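(* Let $(A,\circ)$ be a finite-dimensional Novikov algebra over $\mathbf{k}$, $(B=\oplus_{i\in\mathbb{Z}}B_i,\diamond,(\cdot,\cdot))$ a quadratic $\mathbb{Z}$-graded right Novikov algebra, and $L=A\otimes B$ the induced Lie algebra. Let $r=\sum_\alpha x_\alpha\otimes y_\alpha\in A\otimes A$ be a skewsymmetric solution of the Novikov Yang-Baxter equation in $A$, and define $\Delta_r:A\to A\otimes A$ by $\Delta_r(a)=(L_A(a)\otimes\mathrm{id}+\mathrm{id}\otimes L_{A,\star}(a))r$. Then $(A,\circ,-\Delta_r)$ is a Novikov bialgebra, and hence $(L,[\cdot,\cdot],\delta)$ is a completed Lie bialgebra, where $$\delta(a\otimes b)=(\mathrm{id}_{L\widehat{\otimes}L}-\widehat{\tau})\big((-\Delta_r(a))\bullet\Delta_B(b)\big)\quad(a\in A,\ b\in B)$$ and $\Delta_B:B\to B\,\widehat{\otimes}\,B$ is given by $(\Delta_B(a),b\otimes c)=(a,b\diamond c)$ for $a,b,c\in B$. It coincides with the completed Lie bialgebra whose cobracket is $$x\mapsto(\mathrm{ad}_x\,\widehat{\otimes}\,\mathrm{id}+\mathrm{id}\,\widehat{\otimes}\,\mathrm{ad}_x)r_L\quad(x\in L),$$ where $r_L:=\sum_{p\in\Pi}\sum_\alpha(x_\alpha\otimes e_p)\otimes(y_\alpha\otimes f_p)\in L\,\widehat{\otimes}\,L$ for a homogeneous basis $\{e_p\}_{p\in\Pi}$ of $B$ with homogeneous dual basis $\{f_p\}_{p\in\Pi}$ with respect to $(\cdo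t,\cdot)$.
   Context: $\mathbf{k}$ is a field of characteristic zero; $\tau$ is the flip. A Novikov algebra $(A,\circ)$: $(a\circ b)\circ c-a\circ(b\circ c)=(b\circ a)\circ c-b\circ(a\circ c)$ and $(a\circ b)\circ c=(a\circ c)\circ b$. Put $L_A(a)b=a\circ b$, $R_A(a)b=b\circ a$, $L_{A,\star}=L_A+R_A$. A right Novikov algebra $(B,\diamond)$: $(a\diamond b)\diamond c-a\diamond(b\diamond c)=(a\diamond c)\diamond b-a\diamond(c\diamond b)$ and $a\diamond(b\diamond c)=b\diamond(a\diamond c)$. Quadratic $\mathbb{Z}$-graded: $B=\oplus B_i$, each $B_i$ finite-dimensional, $B_i\diamond B_j\subset B_{i+j}$, with a symmetric nondegenerate bilinear form that is graded (for some $m\in\mathbb{Z}$, $(B_i,B_j)=0$ whenever $i+j+m\neq0$) and satisfies $(a\diamond b,c)=-(a,b\diamond c+c\diamond b)$. Dual basis: $(e_p,f_q)=\delta_{p,q}$. Induced Lie algebra: $[a_1\otimes b_1,a_2\otimes b_2]=a_1\circ a_2\otimes b_1\diamond b_2-a_2\circ a_1\otimes b_2\diamond b_1$ on $L=A\otimes B$, graded by $L_i=A\otimes B_i$. Novikov Yang-Baxter equation (NYBE) for $r=\sum x_\alpha\otimes y_\alpha$: $\sum_{\alpha,\beta}\big(x_\alpha\otimes x_\beta\otimes y_\alpha\circ y_\beta+x_\alpha\otimes(y_\alpha\circ x_\beta+x_\beta\circ y_\alpha)\otimes y_\beta+x_\alpha\circ x_\beta\otimes y_\beta\otimes y_\alpha\big)=0$;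 skewsymmetric: $\tau r=-r$. Novikov coalgebra $(A,\Delta)$: $(\mathrm{id}\otimes\Delta)\Delta-(\tau\otimes\mathrm{id})(\mathrm{id}\otimes\Delta)\Delta=(\Delta\otimes\mathrm{id})\Delta-(\tau\otimes\mathrm{id})(\Delta\otimes\mathrm{id})\Delta$ and $(\tau\otimes\mathrm{id})(\mathrm{id}\otimes\Delta)\tau\Delta=(\Delta\otimes\mathrm{id})\Delta$. Novikov bialgebra $(A,\circ,\Delta)$: Novikov algebra and Novikov coalgebra with, for all $a,b$: $\Delta(a\circ b)=(R_A(b)\otimes\mathrm{id})\Delta(a)+(\mathrm{id}\otimes L_{A,\star}(a))(\Delta(b)+\tau\Delta(b))$; $(L_{A,\star}(a)\otimes\mathrm{id})\Delta(b)-(\mathrm{id}\otimes L_{A,\star}(a))\tau\Delta(b)=(L_{A,\star}(b)\otimes\mathrm{id})\Delta(a)-(\mathrm{id}\otimes L_{A,\star}(b))\tau\Delta(a)$; $(\mathrm{id}\otimes R_A(a)-R_A(a)\otimes\mathrm{id})(\Delta(b)+\tau\Delta(b))=(\mathrm{id}\otimes R_A(b)-R_A(b)\otimes\mathrm{id})(\Delta(a)+\tau\Delta(a))$. Completed tensor products: $C\,\widehat{\otimes}\,D:=\prod_{i,j}C_i\otimes D_j$ for $\mathbb{Z}$-graded spaces (similarly three factors), elements written as formal sums $\sum_{i,j,\alpha}c_{i\alpha}\otimes d_{j\alpha}$ of homogeneous elements with finitely many $\alpha$ per $(i,j)$; $f\,\widehat{\otimes}\,g$, the flip $\widehat{\tau}$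 and iterated coproducts are defined termwise (understood to be well defined, i.e. finitely many contributions in each multidegree). The pairing of $\sum a_{1i\alpha}\otimes a_{2j\alpha}$ with $b\otimes c$ is $\sum(a_{1i\alpha},b)(a_{2j\alpha},c)$. For $u=\sum a'\otimes a''\in A\otimes A$ and $v=\sum b_{1i\alpha}\otimes b_{2j\alpha}\in B\,\widehat{\otimes}\,B$, $u\bullet v=\sum(a'\otimes b_{1i\alpha})\otimes(a''\otimes b_{2j\alpha})$. A completed Lie bialgebra $(L,[\cdot,\cdot],\delta)$: $L$ a $\mathbb{Z}$-graded space with Lie bracket, $\delta:L\to L\,\widehat{\otimes}\,L$ linear with $\delta=-\widehat{\tau}\delta$, $(\mathrm{id}\,\widehat{\otimes}\,\delta)\delta-(\widehat{\tau}\,\widehat{\otimes}\,\mathrm{id})(\mathrm{id}\,\widehat{\otimes}\,\delta)\delta=(\delta\,\widehat{\otimes}\,\mathrm{id})\delta$, and $\delta([a,b])=(\mathrm{ad}_a\widehat{\otimes}\,\mathrm{id}+\mathrm{id}\,\widehat{\otimes}\,\mathrm{ad}_a)\delta(b)-(\mathrm{ad}_b\widehat{\otimes}\,\mathrm{id}+\mathrm{id}\,\widehat{\otimes}\,\mathrm{ad}_b)\delta(a)$, with $\mathrm{ad}_a(b)=[a,b]$. *)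

theory Defs
  imports Complex_Main "HOL-Library.Function_Algebras" "HOL-Library.Groups_Big_Fun"
begin

section \<open>Vector spaces and linear maps on carriers\<close>

text \<open>A subspace \<open>vcar V\<close> of a vector space living on a whole type, with scalar
  multiplication \<open>vscl V\<close>.\<close>

record ('k, 'v) vs =
  vcar :: "'v set"
  vscl :: "'k \<Rightarrow> 'v \<Rightarrow> 'v"

definition is_vs :: "('k::field, 'v::ab_group_add) vs \<Rightarrow> bool" where
  "is_vs V \<longleftrightarrow> vector_space (vscl V) \<and> module.subspace (vscl V) (vcar V)"

definition whole :: "('k \<Rightarrow> 'v \<Rightarrow> 'v) \<Rightarrow> ('k, 'v) vs" where
  "whole s = \<lparr>vcar = UNIV, vscl = s\<rparr>"

definition linear_on ::
  "('k, 'v::plus) vs \<Rightarrow> ('k \<Rightarrow> 'z \<Rightarrow> 'z) \<Rightarrow> ('v \<Rightarrow> 'z::plus) \<Rightarrow> bool" where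
  "linear_on V sZ f \<longleftrightarrow>
     (\<forall>x\<in>vcar V. \<forall>y\<in>vcar V. f (x + y) = f x + f y) \<and>
     (\<forall>c. \<forall>x\<in>vcar V. f (vscl V c x) = sZ c (f x))"

definition bilinear_on ::
  "('k, 'v::plus) vs \<Rightarrow> ('k, 'w::plus) vs \<Rightarrow> ('k \<Rightarrow> 'z \<Rightarrow> 'z) \<Rightarrow> ('v \<Rightarrow> 'w \<Rightarrow> 'z::plus) \<Rightarrow> bool" where
  "bilinear_on V W sZ F \<longleftrightarrow>
     (\<forall>w\<in>vcar W. linear_on V sZ (\<lambda>v. F v w)) \<and> (\<forall>v\<in>vcar V. linear_on W sZ (F v))"

section \<open>Tensor products\<close>

text \<open>Over a field, \<open>V \<otimes> W\<close> embeds into the functions of pairs of linear functionals by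
  \<open>v \<otimes> w \<mapsto> (\<phi>, \<psi>) \<mapsto> \<phi> v * \<psi> w\<close>; it is realised as the span of these functions.
  The functionals are those of the ambient types, so for subspaces \<open>V'\<close> of \<open>V\<close> and
  \<open>W'\<close> of \<open>W\<close> the space \<open>V' \<otimes> W'\<close> is literally a subspace of \<open>V \<otimes> W\<close>.
  The model is only used through its universal property, proved in \<open>tlift_universal\<close>
  and \<open>tensor_linear_unique\<close> below.\<close>

type_synonym ('k, 'v, 'w) tens = "('v \<Rightarrow> 'k) \<Rightarrow> ('w \<Rightarrow> 'k) \<Rightarrow> 'k"

definition tscale :: "'k::field \<Rightarrow> ('k, 'v, 'w) tens \<Rightarrow> ('k, 'v, 'w) tens" where
  "tscale c t = (\<lambda>\<phi> \<psi>. c * t \<phi> \<psi>)"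

definition tens ::
  "('k::field, 'v::ab_group_add) vs \<Rightarrow> ('k, 'w::ab_group_add) vs \<Rightarrow> 'v \<Rightarrow> 'w \<Rightarrow> ('k, 'v, 'w) tens" where
  "tens V W v w = (\<lambda>\<phi> \<psi>.
     if Vector_Spaces.linear (vscl V) (*) \<phi> \<and> Vector_Spaces.linear (vscl W) (*) \<psi>
     then \<phi> v * \<psi> w else 0)"

definition tensor ::
  "('k::field, 'v::ab_group_add) vs \<Rightarrow> ('k, 'w::ab_group_add) vs \<Rightarrow> ('k, ('k, 'v, 'w) tens) vs" where
  "tensor V W =
     \<lparr>vcar = module.span tscale {tens V W v w | v w. v \<in> vcar V \<and> w \<in> vcar W}, vscl = tscale\<rparr>"

text \<open>The linear map induced by a bilinear map \<open>F\<close> on \<open>V \<times> W\<close>; it is determined on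
  \<open>vcar (tensor V W)\<close>, and its values elsewhere are irrelevant.\<close>

definition tlift ::
  "('k::field, 'v::ab_group_add) vs \<Rightarrow> ('k, 'w::ab_group_add) vs \<Rightarrow> ('k \<Rightarrow> 'z \<Rightarrow> 'z) \<Rightarrow>
   ('v \<Rightarrow> 'w \<Rightarrow> 'z) \<Rightarrow> ('k, 'v, 'w) tens \<Rightarrow> 'z::ab_group_add" where
  "tlift V W sZ F = (SOME g. Vector_Spaces.linear tscale sZ g \<and>
     (\<forall>v\<in>vcar V. \<forall>w\<in>vcar W. g (tens V W v w) = F v w))"

text \<open>\<open>f \<otimes> g : V \<otimes> W \<rightarrow> V' \<otimes> W'\<close>.\<close>

definition tmap ::
  "('k::field, 'v::ab_group_add) vs \<Rightarrow> ('k, 'w::ab_group_add) vs \<Rightarrow>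
   ('k, 'v2::ab_group_add) vs \<Rightarrow> ('k, 'w2::ab_group_add) vs \<Rightarrow>
   ('v \<Rightarrow> 'v2) \<Rightarrow> ('w \<Rightarrow> 'w2) \<Rightarrow> ('k, 'v, 'w) tens \<Rightarrow> ('k, 'v2, 'w2) tens" where
  "tmap V W V' W' f g = tlift V W tscale (\<lambda>v w. tens V' W' (f v) (g w))"

definition tflip ::
  "('k::field, 'v::ab_group_add) vs \<Rightarrow> ('k, 'w::ab_group_add) vs \<Rightarrow>
   ('k, 'v, 'w) tens \<Rightarrow> ('k, 'w, 'v) tens" where
  "tflip V W = tlift V W tscale (\<lambda>v w. tens W V w v)"

text \<open>The identification \<open>u \<otimes> (v \<otimes> w) \<mapsto> (u \<otimes> v) \<otimes> w\<close>. Threefold tensor products are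
  always bracketed to the left.\<close>

definition tassoc ::
  "('k::field, 'u::ab_group_add) vs \<Rightarrow> ('k, 'v::ab_group_add) vs \<Rightarrow> ('k, 'w::ab_group_add) vs \<Rightarrow>
   ('k, 'u, ('k, 'v, 'w) tens) tens \<Rightarrow> ('k, ('k, 'u, 'v) tens, 'w) tens" where
  "tassoc U V W = tlift U (tensor V W) tscale
     (\<lambda>u. tlift V W tscale (\<lambda>v w. tens (tensor U V) W (tens U V u v) w))"

subsection \<open>Universal property\<close>

lemma vector_space_tscale: "vector_space (tscale :: 'k::field \<Rightarrow> ('k, 'v, 'w) tens \<Rightarrow> _)"
  by unfold_locales (auto simp: tscale_def fun_eq_iff algebra_simps)

lemma vector_space_times: "vector_space ((*) :: 'k::field \<Rightarrow> 'k \<Rightarrow> 'k)"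
  by unfold_locales (auto simp: algebra_simps)

lemma is_vs_tensor: "is_vs (tensor V W)"
  unfolding is_vs_def tensor_def
  by (simp add: vector_space_tscale module.subspace_span module_iff_vector_space)

lemma is_vs_whole: "vector_space s \<Longrightarrow> is_vs (whole s)"
  unfolding is_vs_def whole_def
  by (simp add: module.subspace_UNIV module_iff_vector_space)

lemma tens_in_tensor: "v \<in> vcar V \<Longrightarrow> w \<in> vcar W \<Longrightarrow> tens V W v w \<in> vcar (tensor V W)"
  unfolding tensor_def
  by (auto intro!: module.span_base simp: module_iff_vector_space vector_space_tscale)

lemma linear_add': "Vector_Spaces.linear s1 s2 f \<Longrightarrow> f (x + y) = f x + f y"
  and linear_scale': "Vector_Spaces.linear s1 s2 f \<Longrightarrow> f (s1 c x) = s2 c (f x)"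
  by (simp_all add: Vector_Spaces.linear.axioms(3) module_hom.add module_hom.scale
      linear_iff_module_hom)

lemma tens_linear:
  "tens V W v (w + w') = tens V W v w + tens V W v w'"
  "tens V W v (vscl W c w) = tscale c (tens V W v w)"
  "tens V W (v + v') w = tens V W v w + tens V W v' w"
  "tens V W (vscl V c v) w = tscale c (tens V W v w)"
  unfolding tens_def tscale_def fun_eq_iff plus_fun_apply
  by (auto simp: linear_add' linear_scale' distrib_left distrib_right)

lemma bilinear_on_tens: "bilinear_on V W tscale (tens V W)"
  unfolding bilinear_on_def linear_on_def by (blast intro: tens_linear)

lemma tlift_exists:
  fixes V :: "('k::field, 'v::ab_group_add) vs" and W :: "('k, 'w::ab_group_add) vs"
    and sZ :: "'k \<Rightarrow> 'z::ab_group_add \<Rightarrow> 'z"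
  assumes V: "is_vs V" and W: "is_vs W" and Z: "vector_space sZ" and F: "bilinear_on V W sZ F"
  shows "\<exists>g. Vector_Spaces.linear tscale sZ g \<and>
    (\<forall>v\<in>vcar V. \<forall>w\<in>vcar W. g (tens V W v w) = F v w)"
proof -
  interpret V: vector_space "vscl V" using V by (simp add: is_vs_def)
  interpret W: vector_space "vscl W" using W by (simp add: is_vs_def)
  interpret Z: vector_space sZ by fact
  interpret T: vector_space "tscale :: 'k \<Rightarrow> ('k, 'v, 'w) tens \<Rightarrow> _" by (rule vector_space_tscale)
  interpret K: vector_space "(*) :: 'k \<Rightarrow> 'k \<Rightarrow> 'k" by (rule vector_space_times)
  interpret VK: vector_space_pair "vscl V" "(*) :: 'k \<Rightarrow> 'k \<Rightarrow> 'k" by unfold_locales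
  interpret WK: vector_space_pair "vscl W" "(*) :: 'k \<Rightarrow> 'k \<Rightarrow> 'k" by unfold_locales
  interpret TZ: vector_space_pair "tscale :: 'k \<Rightarrow> ('k, 'v, 'w) tens \<Rightarrow> _" sZ by unfold_locales
  have sV: "V.subspace (vcar V)" and sW: "W.subspace (vcar W)" using V W by (auto simp: is_vs_def)
  obtain P where P: "P \<subseteq> vcar V" "V.independent P" "vcar V \<subseteq> V.span P"
    using V.maximal_independent_subset by blast
  obtain Q where Q: "Q \<subseteq> vcar W" "W.independent Q" "vcar W \<subseteq> W.span Q"
    using W.maximal_independent_subset by blast
  have "\<exists>\<phi>. \<forall>b. Vector_Spaces.linear (vscl V) (*) (\<phi> b) \<and> (\<forall>x\<in>P. \<phi> b x = (if x = b then 1 else 0))"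
    by (rule choice, rule allI, rule VK.linear_independent_extend[OF P(2)])
  then obtain \<phi> where \<phi>: "\<And>b. Vector_Spaces.linear (vscl V) (*) (\<phi> b)"
    "\<And>b x. x \<in> P \<Longrightarrow> \<phi> b x = (if x = b then 1 else 0)" by blast
  have "\<exists>\<psi>. \<forall>b. Vector_Spaces.linear (vscl W) (*) (\<psi> b) \<and> (\<forall>x\<in>Q. \<psi> b x = (if x = b then 1 else 0))"
    by (rule choice, rule allI, rule WK.linear_independent_extend[OF Q(2)])
  then obtain \<psi> where \<psi>: "\<And>b. Vector_Spaces.linear (vscl W) (*) (\<psi> b)"
    "\<And>b x. x \<in> Q \<Longrightarrow> \<psi> b x = (if x = b then 1 else 0)" by blast
  define E where "E = (\<lambda>(b, c). tens V W b c)"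
  have ev: "E p (\<phi> b) (\<psi> c) = (if p = (b, c) then 1 else 0)" if "p \<in> P \<times> Q" for p b c
    using that \<phi> \<psi> by (auto simp: E_def tens_def split: if_splits)
  have inj: "inj_on E (P \<times> Q)"
  proof (rule inj_onI)
    fix p q assume pq: "p \<in> P \<times> Q" "q \<in> P \<times> Q" "E p = E q"
    show "p = q"
      using ev[OF pq(1), of "fst q" "snd q"] ev[OF pq(2), of "fst q" "snd q"] pq(3)
      by (simp split: if_splits)
  qed
  have ind: "T.independent (E ` (P \<times> Q))"
  proof
    assume "T.dependent (E ` (P \<times> Q))"
    then obtain t u where t: "finite t" "t \<subseteq> E ` (P \<times> Q)" "(\<Sum>v\<in>t. tscale (u v) v) = 0"
      and "\<exists>v\<in>t. u v \<noteq> 0"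
      by (auto simp: T.dependent_explicit)
    then obtain b c where bc: "b \<in> P" "c \<in> Q" "E (b, c) \<in> t" "u (E (b, c)) \<noteq> 0" by blast
    have sum_app: "(\<Sum>v\<in>S. f v) x y = (\<Sum>v\<in>S. f v x y)"
      for S and f :: "('k, 'v, 'w) tens \<Rightarrow> ('k, 'v, 'w) tens" and x y
      by (induction S rule: infinite_finite_induct) auto
    have "0 = (\<Sum>v\<in>t. tscale (u v) v) (\<phi> b) (\<psi> c)" using t(3) by simp
    also have "\<dots> = (\<Sum>v\<in>t. u v * v (\<phi> b) (\<psi> c))" by (simp add: sum_app tscale_def)
    also have "\<dots> = (\<Sum>v\<in>t. if v = E (b, c) then u v else 0)"
    proof (rule sum.cong)
      fix v assume "v \<in> t"
      then obtain p where p: "p \<in> P \<times> Q" "v = E p" using t(2) by blast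
      then have "v = E (b, c) \<longleftrightarrow> p = (b, c)" using inj bc(1,2) by (auto dest: inj_onD)
      then show "u v * v (\<phi> b) (\<psi> c) = (if v = E (b, c) then u v else 0)"
        using ev[OF p(1)] p(2) by simp
    qed simp
    also have "\<dots> = u (E (b, c))" using t(1) bc(3) by simp
    finally show False using bc(4) by simp
  qed
  obtain g where g: "Vector_Spaces.linear tscale sZ g"
    "\<And>x. x \<in> E ` (P \<times> Q) \<Longrightarrow> g x = case_prod F (inv_into (P \<times> Q) E x)"
    using TZ.linear_independent_extend[OF ind, of "\<lambda>x. case_prod F (inv_into (P \<times> Q) E x)"] by blast
  have gE: "g (tens V W b c) = F b c" if "b \<in> P" "c \<in> Q" for b c
  proof -
    have bc: "(b, c) \<in> P \<times> Q" using that by simp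
    have "g (E (b, c)) = case_prod F (b, c)"
      using g(2)[OF imageI[OF bc]] unfolding inv_into_f_f[OF inj bc] .
    then show ?thesis unfolding E_def by simp
  qed
  have F1: "\<And>v w w'. v \<in> vcar V \<Longrightarrow> w \<in> vcar W \<Longrightarrow> w' \<in> vcar W \<Longrightarrow> F v (w + w') = F v w + F v w'"
    "\<And>v w c. v \<in> vcar V \<Longrightarrow> w \<in> vcar W \<Longrightarrow> F v (vscl W c w) = sZ c (F v w)"
    "\<And>v v' w. v \<in> vcar V \<Longrightarrow> v' \<in> vcar V \<Longrightarrow> w \<in> vcar W \<Longrightarrow> F (v + v') w = F v w + F v' w"
    "\<And>v w c. v \<in> vcar V \<Longrightarrow> w \<in> vcar W \<Longrightarrow> F (vscl V c v) w = sZ c (F v w)"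
    using F by (auto simp: bilinear_on_def linear_on_def)
  note T1 = tens_linear[of V W]
  have gw: "w \<in> vcar W \<and> g (tens V W b w) = F b w" if b: "b \<in> P" and "w \<in> W.span Q" for b w
    using that(2)
  proof (induction rule: W.span_induct_alt)
    case base
    have 0: "b \<in> vcar V" "0 \<in> vcar W" using b P(1) W.subspace_0[OF sW] by auto
    have "g (tens V W b (vscl W 0 0)) = sZ 0 (g (tens V W b 0))"
      by (simp only: T1(2) linear_scale'[OF g(1)])
    then have "g (tens V W b 0) = 0" by (simp only: W.scale_zero_left Z.scale_zero_left)
    moreover have "F b 0 = 0"
      using F1(2)[OF 0, of 0] by (simp only: W.scale_zero_left Z.scale_zero_left)
    ultimately show ?case using 0 by simp
  next
    case (step c x y)
    then have x: "x \<in> vcar W" "vscl W c x \<in> vcar W" and y: "y \<in> vcar W"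
      and bV: "b \<in> vcar V" and eq: "g (tens V W b x) = F b x" "g (tens V W b y) = F b y"
      using b P(1) Q(1) W.subspace_scale[OF sW] gE by blast+
    have "g (tens V W b (vscl W c x + y)) = sZ c (g (tens V W b x)) + g (tens V W b y)"
      by (simp only: T1(1,2) linear_add'[OF g(1)] linear_scale'[OF g(1)])
    also have "\<dots> = F b (vscl W c x + y)"
      by (simp only: eq F1(1)[OF bV x(2) y] F1(2)[OF bV x(1)])
    finally show ?case using W.subspace_add[OF sW x(2) y] by blast
  qed
  have gv: "v \<in> vcar V \<and> g (tens V W v w) = F v w" if w: "w \<in> vcar W" and "v \<in> V.span P" for v w
    using that(2)
  proof (induction rule: V.span_induct_alt)
    case base
    have 0: "0 \<in> vcar V" using V.subspace_0[OF sV] by auto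
    have "g (tens V W (vscl V 0 0) w) = sZ 0 (g (tens V W 0 w))"
      by (simp only: T1(4) linear_scale'[OF g(1)])
    then have "g (tens V W 0 w) = 0" by (simp only: V.scale_zero_left Z.scale_zero_left)
    moreover have "F 0 w = 0"
      using F1(4)[OF 0 w, of 0] by (simp only: V.scale_zero_left Z.scale_zero_left)
    ultimately show ?case using 0 by simp
  next
    case (step c x y)
    then have x: "x \<in> vcar V" "vscl V c x \<in> vcar V" and y: "y \<in> vcar V"
      and eq: "g (tens V W x w) = F x w" "g (tens V W y w) = F y w"
      using w P(1) Q(3) V.subspace_scale[OF sV] gw by blast+
    have "g (tens V W (vscl V c x + y) w) = sZ c (g (tens V W x w)) + g (tens V W y w)"
      by (simp only: T1(3,4) linear_add'[OF g(1)] linear_scale'[OF g(1)])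
    also have "\<dots> = F (vscl V c x + y) w"
      by (simp only: eq F1(3)[OF x(2) y w] F1(4)[OF x(1) w])
    finally show ?case using V.subspace_add[OF sV x(2) y] by blast
  qed
  show ?thesis using g(1) gv P(3) by blast
qed

theorem tlift_universal:
  assumes "is_vs V" and "is_vs W" and "vector_space sZ" and "bilinear_on V W sZ F"
  shows "Vector_Spaces.linear tscale sZ (tlift V W sZ F)"
    and "\<And>v w. v \<in> vcar V \<Longrightarrow> w \<in> vcar W \<Longrightarrow> tlift V W sZ F (tens V W v w) = F v w"
  using someI_ex[OF tlift_exists[OF assms]] unfolding tlift_def by blast+

theorem tensor_linear_unique:
  assumes f: "linear_on (tensor V W) sZ f" and g: "linear_on (tensor V W) sZ g"
    and Z: "vector_space sZ"
    and eq: "\<And>v w. v \<in> vcar V \<Longrightarrow> w \<in> vcar W \<Longrightarrow> f (tens V W v w) = g (tens V W v w)"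
    and t: "t \<in> vcar (tensor V W)"
  shows "f t = g t"
proof -
  interpret Z: vector_space sZ by fact
  interpret T: vector_space tscale by (rule vector_space_tscale)
  let ?G = "{tens V W v w | v w. v \<in> vcar V \<and> w \<in> vcar W}"
  have car: "vcar (tensor V W) = T.span ?G" "vscl (tensor V W) = tscale"
    by (simp_all add: tensor_def)
  have t': "t \<in> T.span ?G" using t car by simp
  have "t \<in> T.span ?G \<and> f t = g t"
    using t'
  proof (induction rule: T.span_induct_alt)
    case base
    have "f (tscale 0 0) = sZ 0 (f 0)" "g (tscale 0 0) = sZ 0 (g 0)"
      using f g T.span_zero[of ?G] unfolding linear_on_def car by blast+
    then have "f 0 = g 0" by simp
    then show ?case by (intro conjI T.span_zero)
  next
    case (step c x y)
    then have m: "x \<in> T.span ?G" "tscale c x \<in> T.span ?G" "y \<in> T.span ?G"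
      by (auto intro: T.span_base T.span_scale)
    have "f (tscale c x + y) = sZ c (f x) + f y" "g (tscale c x + y) = sZ c (g x) + g y"
      using f g m unfolding linear_on_def car by auto
    moreover have "f x = g x" using step(1) eq by blast
    ultimately have "f (tscale c x + y) = g (tscale c x + y)" using step by metis
    then show ?case using T.span_add[OF m(2,3)] by blast
  qed
  then show ?thesis by simp
qed

section \<open>Novikov algebras, coalgebras and bialgebras\<close>

definition novikov_algebra :: "('k::field \<Rightarrow> 'a::ab_group_add \<Rightarrow> 'a) \<Rightarrow> ('a \<Rightarrow> 'a \<Rightarrow> 'a) \<Rightarrow> bool" where
  "novikov_algebra s m \<longleftrightarrow> vector_space s \<and> bilinear_on (whole s) (whole s) s m \<and>
     (\<forall>a b c. m (m a b) c - m a (m b c) = m (m b a) c - m b (m a c)) \<and>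
     (\<forall>a b c. m (m a b) c = m (m a c) b)"

definition right_novikov_algebra ::
  "('k::field \<Rightarrow> 'b::ab_group_add \<Rightarrow> 'b) \<Rightarrow> ('b \<Rightarrow> 'b \<Rightarrow> 'b) \<Rightarrow> bool" where
  "right_novikov_algebra s m \<longleftrightarrow> vector_space s \<and> bilinear_on (whole s) (whole s) s m \<and>
     (\<forall>a b c. m (m a b) c - m a (m b c) = m (m a c) b - m a (m c b)) \<and>
     (\<forall>a b c. m a (m b c) = m b (m a c))"

definition Lstar :: "('a \<Rightarrow> 'a \<Rightarrow> 'a::plus) \<Rightarrow> 'a \<Rightarrow> 'a \<Rightarrow> 'a" where
  "Lstar m a b = m a b + m b a"

definition novikov_coalgebra ::
  "('k::field \<Rightarrow> 'a::ab_group_add \<Rightarrow> 'a) \<Rightarrow> ('a \<Rightarrow> ('k, 'a, 'a) tens) \<Rightarrow> bool" where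
  "novikov_coalgebra s \<Delta> \<longleftrightarrow>
     (let A = whole s; AA = tensor A A;
          id\<Delta> = (\<lambda>t. tassoc A A A (tmap A A A AA id \<Delta> t));
          \<Delta>id = tmap A A AA A \<Delta> id;
          \<tau> = tflip A A;
          \<tau>id = tmap AA A AA A \<tau> id
      in vector_space s \<and> linear_on A tscale \<Delta> \<and> (\<forall>a. \<Delta> a \<in> vcar AA) \<and>
         (\<forall>a. id\<Delta> (\<Delta> a) - \<tau>id (id\<Delta> (\<Delta> a)) = \<Delta>id (\<Delta> a) - \<tau>id (\<Delta>id (\<Delta> a))) \<and>
         (\<forall>a. \<tau>id (id\<Delta> (\<tau> (\<Delta> a))) = \<Delta>id (\<Delta> a)))"

definition novikov_bialgebra ::
  "('k::field \<Rightarrow> 'a::ab_group_add \<Rightarrow> 'a) \<Rightarrow> ('a \<Rightarrow> 'a \<Rightarrow> 'a) \<Rightarrow> ('a \<Rightarrow> ('k, 'a, 'a) tens) \<Rightarrow> bool" where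
  "novikov_bialgebra s m \<Delta> \<longleftrightarrow>
     (let A = whole s;
          tm = tmap A A A A;
          \<tau> = tflip A A;
          Ls = Lstar m;
          R = (\<lambda>a b. m b a)
      in novikov_algebra s m \<and> novikov_coalgebra s \<Delta> \<and>
         (\<forall>a b. \<Delta> (m a b) = tm (R b) id (\<Delta> a) + tm id (Ls a) (\<Delta> b + \<tau> (\<Delta> b))) \<and>
         (\<forall>a b. tm (Ls a) id (\<Delta> b) - tm id (Ls a) (\<tau> (\<Delta> b)) =
                tm (Ls b) id (\<Delta> a) - tm id (Ls b) (\<tau> (\<Delta> a))) \<and>
         (\<forall>a b. tm id (R a) (\<Delta> b + \<tau> (\<Delta> b)) - tm (R a) id (\<Delta> b + \<tau> (\<Delta> b)) =
                tm id (R b) (\<Delta> a + \<tau> (\<Delta> a)) - tm (R b) id (\<Delta> a + \<tau> (\<Delta> a))))"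

text \<open>The Novikov Yang-Baxter equation for \<open>r = \<Sum>\<alpha>\<in>I. x \<alpha> \<otimes> y \<alpha>\<close>.\<close>

definition nybe ::
  "('k::field \<Rightarrow> 'a::ab_group_add \<Rightarrow> 'a) \<Rightarrow> ('a \<Rightarrow> 'a \<Rightarrow> 'a) \<Rightarrow>
   'i set \<Rightarrow> ('i \<Rightarrow> 'a) \<Rightarrow> ('i \<Rightarrow> 'a) \<Rightarrow> bool" where
  "nybe s m I x y \<longleftrightarrow>
     (let A = whole s;
          t3 = (\<lambda>a b c. tens (tensor A A) A (tens A A a b) c)
      in (\<Sum>\<alpha>\<in>I. \<Sum>\<beta>\<in>I. t3 (x \<alpha>) (x \<beta>) (m (y \<alpha>) (y \<beta>))
             + t3 (x \<alpha>) (m (y \<alpha>) (x \<beta>) + m (x \<beta>) (y \<alpha>)) (y \<beta>)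
             + t3 (m (x \<alpha>) (x \<beta>)) (y \<beta>) (y \<alpha>)) = 0)"

definition Delta_r ::
  "('k::field \<Rightarrow> 'a::ab_group_add \<Rightarrow> 'a) \<Rightarrow> ('a \<Rightarrow> 'a \<Rightarrow> 'a) \<Rightarrow> ('k, 'a, 'a) tens \<Rightarrow>
   'a \<Rightarrow> ('k, 'a, 'a) tens" where
  "Delta_r s m r a =
     (let A = whole s in tmap A A A A (m a) id r + tmap A A A A id (Lstar m a) r)"

section \<open>Graded spaces and completed tensor products\<close>

definition is_decomp :: "('i \<Rightarrow> 'v set) \<Rightarrow> 'v::comm_monoid_add \<Rightarrow> ('i \<Rightarrow> 'v) \<Rightarrow> bool" where
  "is_decomp G x h \<longleftrightarrow> (\<forall>i. h i \<in> G i) \<and> finite {i. h i \<noteq> 0} \<and> x = Sum_any h"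

definition graded_space :: "('k::field, 'v::ab_group_add) vs \<Rightarrow> (int \<Rightarrow> 'v set) \<Rightarrow> bool" where
  "graded_space V G \<longleftrightarrow> is_vs V \<and>
     (\<forall>i. module.subspace (vscl V) (G i) \<and> G i \<subseteq> vcar V) \<and>
     (\<forall>x\<in>vcar V. \<exists>!h. is_decomp G x h)"

text \<open>The component of degree \<open>i\<close> of \<open>x\<close>.\<close>

definition gcomp :: "(int \<Rightarrow> 'v set) \<Rightarrow> int \<Rightarrow> 'v \<Rightarrow> 'v::ab_group_add" where
  "gcomp G i x = (THE h. is_decomp G x h) i"

text \<open>\<open>V \<otimes>^ W = (\<Prod>i j. V\<^sub>i \<otimes> W\<^sub>j)\<close> as families indexed by the bidegree.\<close>

definition ctensor ::
  "('k::field, 'v::ab_group_add) vs \<Rightarrow> ('i \<Rightarrow> 'v set) \<Rightarrow>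
   ('k, 'w::ab_group_add) vs \<Rightarrow> ('j \<Rightarrow> 'w set) \<Rightarrow> ('i \<Rightarrow> 'j \<Rightarrow> ('k, 'v, 'w) tens) set" where
  "ctensor V G W H =
     {t. \<forall>i j. t i j \<in> vcar (tensor (V\<lparr>vcar := G i\<rparr>) (W\<lparr>vcar := H j\<rparr>))}"

definition ctscale :: "'k::field \<Rightarrow> ('i \<Rightarrow> 'j \<Rightarrow> ('k, 'v, 'w) tens) \<Rightarrow> ('i \<Rightarrow> 'j \<Rightarrow> ('k, 'v, 'w) tens)" where
  "ctscale c t = (\<lambda>i j. tscale c (t i j))"

definition cflip ::
  "('k::field, 'v::ab_group_add) vs \<Rightarrow> ('k, 'w::ab_group_add) vs \<Rightarrow>
   ('i \<Rightarrow> 'j \<Rightarrow> ('k, 'v, 'w) tens) \<Rightarrow> ('j \<Rightarrow> 'i \<Rightarrow> ('k, 'w, 'v) tens)" where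
  "cflip V W t = (\<lambda>j i. tflip V W (t i j))"

text \<open>\<open>f \<otimes>^ g\<close>, where \<open>f\<close> and \<open>g\<close> are given by their homogeneous components \<open>f p\<close> and
  \<open>g q\<close>: the component of degree \<open>(p, q)\<close> of the image of \<open>t\<close> collects the contributions
  \<open>(f p \<otimes> g q) (t i j)\<close> of all \<open>i, j\<close>. The components of the identity are \<open>gcomp G\<close>, and for
  a map into a completed tensor product the index \<open>p\<close> is itself a bidegree. The value is meaningful
  only under \<open>cmap_wd\<close>: there are finitely many contributions in each degree.\<close>

definition cmap ::
  "('k::field, 'v::ab_group_add) vs \<Rightarrow> ('k, 'w::ab_group_add) vs \<Rightarrow>
   ('k, 'v2::ab_group_add) vs \<Rightarrow> ('k, 'w2::ab_group_add) vs \<Rightarrow>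
   ('p \<Rightarrow> 'v \<Rightarrow> 'v2) \<Rightarrow> ('q \<Rightarrow> 'w \<Rightarrow> 'w2) \<Rightarrow>
   ('i \<Rightarrow> 'j \<Rightarrow> ('k, 'v, 'w) tens) \<Rightarrow> ('p \<Rightarrow> 'q \<Rightarrow> ('k, 'v2, 'w2) tens)" where
  "cmap V W V' W' f g t = (\<lambda>p q. Sum_any (\<lambda>(i, j). tmap V W V' W' (f p) (g q) (t i j)))"

definition cmap_wd ::
  "('k::field, 'v::ab_group_add) vs \<Rightarrow> ('k, 'w::ab_group_add) vs \<Rightarrow>
   ('k, 'v2::ab_group_add) vs \<Rightarrow> ('k, 'w2::ab_group_add) vs \<Rightarrow>
   ('p \<Rightarrow> 'v \<Rightarrow> 'v2) \<Rightarrow> ('q \<Rightarrow> 'w \<Rightarrow> 'w2) \<Rightarrow> ('i \<Rightarrow> 'j \<Rightarrow> ('k, 'v, 'w) tens) \<Rightarrow> bool" where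
  "cmap_wd V W V' W' f g t \<longleftrightarrow>
     (\<forall>p q. finite {(i, j). tmap V W V' W' (f p) (g q) (t i j) \<noteq> 0})"

section \<open>Completed Lie bialgebras\<close>

definition lie_algebra :: "('k::field, 'l::ab_group_add) vs \<Rightarrow> ('l \<Rightarrow> 'l \<Rightarrow> 'l) \<Rightarrow> bool" where
  "lie_algebra L br \<longleftrightarrow> is_vs L \<and>
     (\<forall>x\<in>vcar L. \<forall>y\<in>vcar L. br x y \<in> vcar L) \<and>
     bilinear_on L L (vscl L) br \<and>
     (\<forall>x\<in>vcar L. br x x = 0) \<and>
     (\<forall>x\<in>vcar L. \<forall>y\<in>vcar L. \<forall>z\<in>vcar L.
        br x (br y z) + br y (br z x) + br z (br x y) = 0)"

text \<open>\<open>(ad\<^sub>x \<otimes>^ id + id \<otimes>^ ad\<^sub>x) t\<close> for \<open>t \<in> L \<otimes>^ L\<close>.\<close>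

definition ad_act ::
  "('k::field, 'l::ab_group_add) vs \<Rightarrow> (int \<Rightarrow> 'l set) \<Rightarrow> ('l \<Rightarrow> 'l \<Rightarrow> 'l) \<Rightarrow> 'l \<Rightarrow>
   (int \<Rightarrow> int \<Rightarrow> ('k, 'l, 'l) tens) \<Rightarrow> (int \<Rightarrow> int \<Rightarrow> ('k, 'l, 'l) tens)" where
  "ad_act L G br x t =
     (let ad = (\<lambda>p z. gcomp G p (br x z))
      in cmap L L L L ad (gcomp G) t + cmap L L L L (gcomp G) ad t)"

definition ad_act_wd ::
  "('k::field, 'l::ab_group_add) vs \<Rightarrow> (int \<Rightarrow> 'l set) \<Rightarrow> ('l \<Rightarrow> 'l \<Rightarrow> 'l) \<Rightarrow> 'l \<Rightarrow>
   (int \<Rightarrow> int \<Rightarrow> ('k, 'l, 'l) tens) \<Rightarrow> bool" where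
  "ad_act_wd L G br x t \<longleftrightarrow>
     (let ad = (\<lambda>p z. gcomp G p (br x z))
      in cmap_wd L L L L ad (gcomp G) t \<and> cmap_wd L L L L (gcomp G) ad t)"

text \<open>Elements of \<open>L \<otimes>^ L \<otimes>^ L\<close> are families in \<open>(L \<otimes> L) \<otimes> L\<close> indexed by \<open>(i, j)\<close> and \<open>k\<close>.\<close>

definition completed_lie_bialgebra ::
  "('k::field, 'l::ab_group_add) vs \<Rightarrow> (int \<Rightarrow> 'l set) \<Rightarrow> ('l \<Rightarrow> 'l \<Rightarrow> 'l) \<Rightarrow>
   ('l \<Rightarrow> int \<Rightarrow> int \<Rightarrow> ('k, 'l, 'l) tens) \<Rightarrow> bool" where
  "completed_lie_bialgebra L G br \<delta> \<longleftrightarrow>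
     (let LL = tensor L L;
          \<delta>c = (\<lambda>(p, q) z. \<delta> z p q);
          id\<delta> = (\<lambda>t (i, j) k. tassoc L L L (cmap L L L LL (gcomp G) \<delta>c t i (j, k)));
          \<delta>id = cmap L L LL L \<delta>c (gcomp G);
          \<tau>id = (\<lambda>t (i, j) k. tmap LL L LL L (tflip L L) id (t (j, i) k))
      in graded_space L G \<and> lie_algebra L br \<and>
         (\<forall>x\<in>vcar L. \<delta> x \<in> ctensor L G L G) \<and> linear_on L ctscale \<delta> \<and>
         (\<forall>x\<in>vcar L. cmap_wd L L L LL (gcomp G) \<delta>c (\<delta> x) \<and> cmap_wd L L LL L \<delta>c (gcomp G) (\<delta> x)) \<and>
         (\<forall>x\<in>vcar L. \<forall>y\<in>vcar L. ad_act_wd L G br x (\<delta> y)) \<and>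
         (\<forall>x\<in>vcar L. \<delta> x = - cflip L L (\<delta> x)) \<and>
         (\<forall>x\<in>vcar L. id\<delta> (\<delta> x) - \<tau>id (id\<delta> (\<delta> x)) = \<delta>id (\<delta> x)) \<and>
         (\<forall>x\<in>vcar L. \<forall>y\<in>vcar L. \<delta> (br x y) = ad_act L G br x (\<delta> y) - ad_act L G br y (\<delta> x)))"

section \<open>Quadratic graded right Novikov algebras\<close>

definition quadratic_graded_right_novikov ::
  "('k::field \<Rightarrow> 'b::ab_group_add \<Rightarrow> 'b) \<Rightarrow> (int \<Rightarrow> 'b set) \<Rightarrow> ('b \<Rightarrow> 'b \<Rightarrow> 'b) \<Rightarrow>
   ('b \<Rightarrow> 'b \<Rightarrow> 'k) \<Rightarrow> bool" where
  "quadratic_graded_right_novikov s G m form \<longleftrightarrow>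
     right_novikov_algebra s m \<and> graded_space (whole s) G \<and>
     (\<forall>i. \<exists>S. finite S \<and> G i = module.span s S) \<and>
     (\<forall>i j. \<forall>a\<in>G i. \<forall>b\<in>G j. m a b \<in> G (i + j)) \<and>
     bilinear_on (whole s) (whole s) (*) form \<and>
     (\<forall>a b. form a b = form b a) \<and>
     (\<forall>a. (\<forall>b. form a b = 0) \<longrightarrow> a = 0) \<and>
     (\<exists>d. \<forall>i j. i + j + d \<noteq> 0 \<longrightarrow> (\<forall>a\<in>G i. \<forall>b\<in>G j. form a b = 0)) \<and>
     (\<forall>a b c. form (m a b) c = - form a (m b c + m c b))"

text \<open>The pairing of \<open>t \<in> B \<otimes>^ B\<close> with \<open>b \<otimes> c\<close>.\<close>

definition cpairing ::
  "('k::field \<Rightarrow> 'b::ab_group_add \<Rightarrow> 'b) \<Rightarrow> ('b \<Rightarrow> 'b \<Rightarrow> 'k) \<Rightarrow>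
   (int \<Rightarrow> int \<Rightarrow> ('k, 'b, 'b) tens) \<Rightarrow> 'b \<Rightarrow> 'b \<Rightarrow> 'k" where
  "cpairing s form t b c =
     Sum_any (\<lambda>(i, j). tlift (whole s) (whole s) (*) (\<lambda>b1 b2. form b1 b * form b2 c) (t i j))"

definition Delta_B ::
  "('k::field \<Rightarrow> 'b::ab_group_add \<Rightarrow> 'b) \<Rightarrow> (int \<Rightarrow> 'b set) \<Rightarrow> ('b \<Rightarrow> 'b \<Rightarrow> 'b) \<Rightarrow>
   ('b \<Rightarrow> 'b \<Rightarrow> 'k) \<Rightarrow> 'b \<Rightarrow> int \<Rightarrow> int \<Rightarrow> ('k, 'b, 'b) tens" where
  "Delta_B s G m form a = (THE t. t \<in> ctensor (whole s) G (whole s) G \<and>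
     (\<forall>b c. cpairing s form t b c = form a (m b c)))"

definition homogeneous_basis ::
  "('k::field \<Rightarrow> 'b::ab_group_add \<Rightarrow> 'b) \<Rightarrow> (int \<Rightarrow> 'b set) \<Rightarrow> 'p set \<Rightarrow> ('p \<Rightarrow> 'b) \<Rightarrow> bool" where
  "homogeneous_basis s G \<Pi> e \<longleftrightarrow> inj_on e \<Pi> \<and> \<not> module.dependent s (e ` \<Pi>) \<and>
     module.span s (e ` \<Pi>) = UNIV \<and> (\<forall>p\<in>\<Pi>. \<exists>i. e p \<in> G i)"

section \<open>The induced structures on \<open>L = A \<otimes> B\<close>\<close>

definition induced_space ::
  "('k::field \<Rightarrow> 'a::ab_group_add \<Rightarrow> 'a) \<Rightarrow> ('k \<Rightarrow> 'b::ab_group_add \<Rightarrow> 'b) \<Rightarrow>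
   ('k, ('k, 'a, 'b) tens) vs" where
  "induced_space sA sB = tensor (whole sA) (whole sB)"

definition induced_grading ::
  "('k::field \<Rightarrow> 'a::ab_group_add \<Rightarrow> 'a) \<Rightarrow> ('k \<Rightarrow> 'b::ab_group_add \<Rightarrow> 'b) \<Rightarrow> (int \<Rightarrow> 'b set) \<Rightarrow>
   int \<Rightarrow> ('k, 'a, 'b) tens set" where
  "induced_grading sA sB G i = vcar (tensor (whole sA) ((whole sB)\<lparr>vcar := G i\<rparr>))"

text \<open>The bilinear extension of
  \<open>[a1 \<otimes> b1, a2 \<otimes> b2] = mA a1 a2 \<otimes> mB b1 b2 - mA a2 a1 \<otimes> mB b2 b1\<close>.\<close>

definition induced_bracket ::
  "('k::field \<Rightarrow> 'a::ab_group_add \<Rightarrow> 'a) \<Rightarrow> ('a \<Rightarrow> 'a \<Rightarrow> 'a) \<Rightarrow>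
   ('k \<Rightarrow> 'b::ab_group_add \<Rightarrow> 'b) \<Rightarrow> ('b \<Rightarrow> 'b \<Rightarrow> 'b) \<Rightarrow>
   ('k, 'a, 'b) tens \<Rightarrow> ('k, 'a, 'b) tens \<Rightarrow> ('k, 'a, 'b) tens" where
  "induced_bracket sA mA sB mB u v =
     (let A = whole sA; B = whole sB
      in tlift A B tscale (\<lambda>a1 b1. tlift A B tscale (\<lambda>a2 b2.
           tens A B (mA a1 a2) (mB b1 b2) - tens A B (mA a2 a1) (mB b2 b1)) v) u)"

text \<open>\<open>u \<bullet> v\<close>, the bilinear extension of
  \<open>(a' \<otimes> a'') \<bullet> (b1 \<otimes> b2) = (a' \<otimes> b1) \<otimes> (a'' \<otimes> b2)\<close> in each bidegree of \<open>v\<close>.\<close>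

definition bullet ::
  "('k::field \<Rightarrow> 'a::ab_group_add \<Rightarrow> 'a) \<Rightarrow> ('k \<Rightarrow> 'b::ab_group_add \<Rightarrow> 'b) \<Rightarrow>
   ('k, 'a, 'a) tens \<Rightarrow> (int \<Rightarrow> int \<Rightarrow> ('k, 'b, 'b) tens) \<Rightarrow>
   int \<Rightarrow> int \<Rightarrow> ('k, ('k, 'a, 'b) tens, ('k, 'a, 'b) tens) tens" where
  "bullet sA sB u v = (\<lambda>i j.
     (let A = whole sA; B = whole sB; L = induced_space sA sB
      in tlift A A tscale (\<lambda>a' a''. tlift B B tscale (\<lambda>b1 b2.
           tens L L (tens A B a' b1) (tens A B a'' b2)) (v i j)) u))"

text \<open>The linear map on \<open>L\<close> with \<open>a \<otimes> b \<mapsto> (id - \<tau>^) (\<Delta> a \<bullet> \<Delta>B b)\<close>.\<close>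

definition induced_cobracket ::
  "('k::field \<Rightarrow> 'a::ab_group_add \<Rightarrow> 'a) \<Rightarrow> ('a \<Rightarrow> ('k, 'a, 'a) tens) \<Rightarrow>
   ('k \<Rightarrow> 'b::ab_group_add \<Rightarrow> 'b) \<Rightarrow> ('b \<Rightarrow> int \<Rightarrow> int \<Rightarrow> ('k, 'b, 'b) tens) \<Rightarrow>
   ('k, 'a, 'b) tens \<Rightarrow> int \<Rightarrow> int \<Rightarrow> ('k, ('k, 'a, 'b) tens, ('k, 'a, 'b) tens) tens" where
  "induced_cobracket sA \<Delta> sB \<Delta>B x = (\<lambda>i j.
     (let L = induced_space sA sB
      in tlift (whole sA) (whole sB) tscale (\<lambda>a b.
           (bullet sA sB (\<Delta> a) (\<Delta>B b) - cflip L L (bullet sA sB (\<Delta> a) (\<Delta>B b))) i j) x))"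

text \<open>The formal sum of \<open>(x \<alpha> \<otimes> e p) \<otimes> (y \<alpha> \<otimes> f p)\<close> over \<open>p \<in> \<Pi>\<close> and \<open>\<alpha> \<in> I\<close>, sorted by bidegree;
  basis vectors are nonzero, so each \<open>p\<close> occurs in exactly one bidegree.\<close>

definition r_L ::
  "('k::field \<Rightarrow> 'a::ab_group_add \<Rightarrow> 'a) \<Rightarrow> 'i set \<Rightarrow> ('i \<Rightarrow> 'a) \<Rightarrow> ('i \<Rightarrow> 'a) \<Rightarrow>
   ('k \<Rightarrow> 'b::ab_group_add \<Rightarrow> 'b) \<Rightarrow> (int \<Rightarrow> 'b set) \<Rightarrow> 'p set \<Rightarrow> ('p \<Rightarrow> 'b) \<Rightarrow> ('p \<Rightarrow> 'b) \<Rightarrow>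
   int \<Rightarrow> int \<Rightarrow> ('k, ('k, 'a, 'b) tens, ('k, 'a, 'b) tens) tens" where
  "r_L sA I x y sB G \<Pi> e f = (\<lambda>i j.
     (let A = whole sA; B = whole sB; L = induced_space sA sB
      in \<Sum>p\<in>{p\<in>\<Pi>. e p \<in> G i \<and> f p \<in> G j}. \<Sum>\<alpha>\<in>I.
           tens L L (tens A B (x \<alpha>) (e p)) (tens A B (y \<alpha>) (f p))))"

end

theory Submission
  imports Defs
begin

text \<open>The idea is to dualise everything. Let \<open>A*\<close> be the space of linear functionals on \<open>A\<close>. An
  element of a (completed) tensor product is determined by its values at enough pairs or triples of
  functionals, and on such values each statement becomes an identity in \<open>A\<close>, in \<open>A*\<close> or in \<open>B\<close>.

  On the side of \<open>A\<close>, the coproduct \<open>-\<Delta>\<^sub>r\<close> is the transpose of a product \<open>star\<close> on \<open>A*\<close>, and \<open>r\<close> is a map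
  \<open>\<rho> : A* \<rightarrow> A\<close>. Skewsymmetry of \<open>r\<close> gives
  \<open>star \<phi> \<psi> = \<phi> R(\<rho> \<psi>) - \<psi> L\<^sub>\<star>(\<rho> \<phi>)\<close> (\<open>star_rho\<close>), and the Novikov Yang-Baxter
  equation says that \<open>\<rho>\<close> is a homomorphism (\<open>rho_star\<close>). Together they make \<open>(A*, star)\<close> a Novikov
  algebra, which is the coalgebra half of the bialgebra; the compatibility conditions are identities
  between values of \<open>r\<close> that follow from skewsymmetry and the Novikov identities of \<open>A\<close>.

  On the side of \<open>L = A \<otimes> B\<close>, the invariant form identifies \<open>A* \<otimes> B\<close> with a space of functionals
  \<open>F \<phi> b = \<phi> \<otimes> (\<cdot>, b)\<close> on \<open>L\<close> that separates the homogeneous parts. Under this identification the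
  induced cobracket is the transpose of the bracket which the Novikov algebra \<open>A*\<close> and the right
  Novikov algebra \<open>B\<close> induce on \<open>A* \<otimes> B\<close> (\<open>tpair_delta\<close>). So co-Jacobi for \<open>\<delta>\<close> and Jacobi for the
  bracket of \<open>L\<close> are two instances of one lemma, \<open>novikov_tensor_jacobi\<close>.

  Finally, every \<open>r\<^sub>L\<close> pairs with \<open>F \<phi> b \<otimes> F \<psi> c\<close> to \<open>r(\<phi>, \<psi>) (b, c)\<close>, whatever the dual bases, and
  any element with these values has coboundary \<open>\<delta>\<close> (\<open>delta_eq_ad_act\<close>). A coboundary is a cocycle
  because \<open>L \<otimes>^ L\<close> is a representation of \<open>L\<close> (\<open>ad_act_bracket\<close>). The infinite sums cause no
  trouble: a functional that lives in finitely many degrees sees only finitely many terms.\<close>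

section \<open>Linear maps between carriers\<close>

(* Tensors are functions; rewriting their sums pointwise would hide them from the rules about carriers. *)
declare plus_fun_apply [simp del] zero_fun_apply [simp del] minus_apply [simp del] uminus_apply [simp del]

text \<open>Being a vector space is part of the predicate, so that one premise carries all the side
  conditions of the rules for tensor products.\<close>

definition lmap :: "('k::field, 'v::ab_group_add) vs \<Rightarrow> ('k, 'w::ab_group_add) vs \<Rightarrow> ('v \<Rightarrow> 'w) \<Rightarrow> bool" where
  "lmap V W f \<longleftrightarrow> is_vs V \<and> is_vs W \<and> linear_on V (vscl W) f \<and> (\<forall>v\<in>vcar V. f v \<in> vcar W)"

abbreviation functional :: "('k::field, 'v::ab_group_add) vs \<Rightarrow> ('v \<Rightarrow> 'k) \<Rightarrow> bool" where
  "functional V \<equiv> lmap V (whole (*))"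

definition bilin :: "('k::field, 'v::ab_group_add) vs \<Rightarrow> ('k, 'w::ab_group_add) vs \<Rightarrow>
    ('k, 'z::ab_group_add) vs \<Rightarrow> ('v \<Rightarrow> 'w \<Rightarrow> 'z) \<Rightarrow> bool" where
  "bilin V W Z F \<longleftrightarrow> (\<forall>w\<in>vcar W. lmap V Z (\<lambda>v. F v w)) \<and> (\<forall>v\<in>vcar V. lmap W Z (F v))"

text \<open>Equal scalar multiplications make the pure tensors over the subspaces literally equal to those
  over the ambient spaces; this is how a tensor of homogeneous parts is a tensor of the whole spaces.\<close>

definition subsp :: "('k::field, 'v::ab_group_add) vs \<Rightarrow> ('k, 'v) vs \<Rightarrow> bool" where
  "subsp V0 V \<longleftrightarrow> is_vs V0 \<and> is_vs V \<and> vscl V0 = vscl V \<and> vcar V0 \<subseteq> vcar V"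

text \<open>The value of a tensor at \<open>\<Phi> \<otimes> \<Psi>\<close>. The functionals need to be linear on the carriers only;
  for functionals of the ambient types it is plain application, see \<open>tensor_eval\<close>.\<close>

definition tpair :: "('k::field, 'v::ab_group_add) vs \<Rightarrow> ('k, 'w::ab_group_add) vs \<Rightarrow>
    ('v \<Rightarrow> 'k) \<Rightarrow> ('w \<Rightarrow> 'k) \<Rightarrow> ('k, 'v, 'w) tens \<Rightarrow> 'k" where
  "tpair V W \<Phi> \<Psi> = tlift V W (*) (\<lambda>v w. \<Phi> v * \<Psi> w)"

definition separates :: "('k::field, 'v::ab_group_add) vs \<Rightarrow> ('v \<Rightarrow> 'k) set \<Rightarrow> bool" where
  "separates V P \<longleftrightarrow> is_vs V \<and> (\<forall>\<Phi>\<in>P. functional V \<Phi>) \<and> (\<forall>v\<in>vcar V. (\<forall>\<Phi>\<in>P. \<Phi> v = 0) \<longrightarrow> v = 0)"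

lemma whole_simps [simp]: "vcar (whole s) = UNIV" "vscl (whole s) = s"
  by (simp_all add: whole_def)

lemma vscl_tensor [simp]: "vscl (tensor V W) = tscale"
  by (simp add: tensor_def)

lemma is_vs_scalars [simp]: "is_vs (whole ((*) :: 'k::field \<Rightarrow> _))"
  by (rule is_vs_whole[OF vector_space_times])

declare is_vs_tensor [simp]

lemma is_vs_vector_space: "is_vs V \<Longrightarrow> vector_space (vscl V)"
  by (simp add: is_vs_def)

lemma is_vs_zero [simp]: "is_vs V \<Longrightarrow> 0 \<in> vcar V"
  and is_vs_add [simp]: "is_vs V \<Longrightarrow> x \<in> vcar V \<Longrightarrow> y \<in> vcar V \<Longrightarrow> x + y \<in> vcar V"
  and is_vs_scale [simp]: "is_vs V \<Longrightarrow> x \<in> vcar V \<Longrightarrow> vscl V c x \<in> vcar V"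
  and is_vs_minus [simp]: "is_vs V \<Longrightarrow> x \<in> vcar V \<Longrightarrow> - x \<in> vcar V"
  and is_vs_diff [simp]: "is_vs V \<Longrightarrow> x \<in> vcar V \<Longrightarrow> y \<in> vcar V \<Longrightarrow> x - y \<in> vcar V"
  by (auto simp: is_vs_def module_iff_vector_space[symmetric] intro: module.subspace_0
      module.subspace_add module.subspace_scale module.subspace_neg module.subspace_diff)

lemma is_vs_sum: "is_vs V \<Longrightarrow> (\<And>i. i \<in> S \<Longrightarrow> f i \<in> vcar V) \<Longrightarrow> sum f S \<in> vcar V"
  by (induction S rule: infinite_finite_induct) simp_all

lemma is_vs_Sum_any: "is_vs V \<Longrightarrow> (\<And>i. f i \<in> vcar V) \<Longrightarrow> Sum_any f \<in> vcar V"
  by (simp add: Sum_any.expand_set is_vs_sum)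

lemma lmapD:
  assumes "lmap V W f"
  shows "is_vs V" "is_vs W" "\<And>v. v \<in> vcar V \<Longrightarrow> f v \<in> vcar W" "linear_on V (vscl W) f"
  using assms by (auto simp: lmap_def)

lemma lmapI:
  assumes "is_vs V" "is_vs W" "\<And>v. v \<in> vcar V \<Longrightarrow> f v \<in> vcar W"
    "\<And>u v. u \<in> vcar V \<Longrightarrow> v \<in> vcar V \<Longrightarrow> f (u + v) = f u + f v"
    "\<And>c v. v \<in> vcar V \<Longrightarrow> f (vscl V c v) = vscl W c (f v)"
  shows "lmap V W f"
  using assms by (auto simp: lmap_def linear_on_def)

lemma lmap_add: "lmap V W f \<Longrightarrow> u \<in> vcar V \<Longrightarrow> v \<in> vcar V \<Longrightarrow> f (u + v) = f u + f v"
  and lmap_scale: "lmap V W f \<Longrightarrow> v \<in> vcar V \<Longrightarrow> f (vscl V c v) = vscl W c (f v)"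
  by (auto simp: lmap_def linear_on_def)

lemma lmap_zero: "lmap V W f \<Longrightarrow> f 0 = 0"
  using lmap_add[of V W f 0 0] by (simp add: lmapD(1))

lemma lmap_minus: "lmap V W f \<Longrightarrow> v \<in> vcar V \<Longrightarrow> f (- v) = - f v"
  using lmap_add[of V W f v "- v"] by (simp add: lmapD(1) lmap_zero eq_neg_iff_add_eq_0 add.commute)

lemma lmap_diff: "lmap V W f \<Longrightarrow> u \<in> vcar V \<Longrightarrow> v \<in> vcar V \<Longrightarrow> f (u - v) = f u - f v"
  using lmap_add[of V W f u "- v"] by (simp add: lmapD(1) lmap_minus)

lemma lmap_sum: "lmap V W f \<Longrightarrow> (\<And>i. i \<in> S \<Longrightarrow> g i \<in> vcar V) \<Longrightarrow> f (sum g S) = (\<Sum>i\<in>S. f (g i))"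
  by (induction S rule: infinite_finite_induct)
    (auto simp: lmap_zero lmap_add is_vs_sum lmapD(1))

lemma lmap_comp: "lmap V W f \<Longrightarrow> lmap W Z g \<Longrightarrow> lmap V Z (\<lambda>v. g (f v))"
  by (rule lmapI) (auto simp: lmapD lmap_add lmap_scale)

lemma lmap_id: "is_vs V \<Longrightarrow> lmap V V (\<lambda>v. v)"
  by (rule lmapI) auto

lemma lmap_scl: "is_vs V \<Longrightarrow> lmap V V (vscl V c)"
  by (rule lmapI) (auto simp: module_iff_vector_space is_vs_vector_space mult.commute
      module.scale_right_distrib[of "vscl V"] module.scale_scale[of "vscl V"])

lemma lmap_0: "is_vs V \<Longrightarrow> is_vs W \<Longrightarrow> lmap V W (\<lambda>v. 0)"
  by (rule lmapI) (auto simp: module.scale_zero_right module_iff_vector_space is_vs_vector_space)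

lemma lmap_plus: "lmap V W f \<Longrightarrow> lmap V W g \<Longrightarrow> lmap V W (\<lambda>v. f v + g v)"
  by (rule lmapI) (auto simp: lmapD lmap_add lmap_scale algebra_simps module_iff_vector_space
      module.scale_right_distrib[of "vscl W"] is_vs_vector_space)

lemma lmap_uminus: "lmap V W f \<Longrightarrow> lmap V W (\<lambda>v. - f v)"
  by (rule lmapI) (auto simp: lmapD lmap_add lmap_scale algebra_simps module_iff_vector_space
      module.scale_minus_right[of "vscl W"] is_vs_vector_space)

lemma lmap_minus_fun: "lmap V W f \<Longrightarrow> lmap V W g \<Longrightarrow> lmap V W (\<lambda>v. f v - g v)"
  using lmap_plus[of V W f "\<lambda>v. - g v"] by (simp add: lmap_uminus)

lemma functional_mult: "functional V \<Phi> \<Longrightarrow> functional V (\<lambda>v. c * \<Phi> v)"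
  by (rule lmapI) (auto simp: lmapD lmap_add lmap_scale algebra_simps)

lemma functional_mult_right: "functional V \<Phi> \<Longrightarrow> functional V (\<lambda>v. \<Phi> v * c)"
  using functional_mult[of V \<Phi> c] by (simp add: mult.commute)

lemma bilinI:
  assumes "is_vs V" "is_vs W" "is_vs Z" "\<And>v w. v \<in> vcar V \<Longrightarrow> w \<in> vcar W \<Longrightarrow> F v w \<in> vcar Z"
    "\<And>u v w. u \<in> vcar V \<Longrightarrow> v \<in> vcar V \<Longrightarrow> w \<in> vcar W \<Longrightarrow> F (u + v) w = F u w + F v w"
    "\<And>c v w. v \<in> vcar V \<Longrightarrow> w \<in> vcar W \<Longrightarrow> F (vscl V c v) w = vscl Z c (F v w)"
    "\<And>v w z. v \<in> vcar V \<Longrightarrow> w \<in> vcar W \<Longrightarrow> z \<in> vcar W \<Longrightarrow> F v (w + z) = F v w + F v z"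
    "\<And>c v w. v \<in> vcar V \<Longrightarrow> w \<in> vcar W \<Longrightarrow> F v (vscl W c w) = vscl Z c (F v w)"
  shows "bilin V W Z F"
  using assms by (auto simp: bilin_def intro!: lmapI)

lemma bilinD:
  assumes "bilin V W Z F"
  shows "w \<in> vcar W \<Longrightarrow> lmap V Z (\<lambda>v. F v w)" "v \<in> vcar V \<Longrightarrow> lmap W Z (F v)"
  using assms by (auto simp: bilin_def)

text \<open>Pure tensors span the carrier and are sent to \<open>vcar Z\<close>, hence so is the whole carrier.\<close>

lemma
  assumes V: "is_vs V" and W: "is_vs W" and Z: "is_vs Z" and F: "bilin V W Z F"
  shows lmap_tlift: "lmap (tensor V W) Z (tlift V W (vscl Z) F)"
    and tlift_tens: "\<And>v w. v \<in> vcar V \<Longrightarrow> w \<in> vcar W \<Longrightarrow> tlift V W (vscl Z) F (tens V W v w) = F v w"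
proof -
  have b: "bilinear_on V W (vscl Z) F"
    using F by (auto simp: bilin_def bilinear_on_def lmap_def)
  note u = tlift_universal[OF V W is_vs_vector_space[OF Z] b]
  show eq: "\<And>v w. v \<in> vcar V \<Longrightarrow> w \<in> vcar W \<Longrightarrow> tlift V W (vscl Z) F (tens V W v w) = F v w"
    by (rule u(2))
  interpret T: vector_space "tscale :: 'a \<Rightarrow> ('a, 'b, 'c) tens \<Rightarrow> _" by (rule vector_space_tscale)
  have "tlift V W (vscl Z) F t \<in> vcar Z" if "t \<in> vcar (tensor V W)" for t
  proof -
    from that have "t \<in> T.span {tens V W v w | v w. v \<in> vcar V \<and> w \<in> vcar W}"
      by (simp add: tensor_def)
    then show ?thesis
    proof (induction rule: T.span_induct_alt)
      case base
      have "tlift V W (vscl Z) F (tscale 0 0) = vscl Z 0 (tlift V W (vscl Z) F 0)"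
        by (rule linear_scale'[OF u(1)])
      then show ?case
        using Z by (simp add: module.scale_zero_left module_iff_vector_space is_vs_vector_space)
    next
      case (step c x y)
      from step(1) obtain v w where x: "x = tens V W v w" "v \<in> vcar V" "w \<in> vcar W" by blast
      have "F v w \<in> vcar Z" using bilinD(2)[OF F x(2)] x(3) by (rule lmapD(3))
      with step x show ?case using Z
        by (simp add: linear_add'[OF u(1)] linear_scale'[OF u(1)] eq)
    qed
  qed
  then show "lmap (tensor V W) Z (tlift V W (vscl Z) F)"
    using Z u(1) by (intro lmapI) (auto simp: linear_add' linear_scale')
qed

text \<open>A scalar can be absorbed into the first factor and \<open>0\<close> is a pure tensor, so closure under
  addition suffices.\<close>

lemma tensor_induct [consumes 2, case_names tens add]:
  assumes V: "is_vs V" and t: "t \<in> vcar (tensor V W)"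
    and 1: "\<And>v w. v \<in> vcar V \<Longrightarrow> w \<in> vcar W \<Longrightarrow> P (tens V W v w)"
    and 2: "\<And>s t. s \<in> vcar (tensor V W) \<Longrightarrow> t \<in> vcar (tensor V W) \<Longrightarrow> P s \<Longrightarrow> P t \<Longrightarrow> P (s + t)"
    and W: "is_vs W"
  shows "P t"
proof -
  interpret T: vector_space "tscale :: 'a \<Rightarrow> ('a, 'b, 'c) tens \<Rightarrow> _" by (rule vector_space_tscale)
  let ?G = "{tens V W v w | v w. v \<in> vcar V \<and> w \<in> vcar W}"
  have "t \<in> T.span ?G" using t by (simp add: tensor_def)
  then have "t \<in> T.span ?G \<and> P t"
  proof (induction rule: T.span_induct_alt)
    case base
    have "tens V W 0 0 = 0"
      using tens_linear(1)[of V W 0 0 0] by simp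
    then show ?case using 1[of 0 0] V W T.span_zero[of ?G] by simp
  next
    case (step c x y)
    from step(1) obtain v w where x: "x = tens V W v w" "v \<in> vcar V" "w \<in> vcar W" by blast
    have cx: "tscale c x = tens V W (vscl V c v) w" by (simp add: x tens_linear)
    have "tscale c x \<in> T.span ?G" using x by (intro T.span_scale T.span_base) blast
    moreover have "P (tscale c x)" unfolding cx using x V by (intro 1) auto
    ultimately show ?case using step(2) 2 by (auto simp: tensor_def intro: T.span_add)
  qed
  then show ?thesis by simp
qed

lemma lmap_tensor_eqI:
  assumes "lmap (tensor V W) Z f" "lmap (tensor V W) Z g" "is_vs V" "is_vs W"
    "\<And>v w. v \<in> vcar V \<Longrightarrow> w \<in> vcar W \<Longrightarrow> f (tens V W v w) = g (tens V W v w)"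
    "t \<in> vcar (tensor V W)"
  shows "f t = g t"
  using assms(3,6) by (induction rule: tensor_induct) (use assms in \<open>auto simp: lmap_add\<close>)

section \<open>Evaluating tensors at functionals\<close>

lemma bilin_functional: "functional V \<Phi> \<Longrightarrow> functional W \<Psi> \<Longrightarrow> bilin V W (whole (*)) (\<lambda>v w. \<Phi> v * \<Psi> w)"
  by (simp add: bilin_def functional_mult functional_mult_right)

lemma functional_tpair: "functional V \<Phi> \<Longrightarrow> functional W \<Psi> \<Longrightarrow> functional (tensor V W) (tpair V W \<Phi> \<Psi>)"
  using lmap_tlift[OF _ _ _ bilin_functional, of V W \<Phi> \<Psi>] by (simp add: tpair_def lmapD(1))

lemma tpair_tens: "functional V \<Phi> \<Longrightarrow> functional W \<Psi> \<Longrightarrow> v \<in> vcar V \<Longrightarrow> w \<in> vcar W \<Longrightarrow>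
    tpair V W \<Phi> \<Psi> (tens V W v w) = \<Phi> v * \<Psi> w"
  using tlift_tens[OF _ _ _ bilin_functional, of V W \<Phi> \<Psi>] by (simp add: tpair_def lmapD(1))

lemmas tpair_add = lmap_add[OF functional_tpair]
lemmas tpair_minus = lmap_minus[OF functional_tpair]
lemmas tpair_diff = lmap_diff[OF functional_tpair]
lemmas tpair_sum = lmap_sum[OF functional_tpair]

lemma subsp_refl [simp]: "is_vs V \<Longrightarrow> subsp V V"
  by (simp add: subsp_def)

lemma subspD: "subsp V0 V \<Longrightarrow> v \<in> vcar V0 \<Longrightarrow> v \<in> vcar V"
  by (auto simp: subsp_def)

lemma lmap_subsp: "subsp V0 V \<Longrightarrow> lmap V W f \<Longrightarrow> lmap V0 W f"
  by (auto simp: subsp_def lmap_def linear_on_def subset_iff)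

lemma tens_subsp: "subsp V0 V \<Longrightarrow> subsp W0 W \<Longrightarrow> tens V0 W0 = tens V W"
  by (intro ext) (simp add: subsp_def tens_def)

lemma subsp_tensor:
  assumes "subsp V0 V" "subsp W0 W" shows "subsp (tensor V0 W0) (tensor V W)"
  unfolding subsp_def
proof (safe intro!: is_vs_tensor)
  fix t assume "t \<in> vcar (tensor V0 W0)"
  with assms(1) have "is_vs V0" "t \<in> vcar (tensor V0 W0)" by (auto simp: subsp_def)
  then show "t \<in> vcar (tensor V W)"
    by (induction rule: tensor_induct) (use assms in \<open>auto simp: tens_subsp[OF assms] subspD subsp_def
      intro!: tens_in_tensor subspD[OF assms(1)] subspD[OF assms(2)]\<close>)
qed simp

text \<open>A tensor sees only the values of the functionals on the subspaces it is built from. Hence a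
  tensor of homogeneous parts may be evaluated in the ambient spaces, and a functional may be replaced
  there by one that agrees with it in the right degree.\<close>

lemma tpair_cong:
  assumes t: "t \<in> vcar (tensor V0 W0)" and s: "subsp V0 V" "subsp W0 W" "subsp V0 V'" "subsp W0 W'"
    and f: "functional V \<Phi>" "functional W \<Psi>" "functional V' \<Phi>'" "functional W' \<Psi>'"
    and eq: "\<And>v. v \<in> vcar V0 \<Longrightarrow> \<Phi> v = \<Phi>' v" "\<And>w. w \<in> vcar W0 \<Longrightarrow> \<Psi> w = \<Psi>' w"
  shows "tpair V W \<Phi> \<Psi> t = tpair V' W' \<Phi>' \<Psi>' t"
proof -
  have v: "is_vs V0" "is_vs W0" using s by (auto simp: subsp_def)
  have "functional (tensor V0 W0) (tpair V W \<Phi> \<Psi>)" "functional (tensor V0 W0) (tpair V' W' \<Phi>' \<Psi>')"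
    using s f by (auto intro: lmap_subsp subsp_tensor functional_tpair)
  then show ?thesis
  proof (rule lmap_tensor_eqI[OF _ _ v _ t])
    fix v w assume vw: "v \<in> vcar V0" "w \<in> vcar W0"
    have "tpair V W \<Phi> \<Psi> (tens V W v w) = tpair V' W' \<Phi>' \<Psi>' (tens V' W' v w)"
      using vw s f eq by (simp add: tpair_tens subspD[OF s(1)] subspD[OF s(2)] subspD[OF s(3)] subspD[OF s(4)])
    then show "tpair V W \<Phi> \<Psi> (tens V0 W0 v w) = tpair V' W' \<Phi>' \<Psi>' (tens V0 W0 v w)"
      using tens_subsp[OF s(1,2)] tens_subsp[OF s(3,4)] by simp
  qed
qed

lemma tpair_cong_whole:
  assumes "t \<in> vcar (tensor V W)" "functional V \<Phi>" "functional W \<Psi>" "functional V \<Phi>'" "functional W \<Psi>'"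
    "\<And>v. v \<in> vcar V \<Longrightarrow> \<Phi> v = \<Phi>' v" "\<And>w. w \<in> vcar W \<Longrightarrow> \<Psi> w = \<Psi>' w"
  shows "tpair V W \<Phi> \<Psi> t = tpair V W \<Phi>' \<Psi>' t"
  using assms by (intro tpair_cong[of t V W]) (auto dest: lmapD(1))

lemma tpair_add_left:
  assumes "t \<in> vcar (tensor V W)" and f: "functional V \<Phi>" "functional V \<Phi>'" "functional W \<Psi>"
  shows "tpair V W (\<lambda>v. \<Phi> v + \<Phi>' v) \<Psi> t = tpair V W \<Phi> \<Psi> t + tpair V W \<Phi>' \<Psi> t"
  by (rule lmap_tensor_eqI[of V W "whole (*)", OF _ _ _ _ _ assms(1)])
    (use f in \<open>auto intro!: functional_tpair lmap_plus simp: tpair_tens lmap_plus distrib_right dest: lmapD(1)\<close>)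

lemma tpair_add_right:
  assumes "t \<in> vcar (tensor V W)" and f: "functional V \<Phi>" "functional W \<Psi>" "functional W \<Psi>'"
  shows "tpair V W \<Phi> (\<lambda>v. \<Psi> v + \<Psi>' v) t = tpair V W \<Phi> \<Psi> t + tpair V W \<Phi> \<Psi>' t"
  by (rule lmap_tensor_eqI[of V W "whole (*)", OF _ _ _ _ _ assms(1)])
    (use f in \<open>auto intro!: functional_tpair lmap_plus simp: tpair_tens lmap_plus distrib_left dest: lmapD(1)\<close>)

lemma tpair_zero_left:
  assumes "t \<in> vcar (tensor V W)" "is_vs V" "functional W \<Psi>"
  shows "tpair V W (\<lambda>v. 0) \<Psi> t = 0"
  using tpair_add_left[OF assms(1) lmap_0[OF assms(2) is_vs_scalars] lmap_0[OF assms(2) is_vs_scalars] assms(3)]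
  by (simp only: add_0_left add_cancel_right_right add_cancel_left_right)

lemma tpair_zero_right:
  assumes "t \<in> vcar (tensor V W)" "is_vs W" "functional V \<Phi>"
  shows "tpair V W \<Phi> (\<lambda>v. 0) t = 0"
  using tpair_add_right[OF assms(1,3) lmap_0[OF assms(2) is_vs_scalars] lmap_0[OF assms(2) is_vs_scalars]]
  by (simp only: add_0_left add_cancel_right_right add_cancel_left_right)

lemma
  assumes v: "is_vs V" and w: "is_vs W"
  shows lmap_tflip: "lmap (tensor V W) (tensor W V) (tflip V W)"
    and tflip_tens: "\<And>v w. v \<in> vcar V \<Longrightarrow> w \<in> vcar W \<Longrightarrow> tflip V W (tens V W v w) = tens W V w v"
proof -
  have b: "bilin V W (tensor W V) (\<lambda>v w. tens W V w v)"
    using v w by (intro bilinI) (auto simp: tens_linear intro: tens_in_tensor)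
  show "lmap (tensor V W) (tensor W V) (tflip V W)"
    "\<And>v w. v \<in> vcar V \<Longrightarrow> w \<in> vcar W \<Longrightarrow> tflip V W (tens V W v w) = tens W V w v"
    using lmap_tlift[OF v w is_vs_tensor b] tlift_tens[OF v w is_vs_tensor b] by (simp_all add: tflip_def)
qed

lemma tpair_tflip:
  assumes \<Phi>: "functional V \<Phi>" and \<Psi>: "functional W \<Psi>" and t: "t \<in> vcar (tensor V W)"
  shows "tpair W V \<Psi> \<Phi> (tflip V W t) = tpair V W \<Phi> \<Psi> t"
  by (rule lmap_tensor_eqI[OF lmap_comp[OF lmap_tflip functional_tpair[OF \<Psi> \<Phi>]]
        functional_tpair[OF \<Phi> \<Psi>] lmapD(1)[OF \<Phi>] lmapD(1)[OF \<Psi>] _ t])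
    (simp_all add: tflip_tens tpair_tens \<Phi> \<Psi> lmapD(1)[OF \<Phi>] lmapD(1)[OF \<Psi>])

text \<open>Contracting one factor of a tensor with \<open>\<Phi>\<close> leaves a vector of the other factor; the pairing is
  the value of this vector at \<open>\<Psi>\<close>.\<close>

lemma tlift_slice:
  assumes "functional V \<Phi>" "is_vs W" "functional W \<Psi>" "t \<in> vcar (tensor V W)"
  shows "\<Psi> (tlift V W (vscl W) (\<lambda>v w. vscl W (\<Phi> v) w) t) = tpair V W \<Phi> \<Psi> t"
    and "tlift V W (vscl W) (\<lambda>v w. vscl W (\<Phi> v) w) t \<in> vcar W"
proof -
  interpret W: vector_space "vscl W" by (rule is_vs_vector_space[OF assms(2)])
  have b: "bilin V W W (\<lambda>v w. vscl W (\<Phi> v) w)"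
    using assms(1,2) by (intro bilinI) (auto simp: lmapD(1) lmap_add lmap_scale W.scale_left_distrib
      W.scale_right_distrib W.scale_scale mult.commute)
  note l = lmap_tlift[OF lmapD(1)[OF assms(1)] assms(2,2) b] and e = tlift_tens[OF lmapD(1)[OF assms(1)] assms(2,2) b]
  show "tlift V W (vscl W) (\<lambda>v w. vscl W (\<Phi> v) w) t \<in> vcar W"
    by (rule lmapD(3)[OF l assms(4)])
  show "\<Psi> (tlift V W (vscl W) (\<lambda>v w. vscl W (\<Phi> v) w) t) = tpair V W \<Phi> \<Psi> t"
    by (rule lmap_tensor_eqI[OF lmap_comp[OF l assms(3)] functional_tpair[OF assms(1,3)] _ assms(2) _ assms(4)])
      (use assms in \<open>auto simp: e tpair_tens lmap_scale[OF assms(3)] dest: lmapD(1)\<close>)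
qed

lemma functional_linear: "is_vs V \<Longrightarrow> Vector_Spaces.linear (vscl V) (*) \<phi> \<Longrightarrow> functional V \<phi>"
  by (rule lmapI) (auto simp: linear_add' linear_scale')

lemma tensor_eval:
  assumes "t \<in> vcar (tensor V W)" "is_vs V" "is_vs W"
  shows "t \<phi> \<psi> = (if Vector_Spaces.linear (vscl V) (*) \<phi> \<and> Vector_Spaces.linear (vscl W) (*) \<psi>
    then tpair V W \<phi> \<psi> t else 0)"
  using assms(2,1)
proof (induction rule: tensor_induct)
  case (tens v w)
  then have "Vector_Spaces.linear (vscl V) (*) \<phi> \<Longrightarrow> Vector_Spaces.linear (vscl W) (*) \<psi> \<Longrightarrow>
      tpair V W \<phi> \<psi> (tens V W v w) = \<phi> v * \<psi> w"
    using assms by (simp add: tpair_tens functional_linear)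
  then show ?case by (auto simp: tens_def[of V W v w])
next
  case (add s t)
  moreover have "(s + t) \<phi> \<psi> = s \<phi> \<psi> + t \<phi> \<psi>" by (simp add: plus_fun_apply)
  ultimately show ?case using assms by (auto simp: tpair_add functional_linear)
qed (rule assms)

text \<open>Slicing twice: the slice along a \<open>\<Phi>\<close> in \<open>P\<close> is killed by \<open>Q\<close>, hence zero, so the pairing with \<open>\<Phi>\<close>
  and any functional vanishes. Exchanging the roles of the factors, it vanishes for any two functionals,
  and in this model a tensor is the function of its values at functionals.\<close>

lemma tensor_zeroI:
  assumes V: "separates V P" and W: "separates W Q" and t: "t \<in> vcar (tensor V W)"
    and z: "\<And>\<Phi> \<Psi>. \<Phi> \<in> P \<Longrightarrow> \<Psi> \<in> Q \<Longrightarrow> tpair V W \<Phi> \<Psi> t = 0"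
  shows "t = 0"
proof -
  have v: "is_vs V" "is_vs W" using V W by (auto simp: separates_def)
  have 1: "tpair V W \<Phi> \<Psi> t = 0" if \<Phi>: "\<Phi> \<in> P" and \<Psi>: "functional W \<Psi>" for \<Phi> \<Psi>
  proof -
    let ?w = "tlift V W (vscl W) (\<lambda>v w. vscl W (\<Phi> v) w) t"
    have f: "functional V \<Phi>" using V \<Phi> by (auto simp: separates_def)
    have "\<And>\<Psi>. \<Psi> \<in> Q \<Longrightarrow> \<Psi> ?w = 0"
      using z[OF \<Phi>] W tlift_slice(1)[OF f v(2) _ t] by (auto simp: separates_def)
    moreover have "?w \<in> vcar W" by (rule tlift_slice(2)[OF f v(2) \<Psi> t])
    ultimately have "?w = 0" using W by (auto simp: separates_def)
    then show ?thesis using tlift_slice(1)[OF f v(2) \<Psi> t] lmap_zero[OF \<Psi>] by simp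
  qed
  have 2: "tpair V W \<Phi> \<Psi> t = 0" if \<Phi>: "functional V \<Phi>" and \<Psi>: "functional W \<Psi>" for \<Phi> \<Psi>
  proof -
    let ?t = "tflip V W t"
    let ?v = "tlift W V (vscl V) (\<lambda>w v. vscl V (\<Psi> w) v) ?t"
    have ft: "?t \<in> vcar (tensor W V)" by (rule lmapD(3)[OF lmap_tflip[OF v] t])
    have e: "\<Phi> ?v = tpair V W \<Phi> \<Psi> t" if "functional V \<Phi>" for \<Phi>
      using tlift_slice(1)[OF \<Psi> v(1) that ft] tpair_tflip[OF that \<Psi> t] by simp
    have "\<And>\<Phi>. \<Phi> \<in> P \<Longrightarrow> \<Phi> ?v = 0"
      using 1[OF _ \<Psi>] V e by (auto simp: separates_def)
    moreover have "?v \<in> vcar V" by (rule tlift_slice(2)[OF \<Psi> v(1) \<Phi> ft])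
    ultimately have "?v = 0" using V by (auto simp: separates_def)
    then show ?thesis using e[OF \<Phi>] lmap_zero[OF \<Phi>] by simp
  qed
  show ?thesis
    by (intro ext) (simp add: tensor_eval[OF t v] 2 functional_linear v zero_fun_apply)
qed

lemma separates_tensor:
  assumes "separates V P" and "separates W Q"
  shows "separates (tensor V W) {tpair V W \<Phi> \<Psi> | \<Phi> \<Psi>. \<Phi> \<in> P \<and> \<Psi> \<in> Q}"
  unfolding separates_def
proof (safe intro!: is_vs_tensor)
  fix \<Phi> \<Psi> assume "\<Phi> \<in> P" "\<Psi> \<in> Q"
  then show "functional (tensor V W) (tpair V W \<Phi> \<Psi>)"
    using assms by (simp add: separates_def functional_tpair)
next
  fix t assume "t \<in> vcar (tensor V W)" "\<forall>\<Xi>\<in>{tpair V W \<Phi> \<Psi> | \<Phi> \<Psi>. \<Phi> \<in> P \<and> \<Psi> \<in> Q}. \<Xi> t = 0"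
  then show "t = 0" by (intro tensor_zeroI[OF assms]) blast+
qed

lemma separates_eqI:
  assumes "separates V P" "u \<in> vcar V" "v \<in> vcar V" "\<And>\<Phi>. \<Phi> \<in> P \<Longrightarrow> \<Phi> u = \<Phi> v"
  shows "u = v"
proof -
  have "\<And>\<Phi>. \<Phi> \<in> P \<Longrightarrow> \<Phi> (u - v) = 0"
    using assms by (auto simp: separates_def lmap_diff)
  moreover have "u - v \<in> vcar V" using assms(1-3) by (simp add: separates_def)
  ultimately have "u - v = 0" using assms(1) unfolding separates_def by blast
  then show ?thesis by simp
qed

lemma separates_functionals:
  assumes "is_vs V" shows "separates V {\<Phi>. functional V \<Phi>}"
  unfolding separates_def
proof (safe intro!: assms)
  fix v assume v: "v \<in> vcar V" "\<forall>\<Phi>\<in>{\<Phi>. functional V \<Phi>}. \<Phi> v = 0"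
  interpret V: vector_space "vscl V" by (rule is_vs_vector_space[OF assms])
  interpret K: vector_space "(*) :: 'a \<Rightarrow> 'a \<Rightarrow> 'a" by (rule vector_space_times)
  interpret VK: vector_space_pair "vscl V" "(*) :: 'a \<Rightarrow> 'a \<Rightarrow> 'a" by unfold_locales
  show "v = 0"
  proof (rule ccontr)
    assume "v \<noteq> 0"
    then have "V.independent {v}" by simp
    then obtain g where "Vector_Spaces.linear (vscl V) (*) g" "g v = 1"
      using VK.linear_independent_extend[of "{v}" "\<lambda>_. 1"] by auto
    moreover from this v functional_linear[OF assms] have "g v = 0" by blast
    ultimately show False by simp
  qed
qed

section \<open>Induced maps on tensor products\<close>

lemma bilin_tens:
  assumes "lmap V V' f" "lmap W W' g" "vcar U = vcar (tensor V' W')" "vscl U = tscale"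
  shows "bilin V W U (\<lambda>v w. tens V' W' (f v) (g w))"
proof -
  have "is_vs U" using assms(3,4) is_vs_tensor[of V' W'] by (simp add: is_vs_def)
  then show ?thesis using assms
    by (intro bilinI) (auto simp: lmapD lmap_add lmap_scale tens_linear intro!: tens_in_tensor)
qed

lemma
  assumes f: "lmap V V' f" and g: "lmap W W' g"
  shows lmap_tmap: "lmap (tensor V W) (tensor V' W') (tmap V W V' W' f g)"
    and tmap_tens: "\<And>v w. v \<in> vcar V \<Longrightarrow> w \<in> vcar W \<Longrightarrow>
      tmap V W V' W' f g (tens V W v w) = tens V' W' (f v) (g w)"
  using lmap_tlift[OF lmapD(1)[OF f] lmapD(1)[OF g] is_vs_tensor bilin_tens[OF f g refl vscl_tensor]]
    tlift_tens[OF lmapD(1)[OF f] lmapD(1)[OF g] is_vs_tensor bilin_tens[OF f g refl vscl_tensor]]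
  by (simp_all add: tmap_def)

text \<open>The maps are formed on the ambient spaces while the tensors live in homogeneous parts; this and
  the corresponding lemmas for \<open>tflip\<close> and \<open>tassoc\<close> keep track of the degrees.\<close>

lemma tmap_in:
  assumes f: "lmap V V' f" and g: "lmap W W' g" and s: "subsp V0 V" "subsp W0 W" "subsp V1 V'" "subsp W1 W'"
    and i: "\<And>v. v \<in> vcar V0 \<Longrightarrow> f v \<in> vcar V1" "\<And>w. w \<in> vcar W0 \<Longrightarrow> g w \<in> vcar W1"
    and t: "t \<in> vcar (tensor V0 W0)"
  shows "tmap V W V' W' f g t \<in> vcar (tensor V1 W1)"
proof -
  have v: "is_vs V0" "is_vs W0" using s by (auto simp: subsp_def)
  note l = lmap_subsp[OF subsp_tensor[OF s(1,2)] lmap_tmap[OF f g]]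
  show ?thesis
    using v(1) t
  proof (induction rule: tensor_induct)
    case (tens v w)
    have "tmap V W V' W' f g (tens V0 W0 v w) = tens V1 W1 (f v) (g w)"
      using tens s by (simp add: tens_subsp[OF s(1,2)] tens_subsp[OF s(3,4)] tmap_tens[OF f g]
          subspD[OF s(1)] subspD[OF s(2)])
    then show ?case using tens i by (simp add: tens_in_tensor)
  next
    case (add s t)
    then show ?case by (simp add: lmap_add[OF l])
  qed (rule v)
qed

lemma tpair_tmap:
  assumes f: "lmap V V' f" and g: "lmap W W' g" and \<Phi>: "functional V' \<Phi>" and \<Psi>: "functional W' \<Psi>"
    and t: "t \<in> vcar (tensor V W)"
  shows "tpair V' W' \<Phi> \<Psi> (tmap V W V' W' f g t) = tpair V W (\<lambda>v. \<Phi> (f v)) (\<lambda>w. \<Psi> (g w)) t"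
  by (rule lmap_tensor_eqI[OF lmap_comp[OF lmap_tmap[OF f g] functional_tpair[OF \<Phi> \<Psi>]]
        functional_tpair[OF lmap_comp[OF f \<Phi>] lmap_comp[OF g \<Psi>]] lmapD(1)[OF f] lmapD(1)[OF g] _ t])
    (simp add: tmap_tens[OF f g] tpair_tens \<Phi> \<Psi> lmap_comp[OF f \<Phi>] lmap_comp[OF g \<Psi>] lmapD[OF f] lmapD[OF g])

lemma tflip_in:
  assumes s: "subsp V0 V" "subsp W0 W" and t: "t \<in> vcar (tensor V0 W0)"
  shows "tflip V W t \<in> vcar (tensor W0 V0)"
proof -
  have v: "is_vs V0" "is_vs W0" "is_vs V" "is_vs W" using s by (auto simp: subsp_def)
  note l = lmap_subsp[OF subsp_tensor[OF s] lmap_tflip[OF v(3,4)]]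
  show ?thesis
    using v(1) t
  proof (induction rule: tensor_induct)
    case (tens v w)
    have "tflip V W (tens V0 W0 v w) = tens W0 V0 w v"
      using tens s v by (simp add: tens_subsp[OF s] tens_subsp[OF s(2,1)] tflip_tens
          subspD[OF s(1)] subspD[OF s(2)])
    then show ?case using tens by (simp add: tens_in_tensor)
  next
    case (add s t)
    then show ?case by (simp add: lmap_add[OF l])
  qed (rule v)
qed

lemma
  assumes u: "is_vs U" and v: "is_vs V" and w: "is_vs W"
  shows lmap_tassoc: "lmap (tensor U (tensor V W)) (tensor (tensor U V) W) (tassoc U V W)"
    and tassoc_tens: "\<And>a b c. a \<in> vcar U \<Longrightarrow> b \<in> vcar V \<Longrightarrow> c \<in> vcar W \<Longrightarrow>
      tassoc U V W (tens U (tensor V W) a (tens V W b c)) = tens (tensor U V) W (tens U V a b) c"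
proof -
  let ?T = "tensor (tensor U V) W"
  let ?f = "\<lambda>a. tlift V W tscale (\<lambda>v w. tens (tensor U V) W (tens U V a v) w)"
  have b: "bilin V W ?T (\<lambda>v w. tens (tensor U V) W (tens U V a v) w)" if "a \<in> vcar U" for a
    using v w that tens_linear[of "tensor U V" W] by (intro bilinI) (auto simp: tens_linear intro!: tens_in_tensor)
  have l: "lmap (tensor V W) ?T (?f a)" if "a \<in> vcar U" for a
    using lmap_tlift[OF v w is_vs_tensor b[OF that]] by simp
  have e: "?f a (tens V W x y) = tens (tensor U V) W (tens U V a x) y"
    if "a \<in> vcar U" "x \<in> vcar V" "y \<in> vcar W" for a x y
    using tlift_tens[OF v w is_vs_tensor b[OF that(1)] that(2,3)] by simp
  have "lmap U ?T (\<lambda>a. ?f a t)" if t: "t \<in> vcar (tensor V W)" for t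
  proof (rule lmapI[OF u is_vs_tensor])
    fix a assume "a \<in> vcar U" then show "?f a t \<in> vcar ?T" using l t by (auto dest: lmapD(3))
  next
    fix a a' assume a: "a \<in> vcar U" "a' \<in> vcar U"
    show "?f (a + a') t = ?f a t + ?f a' t"
      by (rule lmap_tensor_eqI[OF l lmap_plus[OF l l] v w _ t])
        (use a u in \<open>auto simp: e, simp add: tens_linear\<close>)
  next
    fix c a assume a: "a \<in> vcar U"
    have sc: "lmap ?T ?T (tscale c)"
      using lmap_scl[of ?T c] by simp
    show "?f (vscl U c a) t = vscl ?T c (?f a t)"
      unfolding vscl_tensor
      by (rule lmap_tensor_eqI[OF l lmap_comp[OF l sc] v w _ t])
        (use a u tens_linear(4)[of "tensor U V" W] in \<open>auto simp: e, simp add: tens_linear\<close>)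
  qed
  then have b2: "bilin U (tensor V W) ?T ?f" using l by (simp add: bilin_def)
  show "lmap (tensor U (tensor V W)) ?T (tassoc U V W)"
    using lmap_tlift[OF u is_vs_tensor is_vs_tensor b2] by (simp add: tassoc_def)
  fix a b c assume a: "a \<in> vcar U" "b \<in> vcar V" "c \<in> vcar W"
  show "tassoc U V W (tens U (tensor V W) a (tens V W b c)) = tens (tensor U V) W (tens U V a b) c"
    using tlift_tens[OF u is_vs_tensor is_vs_tensor b2] a by (simp add: tassoc_def e tens_in_tensor)
qed

lemma tassoc_in:
  assumes s: "subsp U0 U" "subsp V0 V" "subsp W0 W" and t: "t \<in> vcar (tensor U0 (tensor V0 W0))"
  shows "tassoc U V W t \<in> vcar (tensor (tensor U0 V0) W0)"
proof -
  have v: "is_vs U0" "is_vs V0" "is_vs W0" "is_vs U" "is_vs V" "is_vs W" using s by (auto simp: subsp_def)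
  note sv = subsp_tensor[OF s(2,3)]
  note l = lmap_subsp[OF subsp_tensor[OF s(1) sv] lmap_tassoc[OF v(4-6)]]
  have l2: "lmap (tensor V0 W0) (tensor (tensor U V) W) (\<lambda>x. tassoc U V W (tens U0 (tensor V0 W0) a x))"
    if a: "a \<in> vcar U0" for a
    by (rule lmap_comp[OF lmapI l]) (use a tens_linear[of U0 "tensor V0 W0"] in \<open>auto intro: tens_in_tensor simp: tens_linear\<close>)
  show ?thesis
    using v(1) t
  proof (induction rule: tensor_induct)
    case (tens a x)
    show ?case using v(2) tens(2)
    proof (induction rule: tensor_induct)
      case (tens b c)
      have "tassoc U V W (tens U0 (tensor V0 W0) a (tens V0 W0 b c)) = tens (tensor U0 V0) W0 (tens U0 V0 a b) c"
        using tens \<open>a \<in> vcar U0\<close> v s by (simp add: tens_subsp[OF s(2,3)] tens_subsp[OF s(1) sv] tassoc_tens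
            tens_subsp[OF s(1,2)] tens_subsp[OF subsp_tensor[OF s(1,2)] s(3)] subspD[OF s(1)] subspD[OF s(2)] subspD[OF s(3)])
      then show ?case using tens \<open>a \<in> vcar U0\<close> by (simp add: tens_in_tensor)
    next
      case (add s t)
      then show ?case using lmap_add[OF l2[OF \<open>a \<in> vcar U0\<close>]] by simp
    qed (rule v)
  next
    case (add s t)
    then show ?case by (simp add: lmap_add[OF l])
  qed simp
qed

lemma tpair_tassoc:
  assumes \<Phi>: "functional U \<Phi>" and \<Psi>: "functional V \<Psi>" and \<Xi>: "functional W \<Xi>"
    and t: "t \<in> vcar (tensor U (tensor V W))"
  shows "tpair (tensor U V) W (tpair U V \<Phi> \<Psi>) \<Xi> (tassoc U V W t) = tpair U (tensor V W) \<Phi> (tpair V W \<Psi> \<Xi>) t"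
proof -
  note v = lmapD(1)[OF \<Phi>] lmapD(1)[OF \<Psi>] lmapD(1)[OF \<Xi>]
  note f = functional_tpair[OF \<Phi> \<Psi>] functional_tpair[OF \<Psi> \<Xi>]
  let ?l = "\<lambda>t. tpair (tensor U V) W (tpair U V \<Phi> \<Psi>) \<Xi> (tassoc U V W t)"
  let ?r = "tpair U (tensor V W) \<Phi> (tpair V W \<Psi> \<Xi>)"
  have l: "functional (tensor U (tensor V W)) ?l" and r: "functional (tensor U (tensor V W)) ?r"
    by (rule lmap_comp[OF lmap_tassoc[OF v] functional_tpair[OF f(1) \<Xi>]], rule functional_tpair[OF \<Phi> f(2)])
  show ?thesis
  proof (rule lmap_tensor_eqI[OF l r v(1) is_vs_tensor _ t])
    fix a x assume a: "a \<in> vcar U" and x: "x \<in> vcar (tensor V W)"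
    have ta: "lmap (tensor V W) (tensor U (tensor V W)) (tens U (tensor V W) a)"
      using a v tens_linear[of U "tensor V W"] by (intro lmapI) (auto intro: tens_in_tensor)
    show "?l (tens U (tensor V W) a x) = ?r (tens U (tensor V W) a x)"
      by (rule lmap_tensor_eqI[OF lmap_comp[OF ta l] lmap_comp[OF ta r] v(2,3) _ x])
        (use a v in \<open>simp add: tassoc_tens tpair_tens \<Phi> \<Psi> \<Xi> f tens_in_tensor mult.assoc\<close>)
  qed
qed

section \<open>Graded spaces\<close>

lemma
  assumes "graded_space V G"
  shows graded_is_vs: "is_vs V" and graded_subsp: "subsp (V\<lparr>vcar := G i\<rparr>) V"
    and graded_ex1: "x \<in> vcar V \<Longrightarrow> \<exists>!h. is_decomp G x h" and graded_in: "x \<in> G i \<Longrightarrow> x \<in> vcar V"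
  using assms by (auto simp: graded_space_def subsp_def is_vs_def)

lemma graded_part_is_vs: "graded_space V G \<Longrightarrow> is_vs (V\<lparr>vcar := G i\<rparr>)"
  using graded_subsp by (auto simp: subsp_def)

lemma gcomp_decomp: "graded_space V G \<Longrightarrow> x \<in> vcar V \<Longrightarrow> is_decomp G x (\<lambda>i. gcomp G i x)"
  unfolding gcomp_def using theI'[OF graded_ex1[of V G x]] by simp

lemma gcomp_eqI: "graded_space V G \<Longrightarrow> x \<in> vcar V \<Longrightarrow> is_decomp G x h \<Longrightarrow> gcomp G i x = h i"
  unfolding gcomp_def using the1_equality[OF graded_ex1[of V G x]] by simp

lemma gcomp_in: "graded_space V G \<Longrightarrow> x \<in> vcar V \<Longrightarrow> gcomp G i x \<in> G i"
  using gcomp_decomp unfolding is_decomp_def by blast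

lemma gcomp_add:
  assumes g: "graded_space V G" and x: "x \<in> vcar V" and y: "y \<in> vcar V"
  shows "gcomp G i (x + y) = gcomp G i x + gcomp G i y"
proof (rule gcomp_eqI[OF g])
  show "x + y \<in> vcar V" using x y g by (simp add: graded_is_vs)
  note d = gcomp_decomp[OF g x] gcomp_decomp[OF g y]
  have "\<And>i. gcomp G i x + gcomp G i y \<in> G i"
    using is_vs_add[OF graded_part_is_vs[OF g]] d by (simp add: is_decomp_def)
  moreover have "finite {i. gcomp G i x + gcomp G i y \<noteq> 0}"
    by (rule finite_subset[of _ "{i. gcomp G i x \<noteq> 0} \<union> {i. gcomp G i y \<noteq> 0}"])
      (use d in \<open>auto simp: is_decomp_def\<close>)
  moreover have "x + y = Sum_any (\<lambda>i. gcomp G i x + gcomp G i y)"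
    using d by (subst Sum_any.distrib) (auto simp: is_decomp_def)
  ultimately show "is_decomp G (x + y) (\<lambda>i. gcomp G i x + gcomp G i y)"
    by (simp add: is_decomp_def)
qed

lemma gcomp_scale:
  assumes g: "graded_space V G" and x: "x \<in> vcar V"
  shows "gcomp G i (vscl V c x) = vscl V c (gcomp G i x)"
proof (rule gcomp_eqI[OF g])
  note v = graded_is_vs[OF g]
  show "vscl V c x \<in> vcar V" using x v by simp
  note d = gcomp_decomp[OF g x]
  have z: "vscl V c 0 = 0" using lmap_zero[OF lmap_scl[OF v]] .
  have i: "\<And>i. gcomp G i x \<in> vcar V" using gcomp_in[OF g x] graded_in[OF g] by blast
  have "\<And>i. vscl V c (gcomp G i x) \<in> G i"
    using is_vs_scale[OF graded_part_is_vs[OF g]] d by (simp add: is_decomp_def)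
  moreover have fin: "finite {i. vscl V c (gcomp G i x) \<noteq> 0}"
    by (rule finite_subset[of _ "{i. gcomp G i x \<noteq> 0}"])
      (use d z in \<open>auto simp: is_decomp_def\<close>)
  moreover have "vscl V c x = Sum_any (\<lambda>i. vscl V c (gcomp G i x))"
  proof -
    let ?S = "{i. gcomp G i x \<noteq> 0}"
    have f: "finite ?S" and x: "x = (\<Sum>i\<in>?S. gcomp G i x)"
      using d by (auto simp: is_decomp_def Sum_any.expand_set)
    have "vscl V c x = (\<Sum>i\<in>?S. vscl V c (gcomp G i x))"
      by (subst x) (rule lmap_sum[OF lmap_scl[OF v] i])
    also have "\<dots> = Sum_any (\<lambda>i. vscl V c (gcomp G i x))"
      by (rule Sum_any.expand_superset[symmetric]) (use f z in auto)
    finally show ?thesis .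
  qed
  ultimately show "is_decomp G (vscl V c x) (\<lambda>i. vscl V c (gcomp G i x))"
    by (simp add: is_decomp_def)
qed

lemma lmap_gcomp:
  assumes g: "graded_space V G" shows "lmap V V (gcomp G i)"
  using gcomp_in[OF g] graded_in[OF g] graded_is_vs[OF g]
  by (intro lmapI) (auto simp: gcomp_add[OF g] gcomp_scale[OF g])

lemma gcomp_homog:
  assumes g: "graded_space V G" and x: "x \<in> G i"
  shows "gcomp G j x = (if j = i then x else 0)"
proof (rule gcomp_eqI[OF g graded_in[OF g x]])
  have "0 \<in> G j" for j using is_vs_zero[OF graded_part_is_vs[OF g]] by simp
  moreover have "finite {j. (if j = i then x else 0) \<noteq> 0}"
    by (rule finite_subset[of _ "{i}"]) auto
  moreover have "Sum_any (\<lambda>j. if j = i then x else 0) = x"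
    by (subst Sum_any.expand_superset[of "{i}"]) auto
  ultimately show "is_decomp G x (\<lambda>j. if j = i then x else 0)" using x by (simp add: is_decomp_def)
qed

lemma gcomp_sum:
  assumes g: "graded_space V G" and x: "x \<in> vcar V"
  obtains S where "finite S" "x = (\<Sum>i\<in>S. gcomp G i x)" "\<And>i. i \<notin> S \<Longrightarrow> gcomp G i x = 0"
proof
  show "finite {i. gcomp G i x \<noteq> 0}" "x = (\<Sum>i | gcomp G i x \<noteq> 0. gcomp G i x)"
    using gcomp_decomp[OF g x] by (auto simp: is_decomp_def Sum_any.expand_set)
qed simp

lemma graded_induct [consumes 2, case_names homog add]:
  assumes g: "graded_space V G" and x: "x \<in> vcar V"
    and 1: "\<And>i x. x \<in> G i \<Longrightarrow> P x"
    and 2: "\<And>x y. x \<in> vcar V \<Longrightarrow> y \<in> vcar V \<Longrightarrow> P x \<Longrightarrow> P y \<Longrightarrow> P (x + y)"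
  shows "P x"
proof -
  obtain S where S: "finite S" "x = (\<Sum>i\<in>S. gcomp G i x)" by (rule gcomp_sum[OF g x])
  have i: "\<And>i. gcomp G i x \<in> vcar V" using gcomp_in[OF g x] graded_in[OF g] by blast
  have "P (\<Sum>i\<in>S. gcomp G i x)" using S(1)
  proof induction
    case empty
    have "0 \<in> G 0" using is_vs_zero[OF graded_part_is_vs[OF g]] by simp
    then show ?case using 1 by simp
  next
    case (insert i S)
    have "P (gcomp G i x)" by (rule 1[OF gcomp_in[OF g x]])
    then have "P (gcomp G i x + (\<Sum>i\<in>S. gcomp G i x))"
      by (rule 2[OF i is_vs_sum[OF graded_is_vs[OF g] i] _ insert(3)])
    then show ?case using insert(1,2) by simp
  qed
  then show ?thesis using S(2) by simp
qed

text \<open>The degrees in which a map does not vanish. For a functional these are the degrees it can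
  see in a formal sum.\<close>

definition supp :: "('i \<Rightarrow> 'v set) \<Rightarrow> ('v \<Rightarrow> 'w::zero) \<Rightarrow> 'i set" where
  "supp G f = {i. \<exists>x\<in>G i. f x \<noteq> 0}"

lemma supp_zero: "i \<notin> supp G f \<Longrightarrow> x \<in> G i \<Longrightarrow> f x = 0"
  by (auto simp: supp_def)

lemma supp_subsetI: "(\<And>i x. i \<notin> S \<Longrightarrow> x \<in> G i \<Longrightarrow> f x = 0) \<Longrightarrow> supp G f \<subseteq> S"
  by (auto simp: supp_def)

lemma supp_plus: "supp G (\<lambda>v. f v + g v) \<subseteq> supp G f \<union> supp G (g :: _ \<Rightarrow> 'w::monoid_add)"
  by (rule supp_subsetI) (auto simp: supp_zero)

lemma supp_diff: "supp G (\<lambda>v. f v - g v) \<subseteq> supp G f \<union> supp G (g :: _ \<Rightarrow> 'w::group_add)"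
  by (rule supp_subsetI) (auto simp: supp_zero)

lemma supp_functional_comp:
  assumes "functional V \<Phi>" shows "supp G (\<lambda>v. \<Phi> (f v)) \<subseteq> supp G f"
proof (rule supp_subsetI)
  fix i x assume "i \<notin> supp G f" "x \<in> G i"
  then have "f x = 0" by (rule supp_zero)
  then show "\<Phi> (f x) = 0" by (simp add: lmap_zero[OF assms])
qed

lemma supp_gcomp: "graded_space V G \<Longrightarrow> supp G (gcomp G p) \<subseteq> {p}"
  by (rule supp_subsetI) (auto simp: gcomp_homog)

lemma supp_gcomp_functional:
  "graded_space V G \<Longrightarrow> functional V \<Phi> \<Longrightarrow> supp G (\<lambda>v. \<Phi> (gcomp G p v)) \<subseteq> {p}"
  by (rule supp_subsetI) (auto simp: gcomp_homog lmap_zero)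

text \<open>The components of \<open>x\<close> of degree outside the support are killed, those in the support but not
  occurring in \<open>x\<close> are zero.\<close>

lemma functional_expand:
  assumes g: "graded_space V G" and \<Phi>: "functional V \<Phi>" and S: "finite S" "supp G \<Phi> \<subseteq> S"
    and x: "x \<in> vcar V"
  shows "\<Phi> x = (\<Sum>i\<in>S. \<Phi> (gcomp G i x))"
proof -
  obtain T where T: "finite T" "x = (\<Sum>i\<in>T. gcomp G i x)" "\<And>i. i \<notin> T \<Longrightarrow> gcomp G i x = 0"
    by (rule gcomp_sum[OF g x]) blast
  have i: "\<And>i. gcomp G i x \<in> G i" "\<And>i. gcomp G i x \<in> vcar V"
    using gcomp_in[OF g x] graded_in[OF g] by blast+
  have "\<Phi> x = (\<Sum>i\<in>T. \<Phi> (gcomp G i x))"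
    by (subst T(2)) (rule lmap_sum[OF \<Phi> i(2)])
  also have "\<dots> = (\<Sum>i\<in>T \<union> S. \<Phi> (gcomp G i x))"
    by (rule sum.mono_neutral_left) (use T S lmap_zero[OF \<Phi>] in auto)
  also have "\<dots> = (\<Sum>i\<in>S. \<Phi> (gcomp G i x))"
    by (rule sum.mono_neutral_right) (use T(1) S supp_zero[of _ G \<Phi>, OF _ i(1)] in blast)+
  finally show ?thesis .
qed

section \<open>Evaluating completed tensors\<close>

text \<open>The pairing of a formal sum with a pair of functionals; the pairing with \<open>b \<otimes> c\<close> for an
  invariant form is the case of the functionals \<open>(\<cdot>, b)\<close> and \<open>(\<cdot>, c)\<close>.\<close>

definition cpair :: "('k::field, 'v::ab_group_add) vs \<Rightarrow> ('k, 'w::ab_group_add) vs \<Rightarrow>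
    ('v \<Rightarrow> 'k) \<Rightarrow> ('w \<Rightarrow> 'k) \<Rightarrow> ('i \<Rightarrow> 'j \<Rightarrow> ('k, 'v, 'w) tens) \<Rightarrow> 'k" where
  "cpair V W \<Phi> \<Psi> t = Sum_any (\<lambda>(i, j). tpair V W \<Phi> \<Psi> (t i j))"

text \<open>The graded dual. At two such functionals a formal sum evaluates to a finite sum, which makes
  the pairing bilinear in them.\<close>

definition gdual :: "('k::field, 'v::ab_group_add) vs \<Rightarrow> ('i \<Rightarrow> 'v set) \<Rightarrow> ('v \<Rightarrow> 'k) \<Rightarrow> bool" where
  "gdual V G \<Phi> \<longleftrightarrow> functional V \<Phi> \<and> finite (supp G \<Phi>)"

lemma gdualD: "gdual V G \<Phi> \<Longrightarrow> functional V \<Phi>" "gdual V G \<Phi> \<Longrightarrow> finite (supp G \<Phi>)"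
  by (auto simp: gdual_def)

lemma gdualI: "functional V \<Phi> \<Longrightarrow> supp G \<Phi> \<subseteq> S \<Longrightarrow> finite S \<Longrightarrow> gdual V G \<Phi>"
  by (auto simp: gdual_def finite_subset)

lemma gdual_plus: "gdual V G \<Phi> \<Longrightarrow> gdual V G \<Psi> \<Longrightarrow> gdual V G (\<lambda>v. \<Phi> v + \<Psi> v)"
  by (rule gdualI[OF _ supp_plus]) (auto simp: gdual_def lmap_plus)

lemma gdual_diff: "gdual V G \<Phi> \<Longrightarrow> gdual V G \<Psi> \<Longrightarrow> gdual V G (\<lambda>v. \<Phi> v - \<Psi> v)"
  by (rule gdualI[OF _ supp_diff]) (auto simp: gdual_def lmap_minus_fun)

lemma gdual_zero: "is_vs V \<Longrightarrow> gdual V G (\<lambda>v. 0)"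
  by (simp add: gdual_def lmap_0 supp_def)

lemma gdual_sum:
  "is_vs V \<Longrightarrow> (\<And>p. p \<in> S \<Longrightarrow> gdual V G (\<Phi> p)) \<Longrightarrow> gdual V G (\<lambda>v. \<Sum>p\<in>S. \<Phi> p v)"
  by (induction S rule: infinite_finite_induct) (auto simp: gdual_plus gdual_zero)

lemma ctensorD: "t \<in> ctensor V G W H \<Longrightarrow> t i j \<in> vcar (tensor (V\<lparr>vcar := G i\<rparr>) (W\<lparr>vcar := H j\<rparr>))"
  by (simp add: ctensor_def)

lemma ctensor_in:
  "graded_space V G \<Longrightarrow> graded_space W H \<Longrightarrow> t \<in> ctensor V G W H \<Longrightarrow> t i j \<in> vcar (tensor V W)"
  by (rule subspD[OF subsp_tensor[OF graded_subsp graded_subsp] ctensorD])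

lemma ctensor_add: "s \<in> ctensor V G W H \<Longrightarrow> t \<in> ctensor V G W H \<Longrightarrow> s + t \<in> ctensor V G W H"
  and ctensor_minus: "s \<in> ctensor V G W H \<Longrightarrow> - s \<in> ctensor V G W H"
  and ctensor_diff: "s \<in> ctensor V G W H \<Longrightarrow> t \<in> ctensor V G W H \<Longrightarrow> s - t \<in> ctensor V G W H"
  by (simp_all add: ctensor_def plus_fun_apply[of s t] plus_fun_apply[of "s _"]
     minus_apply[of s t] minus_apply[of "s _"] uminus_apply[of s] uminus_apply[of "s _"])

lemma tpair_eq_zero_left:
  assumes g: "graded_space V G" "graded_space W H" and t: "t \<in> ctensor V G W H"
    and f: "functional V \<Phi>" "functional W \<Psi>" and i: "i \<notin> supp G \<Phi>"
  shows "tpair V W \<Phi> \<Psi> (t i j) = 0"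
proof -
  have "tpair V W \<Phi> \<Psi> (t i j) = tpair V W (\<lambda>_. 0) \<Psi> (t i j)"
    by (rule tpair_cong[OF ctensorD[OF t]])
      (use g f i in \<open>auto simp: graded_subsp lmap_0 graded_is_vs supp_zero\<close>)
  then show ?thesis using tpair_zero_left[OF ctensor_in[OF g t] graded_is_vs[OF g(1)] f(2)] by simp
qed

lemma tpair_eq_zero_right:
  assumes g: "graded_space V G" "graded_space W H" and t: "t \<in> ctensor V G W H"
    and f: "functional V \<Phi>" "functional W \<Psi>" and j: "j \<notin> supp H \<Psi>"
  shows "tpair V W \<Phi> \<Psi> (t i j) = 0"
proof -
  have "tpair V W \<Phi> \<Psi> (t i j) = tpair V W \<Phi> (\<lambda>_. 0) (t i j)"
    by (rule tpair_cong[OF ctensorD[OF t]])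
      (use g f j in \<open>auto simp: graded_subsp lmap_0 graded_is_vs supp_zero\<close>)
  then show ?thesis using tpair_zero_right[OF ctensor_in[OF g t] graded_is_vs[OF g(2)] f(1)] by simp
qed

lemma cpair_eq:
  assumes g: "graded_space V G" "graded_space W H" and t: "t \<in> ctensor V G W H"
    and f: "functional V \<Phi>" "functional W \<Psi>"
    and S: "finite S" "supp G \<Phi> \<subseteq> S" "finite T" "supp H \<Psi> \<subseteq> T"
  shows "cpair V W \<Phi> \<Psi> t = (\<Sum>i\<in>S. \<Sum>j\<in>T. tpair V W \<Phi> \<Psi> (t i j))"
proof -
  have "cpair V W \<Phi> \<Psi> t = (\<Sum>(i, j)\<in>S \<times> T. tpair V W \<Phi> \<Psi> (t i j))"
    unfolding cpair_def
  proof (rule Sum_any.expand_superset)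
    show "{a. (case a of (i, j) \<Rightarrow> tpair V W \<Phi> \<Psi> (t i j)) \<noteq> 0} \<subseteq> S \<times> T"
      using tpair_eq_zero_left[OF g t f] tpair_eq_zero_right[OF g t f] S(2,4) unfolding subset_iff split_def mem_Times_iff mem_Collect_eq by meson
  qed (use S in simp)
  then show ?thesis by (simp add: sum.cartesian_product)
qed

lemma cpair_homog:
  assumes "graded_space V G" "graded_space W H" "t \<in> ctensor V G W H"
    "functional V \<Phi>" "functional W \<Psi>" "supp G \<Phi> \<subseteq> {i}" "supp H \<Psi> \<subseteq> {j}"
  shows "cpair V W \<Phi> \<Psi> t = tpair V W \<Phi> \<Psi> (t i j)"
  using cpair_eq[OF assms(1-5) _ assms(6) _ assms(7)] by simp

lemma cpair_cong:
  assumes g: "graded_space V G" "graded_space W H" and t: "t \<in> ctensor V G W H"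
    and "functional V \<Phi>" "functional W \<Psi>" "functional V \<Phi>'" "functional W \<Psi>'"
    "\<And>v. v \<in> vcar V \<Longrightarrow> \<Phi> v = \<Phi>' v" "\<And>w. w \<in> vcar W \<Longrightarrow> \<Psi> w = \<Psi>' w"
  shows "cpair V W \<Phi> \<Psi> t = cpair V W \<Phi>' \<Psi>' t"
proof -
  have "\<And>i j. tpair V W \<Phi> \<Psi> (t i j) = tpair V W \<Phi>' \<Psi>' (t i j)"
    by (rule tpair_cong_whole[OF ctensor_in[OF g t]]) (use assms in auto)
  then show ?thesis by (simp add: cpair_def)
qed

lemma cpair_add_left:
  assumes g: "graded_space V G" "graded_space W H" and t: "t \<in> ctensor V G W H"
    and f: "gdual V G \<Phi>" "gdual V G \<Phi>'" "gdual W H \<Psi>"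
  shows "cpair V W (\<lambda>v. \<Phi> v + \<Phi>' v) \<Psi> t = cpair V W \<Phi> \<Psi> t + cpair V W \<Phi>' \<Psi> t"
proof -
  let ?S = "supp G \<Phi> \<union> supp G \<Phi>'"
  note F = gdualD[OF f(1)] gdualD[OF f(2)] gdualD[OF f(3)]
  show ?thesis using F supp_plus[of G \<Phi> \<Phi>']
    by (simp add: cpair_eq[OF g t, where S = ?S and T = "supp H \<Psi>"] lmap_plus
        tpair_add_left[OF ctensor_in[OF g t]] sum.distrib)
qed

lemma cpair_add_right:
  assumes g: "graded_space V G" "graded_space W H" and t: "t \<in> ctensor V G W H"
    and f: "gdual V G \<Phi>" "gdual W H \<Psi>" "gdual W H \<Psi>'"
  shows "cpair V W \<Phi> (\<lambda>v. \<Psi> v + \<Psi>' v) t = cpair V W \<Phi> \<Psi> t + cpair V W \<Phi> \<Psi>' t"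
proof -
  let ?T = "supp H \<Psi> \<union> supp H \<Psi>'"
  note F = gdualD[OF f(1)] gdualD[OF f(2)] gdualD[OF f(3)]
  show ?thesis using F supp_plus[of H \<Psi> \<Psi>']
    by (simp add: cpair_eq[OF g t, where S = "supp G \<Phi>" and T = ?T] lmap_plus
        tpair_add_right[OF ctensor_in[OF g t]] sum.distrib)
qed

lemma cpair_sum_left:
  assumes g: "graded_space V G" "graded_space W H" and t: "t \<in> ctensor V G W H"
    and f: "\<And>p. p \<in> S \<Longrightarrow> gdual V G (\<Phi> p)" and \<Psi>: "gdual W H \<Psi>"
  shows "cpair V W (\<lambda>v. \<Sum>p\<in>S. \<Phi> p v) \<Psi> t = (\<Sum>p\<in>S. cpair V W (\<Phi> p) \<Psi> t)"
proof -
  note v = graded_is_vs[OF g(1)]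
  have "cpair V W (\<lambda>v. 0) \<Psi> t = 0"
    by (simp add: cpair_def tpair_zero_left[OF ctensor_in[OF g t] v gdualD(1)[OF \<Psi>]])
  then show ?thesis using f
    by (induction S rule: infinite_finite_induct) (simp_all add: cpair_add_left[OF g t _ _ \<Psi>] gdual_sum v)
qed

lemma cpair_sum_right:
  assumes g: "graded_space V G" "graded_space W H" and t: "t \<in> ctensor V G W H"
    and f: "\<And>p. p \<in> S \<Longrightarrow> gdual W H (\<Psi> p)" and \<Phi>: "gdual V G \<Phi>"
  shows "cpair V W \<Phi> (\<lambda>v. \<Sum>p\<in>S. \<Psi> p v) t = (\<Sum>p\<in>S. cpair V W \<Phi> (\<Psi> p) t)"
proof -
  note v = graded_is_vs[OF g(2)]
  have "cpair V W \<Phi> (\<lambda>v. 0) t = 0"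
    by (simp add: cpair_def tpair_zero_right[OF ctensor_in[OF g t] v gdualD(1)[OF \<Phi>]])
  then show ?thesis using f
    by (induction S rule: infinite_finite_induct) (simp_all add: cpair_add_right[OF g t \<Phi>] gdual_sum v)
qed

lemma cpair_diff_left:
  assumes g: "graded_space V G" "graded_space W H" and t: "t \<in> ctensor V G W H"
    and f: "gdual V G \<Phi>" "gdual V G \<Phi>'" "gdual W H \<Psi>"
  shows "cpair V W (\<lambda>v. \<Phi> v - \<Phi>' v) \<Psi> t = cpair V W \<Phi> \<Psi> t - cpair V W \<Phi>' \<Psi> t"
  using cpair_add_left[OF g t gdual_diff[OF f(1,2)] f(2,3)] by simp

lemma cpair_diff_right:
  assumes g: "graded_space V G" "graded_space W H" and t: "t \<in> ctensor V G W H"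
    and f: "gdual V G \<Phi>" "gdual W H \<Psi>" "gdual W H \<Psi>'"
  shows "cpair V W \<Phi> (\<lambda>v. \<Psi> v - \<Psi>' v) t = cpair V W \<Phi> \<Psi> t - cpair V W \<Phi> \<Psi>' t"
  using cpair_add_right[OF g t f(1) gdual_diff[OF f(2,3)] f(3)] by simp

lemma cpair_plus:
  assumes g: "graded_space V G" "graded_space W H" and t: "t \<in> ctensor V G W H" "s \<in> ctensor V G W H"
    and f: "gdual V G \<Phi>" "gdual W H \<Psi>"
  shows "cpair V W \<Phi> \<Psi> (s + t) = cpair V W \<Phi> \<Psi> s + cpair V W \<Phi> \<Psi> t"
proof -
  note F = gdualD[OF f(1)] gdualD[OF f(2)]
  have e: "(s + t) i j = s i j + t i j" for i j by (simp add: plus_fun_apply)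
  have "tpair V W \<Phi> \<Psi> ((s + t) i j) = tpair V W \<Phi> \<Psi> (s i j) + tpair V W \<Phi> \<Psi> (t i j)" for i j
    unfolding e by (rule tpair_add) (use F ctensor_in[OF g] t in auto)
  then show ?thesis using F
    by (simp add: cpair_eq[OF g _ F(1) F(3) F(2) subset_refl F(4) subset_refl] ctensor_add t sum.distrib)
qed

text \<open>Equality of formal sums is tested one bidegree at a time, with functionals that separate the
  homogeneous parts.\<close>

lemma ctensor_eqI:
  assumes g: "graded_space V G" "graded_space W H" and t: "t \<in> ctensor V G W H" "u \<in> ctensor V G W H"
    and P: "\<And>i. separates (V\<lparr>vcar := G i\<rparr>) (P i)" "\<And>i \<Phi>. \<Phi> \<in> P i \<Longrightarrow> functional V \<Phi>"
    and Q: "\<And>j. separates (W\<lparr>vcar := H j\<rparr>) (Q j)" "\<And>j \<Psi>. \<Psi> \<in> Q j \<Longrightarrow> functional W \<Psi>"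
    and eq: "\<And>i j \<Phi> \<Psi>. \<Phi> \<in> P i \<Longrightarrow> \<Psi> \<in> Q j \<Longrightarrow> tpair V W \<Phi> \<Psi> (t i j) = tpair V W \<Phi> \<Psi> (u i j)"
  shows "t = u"
proof (rule ext, rule ext)
  fix i j
  show "t i j = u i j"
  proof (rule separates_eqI[OF separates_tensor[OF P(1)[of i] Q(1)[of j]] ctensorD[OF t(1)] ctensorD[OF t(2)]])
    fix \<Xi> assume "\<Xi> \<in> {tpair (V\<lparr>vcar := G i\<rparr>) (W\<lparr>vcar := H j\<rparr>) \<Phi> \<Psi> |\<Phi> \<Psi>. \<Phi> \<in> P i \<and> \<Psi> \<in> Q j}"
    then obtain \<Phi> \<Psi> where \<Xi>: "\<Xi> = tpair (V\<lparr>vcar := G i\<rparr>) (W\<lparr>vcar := H j\<rparr>) \<Phi> \<Psi>" "\<Phi> \<in> P i" "\<Psi> \<in> Q j"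
      by blast
    have "tpair (V\<lparr>vcar := G i\<rparr>) (W\<lparr>vcar := H j\<rparr>) \<Phi> \<Psi> (s i j) = tpair V W \<Phi> \<Psi> (s i j)"
      if "s \<in> ctensor V G W H" for s
      by (rule tpair_cong[OF ctensorD[OF that]]) (use P(2) Q(2) \<Xi> g in \<open>auto simp: graded_subsp
        graded_part_is_vs intro: lmap_subsp[OF graded_subsp]\<close>)
    then show "\<Xi> (t i j) = \<Xi> (u i j)" using eq \<Xi> t by simp
  qed
qed

definition degree_functionals :: "('k::field, 'v::ab_group_add) vs \<Rightarrow> ('i \<Rightarrow> 'v set) \<Rightarrow> 'i \<Rightarrow> ('v \<Rightarrow> 'k) set" where
  "degree_functionals V G i = {\<Phi>. functional V \<Phi> \<and> supp G \<Phi> \<subseteq> {i}}"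

lemma separates_degree_functionals:
  assumes g: "graded_space V G"
  shows "separates (V\<lparr>vcar := G i\<rparr>) (degree_functionals V G i)"
  unfolding separates_def
proof (safe intro!: graded_part_is_vs[OF g])
  fix \<Phi> assume "\<Phi> \<in> degree_functionals V G i"
  then show "functional (V\<lparr>vcar := G i\<rparr>) \<Phi>"
    by (auto simp: degree_functionals_def intro: lmap_subsp[OF graded_subsp[OF g]])
next
  fix v assume v: "v \<in> vcar (V\<lparr>vcar := G i\<rparr>)" "\<forall>\<Phi>\<in>degree_functionals V G i. \<Phi> v = 0"
  then have vi: "v \<in> G i" by simp
  have "\<Phi> v = 0" if "functional V \<Phi>" for \<Phi>
  proof -
    have "(\<lambda>v. \<Phi> (gcomp G i v)) \<in> degree_functionals V G i"
      using supp_gcomp_functional[OF g that] lmap_comp[OF lmap_gcomp[OF g] that]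
      by (simp add: degree_functionals_def)
    then have "\<Phi> (gcomp G i v) = 0" by (rule bspec[OF v(2)])
    then show ?thesis by (simp add: gcomp_homog[OF g vi])
  qed
  then show "v = 0"
    using separates_functionals[OF graded_is_vs[OF g]] graded_in[OF g vi] by (simp add: separates_def)
qed

section \<open>Maps of completed tensor products\<close>

lemma lmap_Sum_any:
  assumes "lmap V W f" "finite {i. g i \<noteq> 0}" "\<And>i. g i \<in> vcar V"
  shows "f (Sum_any g) = Sum_any (\<lambda>i. f (g i))"
proof -
  have "f (Sum_any g) = (\<Sum>i | g i \<noteq> 0. f (g i))"
    using assms by (simp add: Sum_any.expand_set lmap_sum)
  also have "\<dots> = Sum_any (\<lambda>i. f (g i))"
    by (rule Sum_any.expand_superset[symmetric]) (use assms lmap_zero[OF assms(1)] in auto)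
  finally show ?thesis .
qed

text \<open>The \<open>(p, q)\<close> component of the image only receives the degrees in which \<open>f p\<close> and \<open>h q\<close> do not
  vanish. When these are finitely many, the transposed map on functionals describes the component.\<close>

lemma
  assumes g: "graded_space V G" "graded_space W H" and t: "t \<in> ctensor V G W H"
    and f: "\<And>p. lmap V V' (f p)" "\<And>p. finite (supp G (f p))"
    and h: "\<And>q. lmap W W' (h q)" "\<And>q. finite (supp H (h q))"
  shows cmap_wdI: "cmap_wd V W V' W' f h t"
    and cmap_in: "subsp V1 V' \<Longrightarrow> subsp W1 W' \<Longrightarrow> (\<And>v. v \<in> vcar V \<Longrightarrow> f p v \<in> vcar V1) \<Longrightarrow>
      (\<And>w. w \<in> vcar W \<Longrightarrow> h q w \<in> vcar W1) \<Longrightarrow> cmap V W V' W' f h t p q \<in> vcar (tensor V1 W1)"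
    and tpair_cmap: "functional V' \<Phi> \<Longrightarrow> functional W' \<Psi> \<Longrightarrow>
      tpair V' W' \<Phi> \<Psi> (cmap V W V' W' f h t p q) = cpair V W (\<lambda>v. \<Phi> (f p v)) (\<lambda>w. \<Psi> (h q w)) t"
proof -
  note v = lmapD(1,2)[OF f(1)] lmapD(1,2)[OF h(1)]
  note tin = ctensor_in[OF g t]
  have m: "tmap V W V' W' (f p) (h q) (t i j) \<in> vcar (tensor V' W')" for p q i j
    by (rule lmapD(3)[OF lmap_tmap[OF f(1) h(1)] tin])
  have supp: "supp G (\<lambda>v. \<Phi> (f p v)) \<subseteq> supp G (f p)" "supp H (\<lambda>v. \<Psi> (h q v)) \<subseteq> supp H (h q)"
    if "functional V' \<Phi>" "functional W' \<Psi>" for \<Phi> \<Psi> p q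
    using that by (auto intro!: supp_functional_comp)
  have z: "tmap V W V' W' (f p) (h q) (t i j) = 0" if ij: "i \<notin> supp G (f p) \<or> j \<notin> supp H (h q)" for p q i j
  proof (rule tensor_zeroI[OF separates_functionals separates_functionals m])
    fix \<Phi> \<Psi> assume "\<Phi> \<in> Collect (functional V')" "\<Psi> \<in> Collect (functional W')"
    then have F: "functional V' \<Phi>" "functional W' \<Psi>" by auto
    note F' = lmap_comp[OF f(1) F(1)] lmap_comp[OF h(1) F(2)]
    show "tpair V' W' \<Phi> \<Psi> (tmap V W V' W' (f p) (h q) (t i j)) = 0"
      unfolding tpair_tmap[OF f(1) h(1) F tin]
      using tpair_eq_zero_left[OF g t F'] tpair_eq_zero_right[OF g t F'] ij supp[OF F] by blast
  qed (fact v)+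
  have sub: "{(i, j). tmap V W V' W' (f p) (h q) (t i j) \<noteq> 0} \<subseteq> supp G (f p) \<times> supp H (h q)" for p q
    using z by blast
  have fin: "finite {(i, j). tmap V W V' W' (f p) (h q) (t i j) \<noteq> 0}" for p q
    by (rule finite_subset[OF sub]) (use f h in auto)
  then show "cmap_wd V W V' W' f h t" by (simp add: cmap_wd_def)
  show "cmap V W V' W' f h t p q \<in> vcar (tensor V1 W1)" if "subsp V1 V'" "subsp W1 W'"
    "\<And>v. v \<in> vcar V \<Longrightarrow> f p v \<in> vcar V1" "\<And>w. w \<in> vcar W \<Longrightarrow> h q w \<in> vcar W1"
    unfolding cmap_def
    by (rule is_vs_Sum_any) (use that v tin in \<open>auto intro!: tmap_in[OF f(1) h(1)]\<close>)
  show "tpair V' W' \<Phi> \<Psi> (cmap V W V' W' f h t p q) = cpair V W (\<lambda>v. \<Phi> (f p v)) (\<lambda>w. \<Psi> (h q w)) t"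
    if F: "functional V' \<Phi>" "functional W' \<Psi>"
  proof -
    have "tpair V' W' \<Phi> \<Psi> (cmap V W V' W' f h t p q) =
      Sum_any (\<lambda>x. tpair V' W' \<Phi> \<Psi> (case x of (i, j) \<Rightarrow> tmap V W V' W' (f p) (h q) (t i j)))"
      unfolding cmap_def
      by (rule lmap_Sum_any[OF functional_tpair[OF F]]) (use fin m in \<open>auto simp: split_def\<close>)
    also have "\<dots> = cpair V W (\<lambda>v. \<Phi> (f p v)) (\<lambda>w. \<Psi> (h q w)) t"
      unfolding cpair_def
      by (rule arg_cong[where f = Sum_any]) (auto simp: tpair_tmap[OF f(1) h(1) F tin])
    finally show ?thesis .
  qed
qed

lemma
  assumes g: "graded_space V G" and f: "lmap V V f" "\<And>p. finite (supp G (\<lambda>z. gcomp G p (f z)))"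
    and \<Phi>: "gdual V G \<Phi>"
  shows gdual_comp: "gdual V G (\<lambda>z. \<Phi> (f z))"
proof (rule gdualI)
  show "functional V (\<lambda>z. \<Phi> (f z))" by (rule lmap_comp[OF f(1) gdualD(1)[OF \<Phi>]])
  note e = functional_expand[OF g gdualD(1)[OF \<Phi>] gdualD(2)[OF \<Phi>] subset_refl lmapD(3)[OF f(1)]]
  show "supp G (\<lambda>z. \<Phi> (f z)) \<subseteq> (\<Union>p\<in>supp G \<Phi>. supp G (\<lambda>z. gcomp G p (f z)))"
  proof (rule supp_subsetI)
    fix i x assume i: "i \<notin> (\<Union>p\<in>supp G \<Phi>. supp G (\<lambda>z. gcomp G p (f z)))" and x: "x \<in> G i"
    have "\<Phi> (f x) = (\<Sum>p\<in>supp G \<Phi>. \<Phi> (gcomp G p (f x)))" by (rule e[OF graded_in[OF g x]])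
    also have "\<dots> = 0"
    proof (rule sum.neutral, rule ballI)
      fix p assume "p \<in> supp G \<Phi>"
      then have "i \<notin> supp G (\<lambda>z. gcomp G p (f z))" using i by blast
      then have "gcomp G p (f x) = 0" using x by (auto simp: supp_def)
      then show "\<Phi> (gcomp G p (f x)) = 0" using lmap_zero[OF gdualD(1)[OF \<Phi>]] by simp
    qed
    finally show "\<Phi> (f x) = 0" .
  qed
  show "finite (\<Union>p\<in>supp G \<Phi>. supp G (\<lambda>z. gcomp G p (f z)))"
    using gdualD(2)[OF \<Phi>] f(2) by blast
qed

lemma cmap_gcomp_in:
  assumes g: "graded_space V G" and t: "t \<in> ctensor V G V G"
    and f: "lmap V V f" "\<And>p. finite (supp G (\<lambda>z. gcomp G p (f z)))"
    and h: "lmap V V h" "\<And>p. finite (supp G (\<lambda>z. gcomp G p (h z)))"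
  shows "cmap V V V V (\<lambda>p z. gcomp G p (f z)) (\<lambda>p z. gcomp G p (h z)) t \<in> ctensor V G V G"
proof -
  note l = lmap_comp[OF f(1) lmap_gcomp[OF g]] lmap_comp[OF h(1) lmap_gcomp[OF g]]
  show ?thesis
    unfolding ctensor_def
    by (safe intro!: cmap_in[OF g g t l(1) f(2) l(2) h(2)] graded_subsp[OF g])
      (use gcomp_in[OF g] lmapD(3)[OF f(1)] lmapD(3)[OF h(1)] in auto)
qed

text \<open>The transpose of a completed map whose components come from honest maps \<open>f\<close> and \<open>h\<close>: since \<open>\<Phi>\<close> and
  \<open>\<Psi>\<close> are finite sums of homogeneous functionals, the values of all components add up to the value of
  \<open>t\<close> at the pulled back functionals.\<close>

lemma cpair_cmap_gcomp:
  assumes g: "graded_space V G" and t: "t \<in> ctensor V G V G"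
    and f: "lmap V V f" "\<And>p. finite (supp G (\<lambda>z. gcomp G p (f z)))"
    and h: "lmap V V h" "\<And>p. finite (supp G (\<lambda>z. gcomp G p (h z)))"
    and \<Phi>: "gdual V G \<Phi>" and \<Psi>: "gdual V G \<Psi>"
  shows "cpair V V \<Phi> \<Psi> (cmap V V V V (\<lambda>p z. gcomp G p (f z)) (\<lambda>p z. gcomp G p (h z)) t) =
    cpair V V (\<lambda>z. \<Phi> (f z)) (\<lambda>z. \<Psi> (h z)) t"
proof -
  note F = gdualD[OF \<Phi>] gdualD[OF \<Psi>]
  note l = lmap_comp[OF f(1) lmap_gcomp[OF g]] lmap_comp[OF h(1) lmap_gcomp[OF g]]
  let ?u = "cmap V V V V (\<lambda>p z. gcomp G p (f z)) (\<lambda>p z. gcomp G p (h z)) t"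
  note gd = gdual_comp[OF g f \<Phi>] gdual_comp[OF g h \<Psi>]
  have gp: "gdual V G (\<lambda>z. \<Phi> (gcomp G p (f z)))" "gdual V G (\<lambda>z. \<Psi> (gcomp G p (h z)))" for p
    using lmap_comp[OF l(1) F(1)] lmap_comp[OF l(2) F(3)] f(2) h(2)
    by (auto simp: gdual_def intro: finite_subset[OF supp_functional_comp[OF F(1)]]
        finite_subset[OF supp_functional_comp[OF F(3)]])
  have sums: "gdual V G (\<lambda>z. \<Sum>p\<in>S. \<Phi> (gcomp G p (f z)))" "gdual V G (\<lambda>z. \<Sum>p\<in>S. \<Psi> (gcomp G p (h z)))" for S
    by (intro gdual_sum graded_is_vs[OF g] gp)+
  have "cpair V V \<Phi> \<Psi> ?u = (\<Sum>p\<in>supp G \<Phi>. \<Sum>q\<in>supp G \<Psi>. tpair V V \<Phi> \<Psi> (?u p q))"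
    by (rule cpair_eq[OF g g cmap_gcomp_in[OF g t f h] F(1,3,2) subset_refl F(4) subset_refl])
  also have "\<dots> = (\<Sum>p\<in>supp G \<Phi>. \<Sum>q\<in>supp G \<Psi>.
      cpair V V (\<lambda>z. \<Phi> (gcomp G p (f z))) (\<lambda>z. \<Psi> (gcomp G q (h z))) t)"
    by (intro sum.cong refl tpair_cmap[OF g g t l(1) f(2) l(2) h(2) F(1,3)])
  also have "\<dots> = cpair V V (\<lambda>z. \<Sum>p\<in>supp G \<Phi>. \<Phi> (gcomp G p (f z)))
      (\<lambda>z. \<Sum>q\<in>supp G \<Psi>. \<Psi> (gcomp G q (h z))) t"
    by (simp add: cpair_sum_left[OF g g t gp(1) sums(2)] cpair_sum_right[OF g g t gp(2) gp(1)])
  also have "\<dots> = cpair V V (\<lambda>z. \<Phi> (f z)) (\<lambda>z. \<Psi> (h z)) t"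
    by (rule cpair_cong[OF g g t])
      (use gdualD(1)[OF sums(1)] gdualD(1)[OF sums(2)] gdualD(1)[OF gd(1)] gdualD(1)[OF gd(2)]
        functional_expand[OF g F(1,2) subset_refl lmapD(3)[OF f(1)]]
        functional_expand[OF g F(3,4) subset_refl lmapD(3)[OF h(1)]] in auto)
  finally show ?thesis .
qed

section \<open>Coboundaries over a graded Lie algebra\<close>

locale graded_lie =
  fixes L :: "('k::field, 'l::ab_group_add) vs" and G :: "int \<Rightarrow> 'l set" and br :: "'l \<Rightarrow> 'l \<Rightarrow> 'l"
  assumes graded: "graded_space L G" and lie: "lie_algebra L br"
    and br_deg: "\<And>i j x y. x \<in> G i \<Longrightarrow> y \<in> G j \<Longrightarrow> br x y \<in> G (i + j)"
begin

lemma lmap_ad: "x \<in> vcar L \<Longrightarrow> lmap L L (br x)"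
  and lmap_ad': "x \<in> vcar L \<Longrightarrow> lmap L L (\<lambda>y. br y x)"
  using lie by (auto simp: lie_algebra_def lmap_def bilinear_on_def)

text \<open>For homogeneous \<open>x\<close> the map \<open>ad\<^sub>x\<close> shifts degrees, so one degree only is sent to degree \<open>p\<close>; a
  general \<open>x\<close> has finitely many components.\<close>

lemma supp_ad:
  assumes x: "x \<in> vcar L" shows "finite (supp G (\<lambda>z. gcomp G p (br x z)))"
  using graded x
proof (induction rule: graded_induct)
  case (homog i x)
  have "supp G (\<lambda>z. gcomp G p (br x z)) \<subseteq> {p - i}"
  proof (rule supp_subsetI)
    fix j z assume "j \<notin> {p - i}" and z: "z \<in> G j"
    then show "gcomp G p (br x z) = 0" using gcomp_homog[OF graded br_deg[OF homog z]] by auto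
  qed
  then show ?case by (rule finite_subset) simp
next
  case (add x y)
  have "supp G (\<lambda>z. gcomp G p (br (x + y) z)) \<subseteq>
      supp G (\<lambda>z. gcomp G p (br x z)) \<union> supp G (\<lambda>z. gcomp G p (br y z))"
  proof (rule supp_subsetI)
    fix i z assume i: "i \<notin> supp G (\<lambda>z. gcomp G p (br x z)) \<union> supp G (\<lambda>z. gcomp G p (br y z))" and z: "z \<in> G i"
    have "z \<in> vcar L" by (rule graded_in[OF graded z])
    then show "gcomp G p (br (x + y) z) = 0" using i z add
      by (auto simp: supp_def lmap_add[OF lmap_ad'] gcomp_add[OF graded] lmapD(3)[OF lmap_ad])
  qed
  then show ?case using add by (simp add: finite_subset)
qed

lemma supp_id: "finite (supp G (\<lambda>z. gcomp G p z))"
  by (rule finite_subset[OF supp_gcomp[OF graded]]) simp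

lemma gdual_ad: "gdual L G \<Phi> \<Longrightarrow> x \<in> vcar L \<Longrightarrow> gdual L G (\<lambda>z. \<Phi> (br x z))"
  by (rule gdual_comp[OF graded lmap_ad supp_ad])

context
  fixes x t assumes x: "x \<in> vcar L" and t: "t \<in> ctensor L G L G"
begin

lemma ad_act_eq: "ad_act L G br x t =
    cmap L L L L (\<lambda>p z. gcomp G p (br x z)) (\<lambda>p z. gcomp G p z) t +
    cmap L L L L (\<lambda>p z. gcomp G p z) (\<lambda>p z. gcomp G p (br x z)) t"
  by (simp add: ad_act_def Let_def)

lemma ad_act_wdI: "ad_act_wd L G br x t"
  unfolding ad_act_wd_def Let_def
  by (intro conjI cmap_wdI[OF graded graded t] lmap_comp[OF lmap_ad[OF x]] lmap_gcomp graded supp_ad[OF x])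
    (simp_all add: supp_id)

lemma ad_act_in: "ad_act L G br x t \<in> ctensor L G L G"
  unfolding ad_act_eq
  by (intro ctensor_add cmap_gcomp_in[OF graded t] lmap_ad[OF x] lmap_id graded_is_vs[OF graded]
      supp_ad[OF x] supp_id)

lemma cpair_ad_act:
  assumes "gdual L G \<Phi>" "gdual L G \<Psi>"
  shows "cpair L L \<Phi> \<Psi> (ad_act L G br x t) =
    cpair L L (\<lambda>z. \<Phi> (br x z)) \<Psi> t + cpair L L \<Phi> (\<lambda>z. \<Psi> (br x z)) t"
proof -
  note i = lmap_id[OF graded_is_vs[OF graded]]
  note a = cpair_cmap_gcomp[OF graded t lmap_ad[OF x] supp_ad[OF x] i supp_id assms]
      cmap_gcomp_in[OF graded t lmap_ad[OF x] supp_ad[OF x] i supp_id]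
    and b = cpair_cmap_gcomp[OF graded t i supp_id lmap_ad[OF x] supp_ad[OF x] assms]
      cmap_gcomp_in[OF graded t i supp_id lmap_ad[OF x] supp_ad[OF x]]
  show ?thesis
    unfolding ad_act_eq by (simp only: cpair_plus[OF graded graded b(2) a(2) assms] a(1) b(1))
qed

end

text \<open>\<open>L \<otimes>^ L\<close> is a representation of \<open>L\<close>. On functionals the action is precomposition with \<open>ad\<close>, for which
  this is the Jacobi identity. Read for a fixed \<open>t\<close>, it is the cocycle condition for the coboundary of \<open>t\<close>.\<close>

lemma ad_act_bracket:
  assumes x: "x \<in> vcar L" and y: "y \<in> vcar L" and t: "t \<in> ctensor L G L G"
  shows "ad_act L G br (br x y) t = ad_act L G br x (ad_act L G br y t) - ad_act L G br y (ad_act L G br x t)"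
proof -
  have xy: "br x y \<in> vcar L" using x y by (rule lmapD(3)[OF lmap_ad])
  note tx = ad_act_in[OF x t] and ty = ad_act_in[OF y t] and txy = ad_act_in[OF xy t]
  note txy' = ad_act_in[OF x ty] and tyx' = ad_act_in[OF y tx]
  have jac: "br (br x y) z = br x (br y z) - br y (br x z)" if z: "z \<in> vcar L" for z
  proof -
    have sk: "br u v = - br v u" if "u \<in> vcar L" "v \<in> vcar L" for u v
    proof -
      have "br (u + v) (u + v) = br u u + br u v + (br v u + br v v)"
        using that graded_is_vs[OF graded] by (simp add: lmap_add[OF lmap_ad] lmap_add[OF lmap_ad'])
      moreover have "br (u + v) (u + v) = 0" "br u u = 0" "br v v = 0"
        using that lie graded_is_vs[OF graded] by (simp_all add: lie_algebra_def)
      ultimately show ?thesis by (simp add: eq_neg_iff_add_eq_0)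
    qed
    have "br x (br y z) + br y (br z x) + br z (br x y) = 0"
      using lie x y z by (simp add: lie_algebra_def)
    moreover have "br z (br x y) = - br (br x y) z" by (rule sk) (use z xy in auto)
    moreover have "br y (br z x) = - br y (br x z)"
      using sk[OF z x] lmap_minus[OF lmap_ad[OF y] lmapD(3)[OF lmap_ad[OF x] z]] by simp
    ultimately show ?thesis by (simp add: algebra_simps eq_neg_iff_add_eq_0)
  qed
  let ?D = "degree_functionals L G"
  show ?thesis
  proof (rule ctensor_eqI[OF graded graded txy ctensor_diff[OF txy' tyx'],
        of ?D ?D])
    fix i j \<Phi> \<Psi> assume "\<Phi> \<in> ?D i" "\<Psi> \<in> ?D j"
    then have F: "functional L \<Phi>" "supp G \<Phi> \<subseteq> {i}" "functional L \<Psi>" "supp G \<Psi> \<subseteq> {j}"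
      by (auto simp: degree_functionals_def)
    then have gd: "gdual L G \<Phi>" "gdual L G \<Psi>" by (auto intro: gdualI)
    note gx = gdual_ad[OF gd(1) x] gdual_ad[OF gd(2) x] and gy = gdual_ad[OF gd(1) y] gdual_ad[OF gd(2) y]
    have hom: "tpair L L \<Phi> \<Psi> (s i j) = cpair L L \<Phi> \<Psi> s" if "s \<in> ctensor L G L G" for s
      using cpair_homog[OF graded graded that F(1,3,2,4)] by simp
    note gxy = gdual_ad[OF gx(1) y] gdual_ad[OF gx(2) y] and gyx = gdual_ad[OF gy(1) x] gdual_ad[OF gy(2) x]
    have jac': "\<Xi> (br (br x y) z) = \<Xi> (br x (br y z)) - \<Xi> (br y (br x z))"
      if "gdual L G \<Xi>" "z \<in> vcar L" for \<Xi> z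
      using that by (simp add: jac lmap_diff[OF gdualD(1)] lmapD(3)[OF lmap_ad[OF x]] lmapD(3)[OF lmap_ad[OF y]])
    have 1: "cpair L L (\<lambda>z. \<Phi> (br (br x y) z)) \<Psi> t =
        cpair L L (\<lambda>z. \<Phi> (br x (br y z))) \<Psi> t - cpair L L (\<lambda>z. \<Phi> (br y (br x z))) \<Psi> t"
      unfolding cpair_diff_left[OF graded graded t gxy(1) gyx(1) gd(2), symmetric]
      by (rule cpair_cong[OF graded graded t])
        (use gd gdual_ad[OF gd(1) xy] gdual_diff[OF gxy(1) gyx(1)] in \<open>auto simp: jac' gdualD(1)\<close>)
    have 2: "cpair L L \<Phi> (\<lambda>z. \<Psi> (br (br x y) z)) t =
        cpair L L \<Phi> (\<lambda>z. \<Psi> (br x (br y z))) t - cpair L L \<Phi> (\<lambda>z. \<Psi> (br y (br x z))) t"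
      unfolding cpair_diff_right[OF graded graded t gd(1) gxy(2) gyx(2), symmetric]
      by (rule cpair_cong[OF graded graded t])
        (use gd gdual_ad[OF gd(2) xy] gdual_diff[OF gxy(2) gyx(2)] in \<open>auto simp: jac' gdualD(1)\<close>)
    have "tpair L L \<Phi> \<Psi> ((ad_act L G br x (ad_act L G br y t) - ad_act L G br y (ad_act L G br x t)) i j) =
        tpair L L \<Phi> \<Psi> (ad_act L G br x (ad_act L G br y t) i j) - tpair L L \<Phi> \<Psi> (ad_act L G br y (ad_act L G br x t) i j)"
      using tpair_diff[OF F(1,3) ctensor_in[OF graded graded txy'] ctensor_in[OF graded graded tyx']]
      by (simp add: minus_apply)
    also have "\<dots> = cpair L L (\<lambda>z. \<Phi> (br (br x y) z)) \<Psi> t + cpair L L \<Phi> (\<lambda>z. \<Psi> (br (br x y) z)) t"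
      unfolding hom[OF txy'] hom[OF tyx'] cpair_ad_act[OF x ty gd] cpair_ad_act[OF y tx gd]
        cpair_ad_act[OF y t gx(1) gd(2)] cpair_ad_act[OF y t gd(1) gx(2)]
        cpair_ad_act[OF x t gy(1) gd(2)] cpair_ad_act[OF x t gd(1) gy(2)] 1 2
      by (simp add: algebra_simps)
    also have "\<dots> = tpair L L \<Phi> \<Psi> (ad_act L G br (br x y) t i j)"
      unfolding hom[OF txy] cpair_ad_act[OF xy t gd] ..
    finally show "tpair L L \<Phi> \<Psi> (ad_act L G br (br x y) t i j) =
      tpair L L \<Phi> \<Psi> ((ad_act L G br x (ad_act L G br y t) - ad_act L G br y (ad_act L G br x t)) i j)" by simp
  qed (rule separates_degree_functionals[OF graded], simp add: degree_functionals_def)+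
qed

end

section \<open>The Jacobi identity from two Novikov products\<close>

text \<open>Jacobi for \<open>[u \<otimes> a, v \<otimes> b] = u v \<otimes> a b - v u \<otimes> b a\<close>, with a biadditive map \<open>T\<close> in place of the tensor
  product and a set \<open>C\<close> closed under the product, so that it applies to elements of \<open>A\<close> as well as to
  linear functionals. Right symmetry of \<open>m\<close> rewrites each \<open>(a c) b\<close> as \<open>(a b) c\<close> plus words of the form
  \<open>a (b c)\<close>, and left commutativity leaves three of the latter; their coefficients cancel by left symmetry
  of \<open>n\<close>, those of the \<open>(a b) c\<close> by right commutativity.\<close>

lemma novikov_tensor_jacobi:
  fixes T :: "'n::ab_group_add \<Rightarrow> 'b::ab_group_add \<Rightarrow> 'k::ab_group_add"
  assumes T: "\<And>u v b. u \<in> C \<Longrightarrow> v \<in> C \<Longrightarrow> T (u + v) b = T u b + T v b"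
    "\<And>u b c. u \<in> C \<Longrightarrow> T u (b + c) = T u b + T u c"
    and C: "\<And>u v. u \<in> C \<Longrightarrow> v \<in> C \<Longrightarrow> n u v \<in> C"
    and N: "\<And>u v w. u \<in> C \<Longrightarrow> v \<in> C \<Longrightarrow> w \<in> C \<Longrightarrow> n (n u v) w + n v (n u w) = n (n v u) w + n u (n v w)"
      "\<And>u v w. u \<in> C \<Longrightarrow> v \<in> C \<Longrightarrow> w \<in> C \<Longrightarrow> n (n u v) w = n (n u w) v"
    and B: "\<And>a b c. m (m a b) c + m a (m c b) = m (m a c) b + m a (m b c)"
      "\<And>a b c. m a (m b c) = m b (m a c)"
    and u: "u1 \<in> C" "u2 \<in> C" "u3 \<in> C"
  defines "J \<equiv> \<lambda>u a v b w c. T (n u (n v w)) (m a (m b c)) - T (n (n v w) u) (m (m b c) a)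
    - T (n u (n w v)) (m a (m c b)) + T (n (n w v) u) (m (m c b) a)"
  shows "J u1 b1 u2 b2 u3 b3 + J u2 b2 u3 b3 u1 b1 + J u3 b3 u1 b1 u2 b2 = 0"
proof -
  \<comment> \<open>Reduces the six words \<open>(a b) c\<close> to three.\<close>
  have q: "T (n (n u v) w) (m (m a c) b) = T (n (n u v) w) (m (m a b) c) + T (n (n u v) w) (m a (m c b))
      - T (n (n u v) w) (m a (m b c))" if "u \<in> C" "v \<in> C" "w \<in> C" for u v w a b c
    using T(2)[of "n (n u v) w" "m (m a b) c" "m a (m c b)"] T(2)[of "n (n u v) w" "m (m a c) b" "m a (m b c)"]
      that B(1)[of a b c] by (simp add: C algebra_simps)
  \<comment> \<open>Solves left symmetry for one of the four words, so that substitution finishes the proof.\<close>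
  have y: "T (n u (n v w)) b = T (n (n u v) w) b + T (n v (n u w)) b - T (n (n v u) w) b"
    if "u \<in> C" "v \<in> C" "w \<in> C" for u v w b
    using T(1)[of "n (n u v) w" "n v (n u w)" b] T(1)[of "n (n v u) w" "n u (n v w)" b] that N(1)[of u v w]
    by (simp add: C algebra_simps)
  note x = N(2)[OF u(1,3,2)] N(2)[OF u(2,3,1)] N(2)[OF u(3,2,1)]
  show ?thesis
    unfolding J_def x
    unfolding q[OF u, of b1 b3 b2] q[OF u(2,1,3), of b2 b1 b3] q[OF u(3,1,2), of b3 b2 b1]
    unfolding y[OF u] y[OF u(2,3,1)] y[OF u(3,1,2)] x
      B(2)[of b2 b1 b3] B(2)[of b3 b2 b1] B(2)[of b3 b1 b2]
    by (simp add: algebra_simps)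
qed

section \<open>The dual Novikov algebra of a skewsymmetric solution\<close>

lemma tensor_eqI:
  assumes "s \<in> vcar (tensor V W)" "t \<in> vcar (tensor V W)" "is_vs V" "is_vs W"
    "\<And>\<Phi> \<Psi>. functional V \<Phi> \<Longrightarrow> functional W \<Psi> \<Longrightarrow> tpair V W \<Phi> \<Psi> s = tpair V W \<Phi> \<Psi> t"
  shows "s = t"
  by (rule separates_eqI[OF separates_tensor[OF separates_functionals separates_functionals] assms(1,2)])
    (use assms in auto)

lemma tensor3_eqI:
  assumes "s \<in> vcar (tensor (tensor U V) W)" "t \<in> vcar (tensor (tensor U V) W)" "is_vs U" "is_vs V" "is_vs W"
    "\<And>\<Phi> \<Psi> \<Xi>. functional U \<Phi> \<Longrightarrow> functional V \<Psi> \<Longrightarrow> functional W \<Xi> \<Longrightarrow>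
      tpair (tensor U V) W (tpair U V \<Phi> \<Psi>) \<Xi> s = tpair (tensor U V) W (tpair U V \<Phi> \<Psi>) \<Xi> t"
  shows "s = t"
  by (rule separates_eqI[OF separates_tensor[OF separates_tensor[OF separates_functionals separates_functionals]
        separates_functionals] assms(1,2)])
    (use assms in auto)

lemma lmap_id' [simp]: "is_vs V \<Longrightarrow> lmap V V id"
  using lmap_id[of V] by (simp add: id_def)

locale novikov =
  fixes sA :: "'k::field \<Rightarrow> 'a::ab_group_add \<Rightarrow> 'a" and mA :: "'a \<Rightarrow> 'a \<Rightarrow> 'a"
  assumes A: "novikov_algebra sA mA"
begin

abbreviation "A \<equiv> whole sA"

lemma is_vs_A [simp]: "is_vs A"
  using A by (simp add: novikov_algebra_def is_vs_whole)

lemma mA_left_symmetric: "mA (mA a b) c - mA a (mA b c) = mA (mA b a) c - mA b (mA a c)"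
  and mA_right_commutative: "mA (mA a b) c = mA (mA a c) b"
  using A unfolding novikov_algebra_def by blast+

lemma lmap_mA: "lmap A A (mA a)" and lmap_mA_right: "lmap A A (\<lambda>c. mA c a)"
  using A by (auto simp: novikov_algebra_def bilinear_on_def lmap_def)

lemma lmap_Lstar: "lmap A A (Lstar mA a)"
  unfolding Lstar_def using lmap_plus[OF lmap_mA lmap_mA_right] by simp

lemmas mA_simps = lmap_add[OF lmap_mA, simplified] lmap_add[OF lmap_mA_right, simplified]
  lmap_scale[OF lmap_mA, simplified] lmap_scale[OF lmap_mA_right, simplified]
  lmap_minus[OF lmap_mA, simplified] lmap_minus[OF lmap_mA_right, simplified]

lemmas functional_mA = lmap_comp[OF lmap_mA] lmap_comp[OF lmap_mA_right] lmap_comp[OF lmap_Lstar]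

lemma functional_A_simps:
  assumes "functional A \<phi>"
  shows "\<phi> (a + b) = \<phi> a + \<phi> b" "\<phi> (a - b) = \<phi> a - \<phi> b" "\<phi> (- a) = - \<phi> a" "\<phi> (sA c a) = c * \<phi> a" "\<phi> 0 = 0"
  using lmap_add[OF assms] lmap_diff[OF assms] lmap_minus[OF assms] lmap_scale[OF assms] lmap_zero[OF assms]
  by simp_all

lemma A_eqI: "(\<And>\<phi>. functional A \<phi> \<Longrightarrow> \<phi> a = \<phi> b) \<Longrightarrow> a = b"
  using separates_eqI[OF separates_functionals[OF is_vs_A]] by auto

lemma Lstar_commute: "Lstar mA a b = Lstar mA b a"
  by (simp add: Lstar_def add.commute)

lemma Lstar_mA_left: "Lstar mA (mA a b) c = Lstar mA a (mA c b)"
proof -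
  have "mA (mA a b) c + mA c (mA a b) = mA a (mA c b) + mA (mA c b) a"
    using mA_left_symmetric[of a c b] mA_right_commutative[of a b c] mA_right_commutative[of c b a]
    by (simp add: algebra_simps)
  then show ?thesis by (simp add: Lstar_def)
qed

lemma Lstar_mA_right: "Lstar mA a (mA b c) = Lstar mA b (mA a c)"
proof -
  have "mA a (mA b c) + mA (mA b c) a = mA b (mA a c) + mA (mA a c) b"
    using mA_left_symmetric[of a b c] mA_right_commutative[of b c a] mA_right_commutative[of a c b]
    by (simp add: algebra_simps)
  then show ?thesis by (simp add: Lstar_def)
qed

end

locale novikov_ybe = novikov sA mA
  for sA :: "'k::field \<Rightarrow> 'a::ab_group_add \<Rightarrow> 'a" and mA +
  fixes I :: "'i set" and x y :: "'i \<Rightarrow> 'a" and r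
  assumes fin_I: "finite I"
    and r: "r = (\<Sum>\<alpha>\<in>I. tens (whole sA) (whole sA) (x \<alpha>) (y \<alpha>))"
    and skew: "tflip (whole sA) (whole sA) r = - r"
    and nybe: "nybe sA mA I x y"
begin

definition r_pair :: "('a \<Rightarrow> 'k) \<Rightarrow> ('a \<Rightarrow> 'k) \<Rightarrow> 'k" where "r_pair \<phi> \<psi> = tpair A A \<phi> \<psi> r"

text \<open>\<open>r\<close> as a map from the dual space to \<open>A\<close>, contracting its first factor.\<close>

definition \<rho> :: "('a \<Rightarrow> 'k) \<Rightarrow> 'a" where "\<rho> \<phi> = (\<Sum>\<alpha>\<in>I. sA (\<phi> (x \<alpha>)) (y \<alpha>))"

lemma r_in: "r \<in> vcar (tensor A A)"
  unfolding r by (rule is_vs_sum) (auto intro: tens_in_tensor)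

lemma r_pair_sum: "functional A \<phi> \<Longrightarrow> functional A \<psi> \<Longrightarrow> r_pair \<phi> \<psi> = (\<Sum>\<alpha>\<in>I. \<phi> (x \<alpha>) * \<psi> (y \<alpha>))"
  unfolding r_pair_def by (subst r) (simp add: tpair_sum tens_in_tensor tpair_tens)

lemma r_pair_skew: "functional A \<phi> \<Longrightarrow> functional A \<psi> \<Longrightarrow> r_pair \<psi> \<phi> = - r_pair \<phi> \<psi>"
  using tpair_tflip[of A \<phi> A \<psi> r] tpair_minus[of A \<psi> A \<phi> r] r_in unfolding r_pair_def skew by (metis minus_minus)

lemma r_pair_rho: "functional A \<phi> \<Longrightarrow> functional A \<psi> \<Longrightarrow> \<psi> (\<rho> \<phi>) = r_pair \<phi> \<psi>"
  unfolding \<rho>_def by (simp add: r_pair_sum lmap_sum functional_A_simps)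

lemma r_pair_add: "functional A \<phi> \<Longrightarrow> functional A \<phi>' \<Longrightarrow> functional A \<psi> \<Longrightarrow>
      r_pair (\<lambda>a. \<phi> a + \<phi>' a) \<psi> = r_pair \<phi> \<psi> + r_pair \<phi>' \<psi>"
  "functional A \<phi> \<Longrightarrow> functional A \<phi>' \<Longrightarrow> functional A \<psi> \<Longrightarrow>
      r_pair \<psi> (\<lambda>a. \<phi> a + \<phi>' a) = r_pair \<psi> \<phi> + r_pair \<psi> \<phi>'"
  by (simp_all add: r_pair_def tpair_add_left[OF r_in] tpair_add_right[OF r_in])

text \<open>The coproduct \<open>-\<Delta>\<^sub>r\<close>, and below the product on the dual space that it is the transpose of.\<close>

definition \<Delta> :: "'a \<Rightarrow> ('k, 'a, 'a) tens" where "\<Delta> a = - Delta_r sA mA r a"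

definition star :: "('a \<Rightarrow> 'k) \<Rightarrow> ('a \<Rightarrow> 'k) \<Rightarrow> 'a \<Rightarrow> 'k" where
  "star \<phi> \<psi> = (\<lambda>a. tpair A A \<phi> \<psi> (\<Delta> a))"

lemma Delta_in: "\<Delta> a \<in> vcar (tensor A A)"
  unfolding \<Delta>_def Delta_r_def Let_def
  by (intro is_vs_minus is_vs_add is_vs_tensor lmapD(3)[OF lmap_tmap] lmap_mA lmap_Lstar lmap_id' is_vs_A r_in)

lemma star_r_pair:
  assumes "functional A \<phi>" "functional A \<psi>"
  shows "star \<phi> \<psi> a = - r_pair (\<lambda>c. \<phi> (mA a c)) \<psi> - r_pair \<phi> (\<lambda>c. \<psi> (Lstar mA a c))"
proof -
  have i: "tmap A A A A (mA a) id r \<in> vcar (tensor A A)" "tmap A A A A id (Lstar mA a) r \<in> vcar (tensor A A)"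
    by (intro lmapD(3)[OF lmap_tmap] lmap_mA lmap_Lstar lmap_id' is_vs_A r_in)+
  have "star \<phi> \<psi> a = - (tpair A A \<phi> \<psi> (tmap A A A A (mA a) id r) + tpair A A \<phi> \<psi> (tmap A A A A id (Lstar mA a) r))"
    unfolding star_def \<Delta>_def Delta_r_def Let_def
    by (simp only: tpair_minus[OF assms is_vs_add[OF is_vs_tensor i]] tpair_add[OF assms i])
  then show ?thesis
    by (simp add: tpair_tmap lmap_mA lmap_Lstar assms r_in r_pair_def)
qed

text \<open>Contracting the second value of \<open>r\<close> in \<open>star_r_pair\<close> with \<open>\<phi>\<close> gives the value at \<open>\<rho> \<phi>\<close>; skewsymmetry exchanges
  the slots of the first one, which becomes the value at \<open>\<rho> \<psi>\<close>.\<close>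

lemma star_rho:
  assumes "functional A \<phi>" "functional A \<psi>"
  shows "star \<phi> \<psi> a = \<phi> (mA a (\<rho> \<psi>)) - \<psi> (Lstar mA a (\<rho> \<phi>))"
proof -
  note f = functional_mA(1)[OF assms(1), of a] functional_mA(3)[OF assms(2), of a]
  show ?thesis
    unfolding star_r_pair[OF assms] using r_pair_rho[OF assms(2) f(1)] r_pair_rho[OF assms(1) f(2)] r_pair_skew[OF f(1) assms(2)]
    by simp
qed

lemma functional_star: "functional A \<phi> \<Longrightarrow> functional A \<psi> \<Longrightarrow> functional A (star \<phi> \<psi>)"
  by (rule lmapI) (simp_all add: star_rho Lstar_def mA_simps functional_A_simps algebra_simps)

lemma rho_flip:
  assumes "functional A \<psi>" shows "(\<Sum>\<beta>\<in>I. sA (\<psi> (y \<beta>)) (x \<beta>)) = - \<rho> \<psi>"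
proof (rule A_eqI)
  fix \<phi> assume \<phi>: "functional A \<phi>"
  have "\<phi> (\<Sum>\<beta>\<in>I. sA (\<psi> (y \<beta>)) (x \<beta>)) = r_pair \<phi> \<psi>"
    using assms \<phi> by (simp add: r_pair_sum lmap_sum functional_A_simps mult.commute)
  also have "\<dots> = \<phi> (- \<rho> \<psi>)"
    using r_pair_skew[OF assms \<phi>] r_pair_rho[OF assms \<phi>] by (simp add: functional_A_simps[OF \<phi>])
  finally show "\<phi> (\<Sum>\<beta>\<in>I. sA (\<psi> (y \<beta>)) (x \<beta>)) = \<phi> (- \<rho> \<psi>)" .
qed

text \<open>This is the Yang-Baxter equation evaluated at \<open>\<phi> \<otimes> \<psi> \<otimes> \<chi>\<close>. Its first term is \<open>\<chi> (\<rho> \<phi> \<circ> \<rho> \<psi>)\<close>, and the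
  other two are minus the two terms of \<open>\<chi> (\<rho> (star \<phi> \<psi>))\<close> by \<open>star_rho\<close>.\<close>

lemma rho_star:
  assumes \<phi>: "functional A \<phi>" and \<psi>: "functional A \<psi>"
  shows "\<rho> (star \<phi> \<psi>) = mA (\<rho> \<phi>) (\<rho> \<psi>)"
proof (rule A_eqI)
  fix \<chi> assume \<chi>: "functional A \<chi>"
  note F = functional_A_simps[OF \<phi>] functional_A_simps[OF \<psi>] functional_A_simps[OF \<chi>]
  let ?AA = "tensor A A"
  let ?t3 = "\<lambda>a b c. tens ?AA A (tens A A a b) c"
  let ?N = "\<lambda>\<alpha> \<beta>. ?t3 (x \<alpha>) (x \<beta>) (mA (y \<alpha>) (y \<beta>)) + ?t3 (x \<alpha>) (mA (y \<alpha>) (x \<beta>) + mA (x \<beta>) (y \<alpha>)) (y \<beta>)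
      + ?t3 (mA (x \<alpha>) (x \<beta>)) (y \<beta>) (y \<alpha>)"
  note p = functional_tpair[OF functional_tpair[OF \<phi> \<psi>] \<chi>]
  have ti: "?t3 a b c \<in> vcar (tensor ?AA A)" for a b c by (simp add: tens_in_tensor)
  have tv: "tpair ?AA A (tpair A A \<phi> \<psi>) \<chi> (?t3 a b c) = \<phi> a * \<psi> b * \<chi> c" for a b c
    by (simp add: tpair_tens \<phi> \<psi> \<chi> functional_tpair tens_in_tensor)
  have "(\<Sum>\<alpha>\<in>I. \<Sum>\<beta>\<in>I. ?N \<alpha> \<beta>) = 0"
    using nybe by (simp add: nybe_def Let_def)
  then have "0 = tpair ?AA A (tpair A A \<phi> \<psi>) \<chi> (\<Sum>\<alpha>\<in>I. \<Sum>\<beta>\<in>I. ?N \<alpha> \<beta>)"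
    by (simp add: lmap_zero[OF p])
  also have "\<dots> = (\<Sum>\<alpha>\<in>I. \<Sum>\<beta>\<in>I. tpair ?AA A (tpair A A \<phi> \<psi>) \<chi> (?N \<alpha> \<beta>))"
    by (simp add: lmap_sum[OF p] is_vs_sum ti)
  also have "\<dots> = (\<Sum>\<alpha>\<in>I. \<Sum>\<beta>\<in>I. \<phi> (x \<alpha>) * \<psi> (x \<beta>) * \<chi> (mA (y \<alpha>) (y \<beta>)))
      + (\<Sum>\<alpha>\<in>I. \<Sum>\<beta>\<in>I. \<phi> (x \<alpha>) * \<psi> (Lstar mA (x \<beta>) (y \<alpha>)) * \<chi> (y \<beta>))
      + (\<Sum>\<alpha>\<in>I. \<Sum>\<beta>\<in>I. \<phi> (mA (x \<alpha>) (x \<beta>)) * \<psi> (y \<beta>) * \<chi> (y \<alpha>))"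
    by (simp add: lmap_add[OF p] ti tv sum.distrib Lstar_def add.commute)
  also have "(\<Sum>\<alpha>\<in>I. \<Sum>\<beta>\<in>I. \<phi> (x \<alpha>) * \<psi> (x \<beta>) * \<chi> (mA (y \<alpha>) (y \<beta>))) = \<chi> (mA (\<rho> \<phi>) (\<rho> \<psi>))"
  proof -
    have "\<chi> (mA (\<rho> \<phi>) (\<rho> \<psi>)) = (\<Sum>\<alpha>\<in>I. \<phi> (x \<alpha>) * \<chi> (mA (y \<alpha>) (\<rho> \<psi>)))"
      unfolding \<rho>_def[of \<phi>]
      by (subst lmap_sum[OF functional_mA(2)[OF \<chi>]]) (simp_all add: mA_simps F)
    also have "\<dots> = (\<Sum>\<alpha>\<in>I. \<phi> (x \<alpha>) * (\<Sum>\<beta>\<in>I. \<psi> (x \<beta>) * \<chi> (mA (y \<alpha>) (y \<beta>))))"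
      unfolding \<rho>_def
      by (subst lmap_sum[OF functional_mA(1)[OF \<chi>]]) (simp_all add: mA_simps F)
    finally show ?thesis by (simp add: sum_distrib_left mult.assoc)
  qed
  also have "(\<Sum>\<alpha>\<in>I. \<Sum>\<beta>\<in>I. \<phi> (x \<alpha>) * \<psi> (Lstar mA (x \<beta>) (y \<alpha>)) * \<chi> (y \<beta>)) =
      (\<Sum>\<beta>\<in>I. \<psi> (Lstar mA (x \<beta>) (\<rho> \<phi>)) * \<chi> (y \<beta>))"
  proof -
    have "\<psi> (Lstar mA (x \<beta>) (\<rho> \<phi>)) = (\<Sum>\<alpha>\<in>I. \<phi> (x \<alpha>) * \<psi> (Lstar mA (x \<beta>) (y \<alpha>)))" for \<beta>
      unfolding \<rho>_def
      by (subst lmap_sum[OF functional_mA(3)[OF \<psi>]]) (simp_all add: lmap_scale[OF lmap_Lstar, simplified] F)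
    then show ?thesis by (subst sum.swap) (simp add: sum_distrib_right)
  qed
  also have "(\<Sum>\<alpha>\<in>I. \<Sum>\<beta>\<in>I. \<phi> (mA (x \<alpha>) (x \<beta>)) * \<psi> (y \<beta>) * \<chi> (y \<alpha>)) =
      - (\<Sum>\<alpha>\<in>I. \<phi> (mA (x \<alpha>) (\<rho> \<psi>)) * \<chi> (y \<alpha>))"
  proof -
    have "\<phi> (mA (x \<alpha>) (\<rho> \<psi>)) = - (\<Sum>\<beta>\<in>I. \<phi> (mA (x \<alpha>) (x \<beta>)) * \<psi> (y \<beta>))" for \<alpha>
    proof -
      have "- \<phi> (mA (x \<alpha>) (\<rho> \<psi>)) = \<phi> (mA (x \<alpha>) (\<Sum>\<beta>\<in>I. sA (\<psi> (y \<beta>)) (x \<beta>)))"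
        by (simp add: rho_flip[OF \<psi>] mA_simps F)
      also have "\<dots> = (\<Sum>\<beta>\<in>I. \<phi> (mA (x \<alpha>) (x \<beta>)) * \<psi> (y \<beta>))"
        by (subst lmap_sum[OF functional_mA(1)[OF \<phi>]]) (simp_all add: mA_simps F mult.commute)
      finally show ?thesis by (metis minus_minus)
    qed
    then show ?thesis by (simp add: sum_distrib_right sum_negf)
  qed
  finally have "\<chi> (mA (\<rho> \<phi>) (\<rho> \<psi>)) = (\<Sum>\<beta>\<in>I. star \<phi> \<psi> (x \<beta>) * \<chi> (y \<beta>))"
    by (simp add: star_rho[OF \<phi> \<psi>] left_diff_distrib sum_subtractf algebra_simps eq_neg_iff_add_eq_0)
  then show "\<chi> (\<rho> (star \<phi> \<psi>)) = \<chi> (mA (\<rho> \<phi>) (\<rho> \<psi>))"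
    using r_pair_rho[OF functional_star[OF \<phi> \<psi>] \<chi>] r_pair_sum[OF functional_star[OF \<phi> \<psi>] \<chi>] by simp
qed

text \<open>\<open>star_rho\<close> and \<open>rho_star\<close> expand a double product into one term for each of the three functionals, and
  each of these terms obeys an identity of \<open>A\<close> on its own.\<close>

lemma
  assumes \<phi>: "functional A \<phi>" and \<psi>: "functional A \<psi>" and \<chi>: "functional A \<chi>"
  shows star_right_commutative: "star (star \<phi> \<psi>) \<chi> a = star (star \<phi> \<chi>) \<psi> a"
    and star_left_symmetric:
      "star (star \<phi> \<psi>) \<chi> a + star \<psi> (star \<phi> \<chi>) a = star (star \<psi> \<phi>) \<chi> a + star \<phi> (star \<psi> \<chi>) a"
proof -
  note s = functional_star[OF \<phi> \<psi>] functional_star[OF \<psi> \<chi>] functional_star[OF \<phi> \<chi>] functional_star[OF \<psi> \<phi>]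
  have l: "star (star \<phi> \<psi>) \<chi> a = \<phi> (mA (mA a (\<rho> \<chi>)) (\<rho> \<psi>)) - \<psi> (Lstar mA (\<rho> \<phi>) (mA a (\<rho> \<chi>)))
      - \<chi> (Lstar mA (\<rho> \<phi>) (mA a (\<rho> \<psi>)))"
    if "functional A \<phi>" "functional A \<psi>" "functional A \<chi>" for \<phi> \<psi> \<chi>
    using that by (simp add: star_rho functional_star rho_star Lstar_commute[of _ "\<rho> \<phi>"]
        Lstar_commute[of _ "mA (\<rho> \<phi>) (\<rho> \<psi>)"] Lstar_mA_left)
  have rt: "star \<phi> (star \<psi> \<chi>) a = \<phi> (mA a (mA (\<rho> \<psi>) (\<rho> \<chi>))) - \<psi> (mA (Lstar mA (\<rho> \<phi>) a) (\<rho> \<chi>))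
      + \<chi> (Lstar mA (\<rho> \<psi>) (Lstar mA (\<rho> \<phi>) a))"
    if "functional A \<phi>" "functional A \<psi>" "functional A \<chi>" for \<phi> \<psi> \<chi>
    using that by (simp add: star_rho functional_star rho_star Lstar_commute[of _ "\<rho> \<phi>"] Lstar_commute[of _ "\<rho> \<psi>"])
  show "star (star \<phi> \<psi>) \<chi> a = star (star \<phi> \<chi>) \<psi> a"
    using mA_right_commutative[of a "\<rho> \<psi>" "\<rho> \<chi>"] by (simp add: l \<phi> \<psi> \<chi>)
  define u v w where uvw: "u = \<rho> \<phi>" "v = \<rho> \<psi>" "w = \<rho> \<chi>"
  have 1: "\<phi> (mA (mA a w) v) + \<phi> (Lstar mA v (mA a w)) = \<phi> (mA (Lstar mA v a) w) + \<phi> (mA a (mA v w))"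
    using arg_cong[OF mA_left_symmetric[of a v w], of \<phi>] mA_right_commutative[of a w v]
    by (simp add: Lstar_def mA_simps functional_A_simps[OF \<phi>] algebra_simps)
  have 2: "\<psi> (mA (mA a w) u) + \<psi> (Lstar mA u (mA a w)) = \<psi> (mA (Lstar mA u a) w) + \<psi> (mA a (mA u w))"
    using arg_cong[OF mA_left_symmetric[of a u w], of \<psi>] mA_right_commutative[of a w u]
    by (simp add: Lstar_def mA_simps functional_A_simps[OF \<psi>] algebra_simps)
  have 3: "\<chi> (Lstar mA u (mA a v)) + \<chi> (Lstar mA v (Lstar mA u a)) = \<chi> (Lstar mA v (mA a u)) + \<chi> (Lstar mA u (Lstar mA v a))"
  proof -
    have "\<chi> (Lstar mA v (mA u a)) = \<chi> (Lstar mA u (mA v a))" by (simp add: Lstar_mA_right[of v u a])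
    moreover have "\<chi> (Lstar mA b (Lstar mA c a)) = \<chi> (Lstar mA b (mA c a)) + \<chi> (Lstar mA b (mA a c))" for b c
      by (simp add: Lstar_def[of mA c a] lmap_add[OF functional_mA(3)[OF \<chi>]])
    ultimately show ?thesis by simp
  qed
  show "star (star \<phi> \<psi>) \<chi> a + star \<psi> (star \<phi> \<chi>) a = star (star \<psi> \<phi>) \<chi> a + star \<phi> (star \<psi> \<chi>) a"
    unfolding l[OF \<phi> \<psi> \<chi>] l[OF \<psi> \<phi> \<chi>] rt[OF \<phi> \<psi> \<chi>] rt[OF \<psi> \<phi> \<chi>] uvw[symmetric]
    using 1 2 3 by algebra
qed

lemma lmap_Delta: "lmap A (tensor A A) \<Delta>"
proof (rule lmapI)
  fix a b
  show "\<Delta> (a + b) = \<Delta> a + \<Delta> b"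
    by (rule tensor_eqI[of _ A A])
      (use lmap_add[OF functional_star] in \<open>auto simp: Delta_in tpair_add star_def\<close>)
next
  fix c a
  have sc: "tscale c (\<Delta> a) \<in> vcar (tensor A A)" using is_vs_scale[OF is_vs_tensor Delta_in] by simp
  have "\<Delta> (sA c a) = tscale c (\<Delta> a)"
    by (rule tensor_eqI[of _ A A])
      (use lmap_scale[OF functional_star] sc lmap_scale[OF functional_tpair Delta_in]
        in \<open>auto simp: Delta_in star_def\<close>)
  then show "\<Delta> (vscl A c a) = vscl (tensor A A) c (\<Delta> a)" by simp
qed (auto simp: Delta_in)

text \<open>At three functionals the coalgebra identities are the Novikov identities of \<open>star\<close>.\<close>

lemma novikov_coalgebra_Delta: "novikov_coalgebra sA \<Delta>"
proof -
  let ?AA = "tensor A A"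
  let ?i = "\<lambda>t. tassoc A A A (tmap A A A ?AA id \<Delta> t)" and ?d = "tmap A A ?AA A \<Delta> id"
    and ?f = "tmap ?AA A ?AA A (tflip A A) id"
  note lf = lmap_tflip[OF is_vs_A is_vs_A]
  note il = lmap_tmap[OF lmap_id'[OF is_vs_A] lmap_Delta] and dl = lmap_tmap[OF lmap_Delta lmap_id'[OF is_vs_A]]
    and fl = lmap_tmap[OF lf lmap_id'[OF is_vs_A]]
  have ii: "?i t \<in> vcar (tensor ?AA A)" if "t \<in> vcar ?AA" for t
    by (rule lmapD(3)[OF lmap_tassoc lmapD(3)[OF il that]]) auto
  note di = lmapD(3)[OF dl] and fi = lmapD(3)[OF fl] and tfi = lmapD(3)[OF lf]
  have f: "tpair ?AA A (tpair A A \<phi> \<psi>) \<chi> (?f t) = tpair ?AA A (tpair A A \<psi> \<phi>) \<chi> t"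
    if F: "functional A \<phi>" "functional A \<psi>" "functional A \<chi>" and t: "t \<in> vcar (tensor ?AA A)" for \<phi> \<psi> \<chi> t
  proof -
    have "tpair ?AA A (tpair A A \<phi> \<psi>) \<chi> (?f t) = tpair ?AA A (\<lambda>s. tpair A A \<phi> \<psi> (tflip A A s)) \<chi> t"
      using tpair_tmap[OF lf lmap_id'[OF is_vs_A] functional_tpair[OF F(1,2)] F(3) t] by simp
    also have "\<dots> = tpair ?AA A (tpair A A \<psi> \<phi>) \<chi> t"
      by (rule tpair_cong_whole[OF t])
        (use F in \<open>auto intro!: lmap_comp[OF lf] functional_tpair simp: tpair_tflip\<close>)
    finally show ?thesis .
  qed
  have i: "tpair ?AA A (tpair A A \<phi> \<psi>) \<chi> (?i t) = tpair A A \<phi> (star \<psi> \<chi>) t"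
    if F: "functional A \<phi>" "functional A \<psi>" "functional A \<chi>" and t: "t \<in> vcar ?AA" for \<phi> \<psi> \<chi> t
    using tpair_tassoc[OF F lmapD(3)[OF il t]]
      tpair_tmap[OF lmap_id'[OF is_vs_A] lmap_Delta F(1) functional_tpair[OF F(2,3)] t]
    by (simp add: star_def)
  have d: "tpair ?AA A (tpair A A \<phi> \<psi>) \<chi> (?d t) = tpair A A (star \<phi> \<psi>) \<chi> t"
    if F: "functional A \<phi>" "functional A \<psi>" "functional A \<chi>" and t: "t \<in> vcar ?AA" for \<phi> \<psi> \<chi> t
    using tpair_tmap[OF lmap_Delta lmap_id'[OF is_vs_A] functional_tpair[OF F(1,2)] F(3) t]
    by (simp add: star_def)
  have st: "tpair A A \<phi> \<psi> (\<Delta> a) = star \<phi> \<psi> a" for \<phi> \<psi> a by (simp add: star_def)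
  have "?i (\<Delta> a) - ?f (?i (\<Delta> a)) = ?d (\<Delta> a) - ?f (?d (\<Delta> a))" for a
  proof (rule tensor3_eqI[of _ A A A])
    fix \<phi> \<psi> \<chi> assume F: "functional A \<phi>" "functional A \<psi>" "functional A \<chi>"
    note p = functional_tpair[OF functional_tpair[OF F(1,2)] F(3)]
    show "tpair ?AA A (tpair A A \<phi> \<psi>) \<chi> (?i (\<Delta> a) - ?f (?i (\<Delta> a))) =
        tpair ?AA A (tpair A A \<phi> \<psi>) \<chi> (?d (\<Delta> a) - ?f (?d (\<Delta> a)))"
      using star_left_symmetric[OF F, of a]
      by (simp add: lmap_diff[OF p] ii di fi Delta_in f i d F functional_star st) (simp add: algebra_simps)
  qed (auto simp: ii di fi Delta_in)
  moreover have "?f (?i (tflip A A (\<Delta> a))) = ?d (\<Delta> a)" for a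
    by (rule tensor3_eqI[of _ A A A])
      (auto simp: ii di fi tfi Delta_in f i d tpair_tflip functional_star st star_right_commutative)
  moreover have "vector_space sA" using A by (simp add: novikov_algebra_def)
  moreover have "linear_on A tscale \<Delta>" using lmapD(4)[OF lmap_Delta] by simp
  ultimately show ?thesis by (simp add: novikov_coalgebra_def Let_def Delta_in)
qed

text \<open>At two functionals each compatibility condition is an identity between values of \<open>r\<close> at
  translated functionals. Skewsymmetry puts \<open>\<phi>\<close> into the first slot everywhere; the mixed terms cancel or
  are symmetric in \<open>a\<close> and \<open>b\<close>, and the terms with both translations in one slot match by
  right commutativity or by \<open>Lstar_mA_left\<close> and \<open>Lstar_mA_right\<close>.\<close>

lemma novikov_bialgebra_Delta: "novikov_bialgebra sA mA \<Delta>"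
proof -
  note lf = lmap_tflip[OF is_vs_A is_vs_A] and id = lmap_id'[OF is_vs_A]
  let ?tm = "tmap A A A A" and ?\<tau> = "tflip A A" and ?Ls = "Lstar mA"
  note ts = lmapD(3)[OF lmap_tmap[OF lmap_mA id]] lmapD(3)[OF lmap_tmap[OF id lmap_mA]]
     lmapD(3)[OF lmap_tmap[OF lmap_mA_right id]] lmapD(3)[OF lmap_tmap[OF id lmap_mA_right]]
     lmapD(3)[OF lmap_tmap[OF lmap_Lstar id]] lmapD(3)[OF lmap_tmap[OF id lmap_Lstar]] lmapD(3)[OF lf]
  have tD: "tpair A A \<phi> \<psi> (\<Delta> a) = star \<phi> \<psi> a" for \<phi> \<psi> a by (simp add: star_def)
  have tf: "tpair A A \<phi> \<psi> (?\<tau> (\<Delta> a)) = star \<psi> \<phi> a" if "functional A \<phi>" "functional A \<psi>" for \<phi> \<psi> a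
    using that by (simp add: tpair_tflip Delta_in star_def)
  note S = ts Delta_in tpair_add tpair_diff tpair_tmap lmap_mA lmap_mA_right lmap_Lstar id tD tf
  have 1: "\<Delta> (mA a b) = ?tm (\<lambda>c. mA c b) id (\<Delta> a) + ?tm id (?Ls a) (\<Delta> b + ?\<tau> (\<Delta> b))" for a b
  proof (rule tensor_eqI[of _ A A])
    fix \<phi> \<psi> assume F: "functional A \<phi>" "functional A \<psi>"
    note fs = functional_mA[OF F(1)] functional_mA[OF F(2)]
      functional_mA(1)[OF functional_mA(2)[OF F(1)]] functional_mA(3)[OF functional_mA(3)[OF F(2)]]
      functional_mA(1)[OF functional_mA(3)[OF F(2)]] functional_mA(2)[OF functional_mA(3)[OF F(2)]]
    have "star \<phi> \<psi> (mA a b) = star (\<lambda>c. \<phi> (mA c b)) \<psi> a + star \<phi> (\<lambda>c. \<psi> (?Ls a c)) b + star (\<lambda>c. \<psi> (?Ls a c)) \<phi> b"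
    proof -
      have e1: "(\<lambda>c. \<phi> (mA (mA a b) c)) = (\<lambda>c. \<phi> (mA (mA a c) b))" by (simp add: mA_right_commutative)
      have e2: "(\<lambda>c. \<psi> (?Ls a (?Ls b c))) = (\<lambda>c. \<psi> (?Ls a (mA b c)) + \<psi> (?Ls (mA a b) c))"
        by (simp add: Lstar_def[of mA b] lmap_add[OF functional_mA(3)[OF F(2)]] Lstar_mA_left)
      have e3: "r_pair (\<lambda>c. \<psi> (?Ls a c)) (\<lambda>c. \<phi> (?Ls b c)) = - r_pair (\<lambda>c. \<phi> (mA b c)) (\<lambda>c. \<psi> (?Ls a c)) - r_pair (\<lambda>c. \<phi> (mA c b)) (\<lambda>c. \<psi> (?Ls a c))"
        using r_pair_skew[OF fs(3)[of b] fs(6)[of a]] r_pair_add(1)[OF fs(1)[of b] fs(2)[of b] fs(6)[of a]]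
        by (simp add: Lstar_def[of mA b] functional_A_simps[OF F(1)])
      have e4: "r_pair (\<lambda>c. \<psi> (?Ls a (mA b c))) \<phi> = - r_pair \<phi> (\<lambda>c. \<psi> (?Ls a (mA b c)))"
        by (rule r_pair_skew[OF F(1) fs(9)])
      have e5: "r_pair \<phi> (\<lambda>c. \<psi> (?Ls a (?Ls b c))) = r_pair \<phi> (\<lambda>c. \<psi> (?Ls a (mA b c))) + r_pair \<phi> (\<lambda>c. \<psi> (?Ls (mA a b) c))"
        unfolding e2 by (rule r_pair_add(2)[OF fs(9) functional_mA(3)[OF F(2)] F(1)])
      show ?thesis
        by (simp add: star_r_pair F fs e1 e3 e4 e5)
    qed
    then show "tpair A A \<phi> \<psi> (\<Delta> (mA a b)) =
        tpair A A \<phi> \<psi> (?tm (\<lambda>c. mA c b) id (\<Delta> a) + ?tm id (?Ls a) (\<Delta> b + ?\<tau> (\<Delta> b)))"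
      by (simp add: S F fs)
  qed (auto simp: ts Delta_in)
  have 2: "?tm (?Ls a) id (\<Delta> b) - ?tm id (?Ls a) (?\<tau> (\<Delta> b)) =
      ?tm (?Ls b) id (\<Delta> a) - ?tm id (?Ls b) (?\<tau> (\<Delta> a))" for a b
  proof (rule tensor_eqI[of _ A A])
    fix \<phi> \<psi> assume F: "functional A \<phi>" "functional A \<psi>"
    note fs = functional_mA[OF F(1)] functional_mA[OF F(2)]
      functional_mA(1)[OF functional_mA(3)[OF F(1)]] functional_mA(1)[OF functional_mA(3)[OF F(2)]]
    have e: "star (\<lambda>c. \<phi> (?Ls a c)) \<psi> b - star (\<lambda>c. \<psi> (?Ls a c)) \<phi> b =
        - r_pair (\<lambda>c. \<phi> (?Ls a (mA b c))) \<psi> - r_pair (\<lambda>c. \<phi> (?Ls a c)) (\<lambda>c. \<psi> (?Ls b c))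
        - r_pair \<phi> (\<lambda>c. \<psi> (?Ls a (mA b c))) - r_pair (\<lambda>c. \<phi> (?Ls b c)) (\<lambda>c. \<psi> (?Ls a c))" for a b
      using r_pair_skew[OF F(1) fs(8)[of a b]] r_pair_skew[OF fs(3)[of b] fs(6)[of a]]
      by (simp add: star_r_pair F fs)
    have "(\<lambda>c. \<phi> (?Ls a (mA b c))) = (\<lambda>c. \<phi> (?Ls b (mA a c)))" "(\<lambda>c. \<psi> (?Ls a (mA b c))) = (\<lambda>c. \<psi> (?Ls b (mA a c)))"
      by (simp_all add: Lstar_mA_right[of a b])
    then have "star (\<lambda>c. \<phi> (?Ls a c)) \<psi> b - star (\<lambda>c. \<psi> (?Ls a c)) \<phi> b =
      star (\<lambda>c. \<phi> (?Ls b c)) \<psi> a - star (\<lambda>c. \<psi> (?Ls b c)) \<phi> a"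
      unfolding e by simp
    then show "tpair A A \<phi> \<psi> (?tm (?Ls a) id (\<Delta> b) - ?tm id (?Ls a) (?\<tau> (\<Delta> b))) =
        tpair A A \<phi> \<psi> (?tm (?Ls b) id (\<Delta> a) - ?tm id (?Ls b) (?\<tau> (\<Delta> a)))"
      by (simp add: S F fs)
  qed (auto simp: ts Delta_in)
  have 3: "?tm id (\<lambda>c. mA c a) (\<Delta> b + ?\<tau> (\<Delta> b)) - ?tm (\<lambda>c. mA c a) id (\<Delta> b + ?\<tau> (\<Delta> b)) =
      ?tm id (\<lambda>c. mA c b) (\<Delta> a + ?\<tau> (\<Delta> a)) - ?tm (\<lambda>c. mA c b) id (\<Delta> a + ?\<tau> (\<Delta> a))" for a b
  proof (rule tensor_eqI[of _ A A])
    fix \<phi> \<psi> assume F: "functional A \<phi>" "functional A \<psi>"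
    note fs = functional_mA[OF F(1)] functional_mA[OF F(2)]
    have sym: "star \<phi> \<psi> b + star \<psi> \<phi> b = r_pair (\<lambda>c. \<phi> (mA c b)) \<psi> - r_pair \<phi> (\<lambda>c. \<psi> (mA c b))"
      if F: "functional A \<phi>" "functional A \<psi>" for \<phi> \<psi> b
    proof -
      note fs = functional_mA[OF F(1), of b] functional_mA[OF F(2), of b]
      have "r_pair (\<lambda>c. \<phi> (?Ls b c)) \<psi> = r_pair (\<lambda>c. \<phi> (mA b c)) \<psi> + r_pair (\<lambda>c. \<phi> (mA c b)) \<psi>"
        "r_pair \<phi> (\<lambda>c. \<psi> (?Ls b c)) = r_pair \<phi> (\<lambda>c. \<psi> (mA b c)) + r_pair \<phi> (\<lambda>c. \<psi> (mA c b))"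
        using r_pair_add(1)[OF fs(1,2) F(2)] r_pair_add(2)[OF fs(4,5) F(1)]
        by (simp_all add: Lstar_def functional_A_simps F)
      then show ?thesis
        using r_pair_skew[OF F(1) fs(4)] r_pair_skew[OF fs(3) F(2)] by (simp add: star_r_pair F)
    qed
    have c: "(\<lambda>c. \<phi> (mA (mA c b) a)) = (\<lambda>c. \<phi> (mA (mA c a) b))" "(\<lambda>c. \<psi> (mA (mA c b) a)) = (\<lambda>c. \<psi> (mA (mA c a) b))"
      by (simp_all add: mA_right_commutative[of _ b a])
    have "(star \<phi> (\<lambda>c. \<psi> (mA c a)) b + star (\<lambda>c. \<psi> (mA c a)) \<phi> b) - (star (\<lambda>c. \<phi> (mA c a)) \<psi> b + star \<psi> (\<lambda>c. \<phi> (mA c a)) b) =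
      (star \<phi> (\<lambda>c. \<psi> (mA c b)) a + star (\<lambda>c. \<psi> (mA c b)) \<phi> a) - (star (\<lambda>c. \<phi> (mA c b)) \<psi> a + star \<psi> (\<lambda>c. \<phi> (mA c b)) a)"
      unfolding sym[OF F(1) fs(5)] sym[OF fs(2) F(2)] c by simp
    then show "tpair A A \<phi> \<psi> (?tm id (\<lambda>c. mA c a) (\<Delta> b + ?\<tau> (\<Delta> b)) - ?tm (\<lambda>c. mA c a) id (\<Delta> b + ?\<tau> (\<Delta> b))) =
      tpair A A \<phi> \<psi> (?tm id (\<lambda>c. mA c b) (\<Delta> a + ?\<tau> (\<Delta> a)) - ?tm (\<lambda>c. mA c b) id (\<Delta> a + ?\<tau> (\<Delta> a)))"
      by (simp add: S F fs)
  qed (auto simp: ts Delta_in)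
  show ?thesis
    unfolding novikov_bialgebra_def Let_def
    using A novikov_coalgebra_Delta 1 2 3 by blast
qed

end

section \<open>Bilinear maps on two tensor products\<close>

text \<open>Both the bracket of \<open>A \<otimes> B\<close> and \<open>u \<bullet> v\<close> are nested lifts of this shape.\<close>

lemma
  fixes Z :: "('k::field, 'z::ab_group_add) vs"
  assumes vs: "is_vs V" "is_vs W" "is_vs V'" "is_vs W'" "is_vs Z"
    and K1: "\<And>v w. v \<in> vcar V \<Longrightarrow> w \<in> vcar W \<Longrightarrow> bilin V' W' Z (K v w)"
    and K2: "\<And>v' w'. v' \<in> vcar V' \<Longrightarrow> w' \<in> vcar W' \<Longrightarrow> bilin V W Z (\<lambda>v w. K v w v' w')"
  defines "T \<equiv> \<lambda>s t. tlift V W (vscl Z) (\<lambda>v w. tlift V' W' (vscl Z) (K v w) t) s"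
  shows bilin_tlift2: "bilin (tensor V W) (tensor V' W') Z T"
    and tlift2_tens: "\<And>v w v' w'. v \<in> vcar V \<Longrightarrow> w \<in> vcar W \<Longrightarrow> v' \<in> vcar V' \<Longrightarrow> w' \<in> vcar W' \<Longrightarrow>
      T (tens V W v w) (tens V' W' v' w') = K v w v' w'"
proof -
  let ?g = "\<lambda>v w. tlift V' W' (vscl Z) (K v w)"
  have g: "lmap (tensor V' W') Z (?g v w)" and gt: "\<And>v' w'. v' \<in> vcar V' \<Longrightarrow> w' \<in> vcar W' \<Longrightarrow>
      ?g v w (tens V' W' v' w') = K v w v' w'" if "v \<in> vcar V" "w \<in> vcar W" for v w
    using lmap_tlift[OF vs(3-5) K1[OF that]] tlift_tens[OF vs(3-5) K1[OF that]] by auto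
  have b: "bilin V W Z (\<lambda>v w. ?g v w t)" if t: "t \<in> vcar (tensor V' W')" for t
  proof (rule bilinI[OF vs(1,2,5)])
    fix v w assume vw: "v \<in> vcar V" "w \<in> vcar W"
    show "?g v w t \<in> vcar Z" by (rule lmapD(3)[OF g[OF vw] t])
    { fix u assume u: "u \<in> vcar V"
      show "?g (u + v) w t = ?g u w t + ?g v w t"
        by (rule lmap_tensor_eqI[OF g lmap_plus[OF g g] vs(3,4) _ t])
          (use u vw vs lmap_add[OF bilinD(1)[OF K2]] in \<open>auto simp: gt\<close>) }
    { fix u assume u: "u \<in> vcar W"
      show "?g v (w + u) t = ?g v w t + ?g v u t"
        by (rule lmap_tensor_eqI[OF g lmap_plus[OF g g] vs(3,4) _ t])
          (use u vw vs lmap_add[OF bilinD(2)[OF K2]] in \<open>auto simp: gt\<close>) }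
    { fix c
      show "?g (vscl V c v) w t = vscl Z c (?g v w t)"
        by (rule lmap_tensor_eqI[OF g lmap_comp[OF g lmap_scl[OF vs(5)]] vs(3,4) _ t])
          (use vw vs lmap_scale[OF bilinD(1)[OF K2]] in \<open>auto simp: gt\<close>) }
    { fix c
      show "?g v (vscl W c w) t = vscl Z c (?g v w t)"
        by (rule lmap_tensor_eqI[OF g lmap_comp[OF g lmap_scl[OF vs(5)]] vs(3,4) _ t])
          (use vw vs lmap_scale[OF bilinD(2)[OF K2]] in \<open>auto simp: gt\<close>) }
  qed
  have l: "lmap (tensor V W) Z (\<lambda>s. T s t)" and lt: "\<And>v w. v \<in> vcar V \<Longrightarrow> w \<in> vcar W \<Longrightarrow> T (tens V W v w) t = ?g v w t"
    if "t \<in> vcar (tensor V' W')" for t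
    unfolding T_def using lmap_tlift[OF vs(1,2,5) b[OF that]] tlift_tens[OF vs(1,2,5) b[OF that]] by auto
  note t = is_vs_tensor
  have "lmap (tensor V' W') Z (T s)" if s: "s \<in> vcar (tensor V W)" for s
  proof (rule lmapI[OF t vs(5)])
    fix t assume "t \<in> vcar (tensor V' W')" then show "T s t \<in> vcar Z" by (rule lmapD(3)[OF l s])
  next
    fix t t' assume t: "t \<in> vcar (tensor V' W')" "t' \<in> vcar (tensor V' W')"
    then have tt: "t + t' \<in> vcar (tensor V' W')" by simp
    show "T s (t + t') = T s t + T s t'"
      by (rule lmap_tensor_eqI[OF l[OF tt] lmap_plus[OF l[OF t(1)] l[OF t(2)]] vs(1,2) _ s])
        (use t tt in \<open>auto simp: lt lmap_add[OF g]\<close>)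
  next
    fix c t assume t: "t \<in> vcar (tensor V' W')"
    have ct: "vscl (tensor V' W') c t \<in> vcar (tensor V' W')" by (rule is_vs_scale[OF is_vs_tensor t])
    show "T s (vscl (tensor V' W') c t) = vscl Z c (T s t)"
      by (rule lmap_tensor_eqI[OF l[OF ct] lmap_comp[OF l[OF t] lmap_scl[OF vs(5)]] vs(1,2) _ s])
        (use t ct lmap_scale[OF g] in \<open>auto simp: lt\<close>)
  qed
  then show "bilin (tensor V W) (tensor V' W') Z T" using l by (simp add: bilin_def)
  show "T (tens V W v w) (tens V' W' v' w') = K v w v' w'"
    if "v \<in> vcar V" "w \<in> vcar W" "v' \<in> vcar V'" "w' \<in> vcar W'" for v w v' w'
    using that by (simp add: lt gt tens_in_tensor)
qed

section \<open>Quadratic graded right Novikov algebras\<close>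

locale quadratic_novikov =
  fixes sB :: "'k::field \<Rightarrow> 'b::ab_group_add \<Rightarrow> 'b" and G :: "int \<Rightarrow> 'b set"
    and mB :: "'b \<Rightarrow> 'b \<Rightarrow> 'b" and form :: "'b \<Rightarrow> 'b \<Rightarrow> 'k"
  assumes B: "quadratic_graded_right_novikov sB G mB form"
begin

abbreviation "B \<equiv> whole sB"
abbreviation "Bh i \<equiv> B\<lparr>vcar := G i\<rparr>"

lemma quadratic_axioms:
  "right_novikov_algebra sB mB" "graded_space B G" "\<forall>i. \<exists>S. finite S \<and> G i = module.span sB S"
  "\<forall>i j. \<forall>a\<in>G i. \<forall>b\<in>G j. mB a b \<in> G (i + j)" "bilinear_on B B (*) form"
  "\<forall>a b. form a b = form b a" "\<forall>a. (\<forall>b. form a b = 0) \<longrightarrow> a = 0"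
  "\<exists>d. \<forall>i j. i + j + d \<noteq> 0 \<longrightarrow> (\<forall>a\<in>G i. \<forall>b\<in>G j. form a b = 0)"
  "\<forall>a b c. form (mB a b) c = - form a (mB b c + mB c b)"
  using B unfolding quadratic_graded_right_novikov_def by - ((elim conjE, assumption)+)

lemmas graded_B = quadratic_axioms(2)

lemma is_vs_B [simp]: "is_vs B" by (rule graded_is_vs[OF graded_B])

lemma mB_right_symmetric: "mB (mB a b) c + mB a (mB c b) = mB (mB a c) b + mB a (mB b c)"
  and mB_left_commutative: "mB a (mB b c) = mB b (mB a c)"
proof -
  note R = quadratic_axioms(1)
  have "mB (mB a b) c - mB a (mB b c) = mB (mB a c) b - mB a (mB c b)"
    using R unfolding right_novikov_algebra_def by blast
  then show "mB (mB a b) c + mB a (mB c b) = mB (mB a c) b + mB a (mB b c)"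
    by (simp add: algebra_simps)
  show "mB a (mB b c) = mB b (mB a c)"
    using R unfolding right_novikov_algebra_def by blast
qed

lemma mB_deg: "a \<in> G i \<Longrightarrow> b \<in> G j \<Longrightarrow> mB a b \<in> G (i + j)"
  using quadratic_axioms(4) by blast

lemma lmap_mB: "lmap B B (mB a)" and lmap_mB_right: "lmap B B (\<lambda>c. mB c a)"
  using quadratic_axioms(1) by (auto simp: right_novikov_algebra_def bilinear_on_def lmap_def)

lemmas mB_simps = lmap_add[OF lmap_mB, simplified] lmap_add[OF lmap_mB_right, simplified]
  lmap_scale[OF lmap_mB, simplified] lmap_scale[OF lmap_mB_right, simplified]

lemma functional_form: "functional B (form a)" and functional_form_right: "functional B (\<lambda>c. form c a)"
  using quadratic_axioms(5) by (auto simp: bilinear_on_def lmap_def)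

lemmas form_simps = lmap_add[OF functional_form, simplified] lmap_add[OF functional_form_right, simplified]
  lmap_scale[OF functional_form, simplified] lmap_scale[OF functional_form_right, simplified]
  lmap_diff[OF functional_form, simplified] lmap_diff[OF functional_form_right, simplified]
  lmap_zero[OF functional_form] lmap_zero[OF functional_form_right]

lemma form_sym: "form a b = form b a"
  and form_nondegenerate: "(\<And>b. form a b = 0) \<Longrightarrow> a = 0"
  and form_mB: "form (mB a b) c = - form a (mB b c) - form a (mB c b)"
proof -
  note q = quadratic_axioms(6,7,9)
  show "form a b = form b a" using q(1) by blast
  show "(\<And>b. form a b = 0) \<Longrightarrow> a = 0" using q(2) by blast
  show "form (mB a b) c = - form a (mB b c) - form a (mB c b)"
    using q(3) by (simp add: form_simps)
qed

text \<open>Invariance is symmetric in \<open>b\<close> and \<open>c\<close>, and with symmetry of the form this makes left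
  multiplication self-adjoint.\<close>

lemma form_mB_swap: "form (mB a b) c = form (mB a c) b"
  by (simp add: form_mB)

lemma form_mB_self_adjoint: "form (mB a b) c = form b (mB a c)"
  by (simp add: form_mB_swap[of a b c] form_sym[of b])

text \<open>The degree of the form: \<open>G i\<close> pairs nontrivially with \<open>G (- d - i)\<close> only.\<close>

definition d :: int where "d = (SOME d. \<forall>i j. i + j + d \<noteq> 0 \<longrightarrow> (\<forall>a\<in>G i. \<forall>b\<in>G j. form a b = 0))"

lemma form_deg: "a \<in> G i \<Longrightarrow> b \<in> G j \<Longrightarrow> i \<noteq> - d - j \<Longrightarrow> form a b = 0"
proof -
  have "\<forall>i j. i + j + d \<noteq> 0 \<longrightarrow> (\<forall>a\<in>G i. \<forall>b\<in>G j. form a b = 0)"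
    unfolding d_def by (rule someI_ex[OF quadratic_axioms(8)])
  moreover assume "a \<in> G i" "b \<in> G j" "i \<noteq> - d - j"
  moreover from this(3) have "i + j + d \<noteq> 0" by linarith
  ultimately show "form a b = 0" by blast
qed

lemma supp_form: "b \<in> G k \<Longrightarrow> supp G (\<lambda>x. form x b) \<subseteq> {- d - k}"
  by (rule supp_subsetI) (auto dest: form_deg)

lemma gdual_form: "gdual B G (\<lambda>x. form x b)"
proof -
  have "b \<in> vcar B" by simp
  with graded_B show ?thesis
  proof (induction rule: graded_induct)
    case (homog k b) then show ?case by (intro gdualI[OF functional_form_right supp_form]) auto
  next
    case (add b c) then show ?case using gdual_plus by (simp add: form_simps)
  qed
qed

lemma form_homog_zero:
  assumes x: "x \<in> G i" and z: "\<And>b. b \<in> G (- d - i) \<Longrightarrow> form x b = 0"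
  shows "x = 0"
proof (rule form_nondegenerate)
  fix b :: 'b
  have "b \<in> vcar B" by simp
  with graded_B show "form x b = 0"
  proof (induction rule: graded_induct)
    case (homog k b)
    show ?case
    proof (cases "k = - d - i")
      case True then show ?thesis using homog z by simp
    next
      case False
      then have "i \<noteq> - d - k" by simp
      then show ?thesis by (rule form_deg[OF x homog])
    qed
  next
    case (add b c) then show ?case by (simp add: form_simps)
  qed
qed

lemma separates_B: "separates (Bh i) {\<lambda>x. form x b | b. b \<in> G (- d - i)}"
  unfolding separates_def
proof (intro conjI ballI impI)
  show "is_vs (Bh i)" by (rule graded_part_is_vs[OF graded_B])
next
  fix \<Phi> assume "\<Phi> \<in> {\<lambda>x. form x b | b. b \<in> G (- d - i)}"
  then show "functional (Bh i) \<Phi>"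
    using lmap_subsp[OF graded_subsp[OF graded_B] functional_form_right] by auto
next
  fix v assume "v \<in> vcar (Bh i)" "\<forall>\<Phi>\<in>{\<lambda>x. form x b | b. b \<in> G (- d - i)}. \<Phi> v = 0"
  then show "v = 0" by (intro form_homog_zero[of v i]) auto
qed

text \<open>When a vector is added to \<open>E\<close>, its remainder after subtracting the expected combination of \<open>E\<close> is
  nonzero, so it pairs to \<open>1\<close> with some \<open>b\<close>; corrected to be orthogonal to \<open>E\<close>, this \<open>b\<close> is the new dual
  vector, by which the old ones are then adjusted.\<close>

lemma dual_family:
  assumes "finite E" "\<not> module.dependent sB E"
  shows "\<exists>f. \<forall>e\<in>E. \<forall>e'\<in>E. form e' (f e) = (if e' = e then 1 else 0)"
  using assms
proof (induction E)
  case (insert e0 E)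
  interpret V: vector_space sB using is_vs_vector_space[OF is_vs_B] by simp
  have "V.independent E" using insert(4) V.independent_mono by blast
  then obtain f where f: "\<And>e e'. e \<in> E \<Longrightarrow> e' \<in> E \<Longrightarrow> form e' (f e) = (if e' = e then 1 else 0)"
    using insert(3) by blast
  define u where "u = e0 - (\<Sum>e\<in>E. sB (form e0 (f e)) e)"
  have "e0 \<notin> V.span E" using insert(2,4) V.independent_insert by simp
  moreover have "(\<Sum>e\<in>E. sB (form e0 (f e)) e) \<in> V.span E"
    by (intro V.span_sum V.span_scale V.span_base)
  ultimately have "u \<noteq> 0" by (auto simp: u_def)
  then obtain b0 where b0: "form u b0 \<noteq> 0" using form_nondegenerate by blast
  define b where "b = sB (1 / form u b0) b0"
  have b: "form u b = 1" using b0 by (simp add: b_def form_simps)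
  define f0 where "f0 = b - (\<Sum>e\<in>E. sB (form e b) (f e))"
  have E0: "form e' f0 = 0" if "e' \<in> E" for e'
  proof -
    have "form e' (\<Sum>e\<in>E. sB (form e b) (f e)) = (\<Sum>e\<in>E. if e = e' then form e b else 0)"
      unfolding lmap_sum[OF functional_form, simplified]
      by (rule sum.cong) (use that f in \<open>auto simp: form_simps\<close>)
    then show ?thesis using that insert(1) by (simp add: f0_def form_simps)
  qed
  have e00: "form e0 f0 = 1"
  proof -
    have "form e0 f0 = form e0 b - (\<Sum>e\<in>E. form e b * form e0 (f e))"
      by (simp add: f0_def form_simps lmap_sum[OF functional_form, simplified])
    also have "\<dots> = form u b"
      by (simp add: u_def form_simps lmap_sum[OF functional_form_right, simplified] mult.commute)
    finally show ?thesis using b by simp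
  qed
  let ?g = "\<lambda>e. if e = e0 then f0 else f e - sB (form e0 (f e)) f0"
  have "\<forall>e\<in>insert e0 E. \<forall>e'\<in>insert e0 E. form e' (?g e) = (if e' = e then 1 else 0)"
    using insert(2) f E0 e00 by (auto simp: form_simps)
  then show ?case by (rule exI[of _ ?g])
qed simp

text \<open>A dual family of a basis of \<open>G i\<close>, projected to degree \<open>- d - i\<close>, is complete there: the defect of
  the expansion of \<open>b\<close> is orthogonal to the basis and so to everything.\<close>

lemma dual_bases_exist:
  "\<exists>E f. finite E \<and> E \<subseteq> G i \<and> (\<forall>e\<in>E. f e \<in> G (- d - i)) \<and>
    (\<forall>b\<in>G (- d - i). (\<Sum>e\<in>E. sB (form e b) (f e)) = b)"
proof -
  interpret V: vector_space sB using is_vs_vector_space[OF is_vs_B] by simp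
  obtain S where S: "finite S" "G i = V.span S"
    using quadratic_axioms(3) by blast
  obtain E where E: "E \<subseteq> S" "V.independent E" "S \<subseteq> V.span E"
    using V.maximal_independent_subset by blast
  have fin: "finite E" using E(1) S(1) by (rule finite_subset)
  have span: "G i = V.span E"
    unfolding S(2) using E V.span_mono[of E S] V.span_minimal[of S "V.span E"] by auto
  have EG: "E \<subseteq> G i" using span V.span_superset by blast
  obtain f where f: "\<And>e e'. e \<in> E \<Longrightarrow> e' \<in> E \<Longrightarrow> form e' (f e) = (if e' = e then 1 else 0)"
    using dual_family[OF fin E(2)] by blast
  define g where "g e = gcomp G (- d - i) (f e)" for e
  have gG: "g e \<in> G (- d - i)" for e
    unfolding g_def by (rule gcomp_in[OF graded_B]) simp
  have fg: "form e' (g e) = (if e' = e then 1 else 0)" if "e \<in> E" "e' \<in> E" for e e'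
  proof -
    have "supp G (form e') \<subseteq> {- d - i}"
      unfolding ext[of "form e'" "\<lambda>x. form x e'", OF form_sym] by (rule supp_form) (use that EG in auto)
    then have "form e' (f e) = form e' (g e)"
      using functional_expand[OF graded_B functional_form, of "{- d - i}" e' "f e"] by (simp add: g_def)
    then show ?thesis using f[OF that] by simp
  qed
  have "(\<Sum>e\<in>E. sB (form e b) (g e)) = b" if b: "b \<in> G (- d - i)" for b
  proof -
    let ?z = "b - (\<Sum>e\<in>E. sB (form e b) (g e))"
    note part = graded_part_is_vs[OF graded_B, of "- d - i"]
    have sG: "sB (form e b) (g e) \<in> vcar (Bh (- d - i))" for e
      using is_vs_scale[OF part, of "g e"] gG by simp
    have zG: "?z \<in> G (- d - i)"
      using is_vs_diff[OF part _ is_vs_sum[OF part, OF sG], of b] b by simp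
    have "form e' ?z = 0" if "e' \<in> E" for e'
    proof -
      have "form e' (\<Sum>e\<in>E. sB (form e b) (g e)) = (\<Sum>e\<in>E. if e = e' then form e b else 0)"
        unfolding lmap_sum[OF functional_form, simplified]
        by (rule sum.cong) (use that fg in \<open>auto simp: form_simps\<close>)
      then show ?thesis using that fin by (simp add: form_simps)
    qed
    note zE = this
    have "form x ?z = 0" if "x \<in> G i" for x
    proof -
      have "x \<in> V.span E" using that span by simp
      then show ?thesis
        by (induction rule: V.span_induct_alt) (auto simp: form_simps(1,2,3,4,7,8) zE)
    qed
    then have "?z = 0"
      using form_homog_zero[OF zG] form_sym[of ?z] by simp
    then show ?thesis by simp
  qed
  with fin EG gG show ?thesis by blast
qed

definition base :: "int \<Rightarrow> 'b set \<times> ('b \<Rightarrow> 'b)" where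
  "base i = (SOME (E, f). finite E \<and> E \<subseteq> G i \<and> (\<forall>e\<in>E. f e \<in> G (- d - i)) \<and>
    (\<forall>b\<in>G (- d - i). (\<Sum>e\<in>E. sB (form e b) (f e)) = b))"

abbreviation "bas i \<equiv> fst (base i)"
abbreviation "dbas i \<equiv> snd (base i)"

lemma bas: "finite (bas i)" "e \<in> bas i \<Longrightarrow> e \<in> G i" "e \<in> bas i \<Longrightarrow> dbas i e \<in> G (- d - i)"
  "b \<in> G (- d - i) \<Longrightarrow> (\<Sum>e\<in>bas i. sB (form e b) (dbas i e)) = b"
proof -
  have "case base i of (E, f) \<Rightarrow> finite E \<and> E \<subseteq> G i \<and> (\<forall>e\<in>E. f e \<in> G (- d - i)) \<and>
    (\<forall>b\<in>G (- d - i). (\<Sum>e\<in>E. sB (form e b) (f e)) = b)"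
    unfolding base_def by (rule someI_ex) (use dual_bases_exist[of i] in auto)
  then show "finite (bas i)" "e \<in> bas i \<Longrightarrow> e \<in> G i" "e \<in> bas i \<Longrightarrow> dbas i e \<in> G (- d - i)"
    "b \<in> G (- d - i) \<Longrightarrow> (\<Sum>e\<in>bas i. sB (form e b) (dbas i e)) = b"
    by (auto simp: split_def)
qed

lemma casimir:
  assumes "b \<in> G (- d - i)" and \<Phi>: "functional B \<Phi>"
  shows "(\<Sum>e\<in>bas i. form e b * \<Phi> (dbas i e)) = \<Phi> b"
proof -
  have "\<Phi> b = \<Phi> (\<Sum>e\<in>bas i. sB (form e b) (dbas i e))" by (simp add: bas(4)[OF assms(1)])
  also have "\<dots> = (\<Sum>e\<in>bas i. form e b * \<Phi> (dbas i e))"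
    using lmap_scale[OF \<Phi>] by (simp add: lmap_sum[OF \<Phi>])
  finally show ?thesis by simp
qed

lemma cpairing_eq: "cpairing sB form t b c = cpair B B (\<lambda>x. form x b) (\<lambda>x. form x c) t"
  by (simp add: cpairing_def cpair_def tpair_def)

lemma cpair_form_homog:
  assumes t: "t \<in> ctensor B G B G" and b: "b \<in> G k" "c \<in> G l"
  shows "cpair B B (\<lambda>x. form x b) (\<lambda>x. form x c) t =
    tpair B B (\<lambda>x. form x b) (\<lambda>x. form x c) (t (- d - k) (- d - l))"
  by (rule cpair_homog[OF graded_B graded_B t functional_form_right functional_form_right
        supp_form[OF b(1)] supp_form[OF b(2)]])

lemma ctensor_B_eqI:
  assumes "s \<in> ctensor B G B G" "t \<in> ctensor B G B G"
    "\<And>k l b c. b \<in> G k \<Longrightarrow> c \<in> G l \<Longrightarrow> tpair B B (\<lambda>x. form x b) (\<lambda>x. form x c) (s (- d - k) (- d - l)) =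
      tpair B B (\<lambda>x. form x b) (\<lambda>x. form x c) (t (- d - k) (- d - l))"
  shows "s = t"
proof (rule ctensor_eqI[OF graded_B graded_B assms(1,2) separates_B _ separates_B])
  fix i j \<Phi> \<Psi> assume "\<Phi> \<in> {\<lambda>x. form x b | b. b \<in> G (- d - i)}" "\<Psi> \<in> {\<lambda>x. form x b | b. b \<in> G (- d - j)}"
  then show "tpair B B \<Phi> \<Psi> (s i j) = tpair B B \<Phi> \<Psi> (t i j)"
    using assms(3)[of _ "- d - i" _ "- d - j"] by auto
qed (auto simp: functional_form_right)

text \<open>Since \<open>(b \<diamond> a, c) = (a, b \<diamond> c)\<close>, the formal sum of all \<open>e \<otimes> (f \<diamond> a)\<close> over dual bases \<open>e, f\<close> has the
  pairing required of \<open>\<Delta>\<^sub>B a\<close>. As \<open>a\<close> need not be homogeneous, the second factor is cut into components.\<close>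

definition coprod :: "'b \<Rightarrow> int \<Rightarrow> int \<Rightarrow> ('k, 'b, 'b) tens" where
  "coprod a = (\<lambda>i j. \<Sum>e\<in>bas i. tens B B e (gcomp G j (mB (dbas i e) a)))"

lemma coprod_in: "coprod a \<in> ctensor B G B G"
proof -
  have "tens B B e (gcomp G j (mB (dbas i e) a)) \<in> vcar (tensor (Bh i) (Bh j))" if "e \<in> bas i" for e i j
    using tens_in_tensor[of e "Bh i" "gcomp G j (mB (dbas i e) a)" "Bh j"] bas(2)[OF that] gcomp_in[OF graded_B]
    by (simp add: tens_subsp[OF graded_subsp graded_subsp, OF graded_B graded_B])
  then show ?thesis
    by (auto simp: ctensor_def coprod_def intro!: is_vs_sum)
qed

lemma tpair_coprod:
  assumes b: "b \<in> G k" "c \<in> G l"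
  shows "tpair B B (\<lambda>x. form x b) (\<lambda>x. form x c) (coprod a (- d - k) (- d - l)) = form a (mB b c)"
proof -
  let ?i = "- d - k" and ?j = "- d - l"
  note F = functional_form_right
  have "form (gcomp G ?j z) c = form z c" for z
    using functional_expand[OF graded_B F, of "{?j}" c z] supp_form[OF b(2)] by simp
  then have "tpair B B (\<lambda>x. form x b) (\<lambda>x. form x c) (coprod a ?i ?j) =
      (\<Sum>e\<in>bas ?i. form e b * form (mB (dbas ?i e) a) c)"
    unfolding coprod_def by (simp add: tpair_sum[OF F F] tens_in_tensor tpair_tens[OF F F])
  also have "\<dots> = form (mB b a) c"
    by (rule casimir[OF _ lmap_comp[OF lmap_mB_right F]]) (use b in simp)
  finally show ?thesis by (simp add: form_mB_self_adjoint)
qed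

lemma cpair_coprod: "cpair B B (\<lambda>x. form x b) (\<lambda>x. form x c) (coprod a) = form a (mB b c)"
proof -
  note g = graded_B and gg = cpair_add_left[OF graded_B graded_B coprod_in gdual_form gdual_form gdual_form]
    cpair_add_right[OF graded_B graded_B coprod_in gdual_form gdual_form gdual_form]
  have b: "b \<in> vcar B" and c: "c \<in> vcar B" by auto
  from g b show ?thesis
  proof (induction rule: graded_induct)
    case (homog k b)
    from g c show ?case
    proof (induction rule: graded_induct)
      case (homog l c)
      then show ?case using \<open>b \<in> G k\<close> by (simp add: cpair_form_homog[OF coprod_in] tpair_coprod)
    next
      case (add c c') then show ?case by (simp add: form_simps gg mB_simps)
    qed
  next
    case (add b b') then show ?case by (simp add: form_simps gg mB_simps)
  qed
qed

lemma Delta_B_eq: "Delta_B sB G mB form a = coprod a"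
  unfolding Delta_B_def cpairing_eq
proof (rule the_equality)
  show "coprod a \<in> ctensor B G B G \<and> (\<forall>b c. cpair B B (\<lambda>x. form x b) (\<lambda>x. form x c) (coprod a) = form a (mB b c))"
    using coprod_in cpair_coprod by simp
next
  fix t assume t: "t \<in> ctensor B G B G \<and> (\<forall>b c. cpair B B (\<lambda>x. form x b) (\<lambda>x. form x c) t = form a (mB b c))"
  show "t = coprod a"
  proof (rule ctensor_B_eqI[OF _ coprod_in])
    fix k l b c assume "b \<in> G k" "c \<in> G l"
    then show "tpair B B (\<lambda>x. form x b) (\<lambda>x. form x c) (t (- d - k) (- d - l)) =
        tpair B B (\<lambda>x. form x b) (\<lambda>x. form x c) (coprod a (- d - k) (- d - l))"
      using t cpair_form_homog[of t b k c l] by (simp add: tpair_coprod)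
  qed (use t in simp)
qed

lemma lmap_coprod: "lmap B (tensor B B) (\<lambda>a. coprod a i j)"
proof (rule lmapI)
  fix c a
  have "tscale c (coprod a i j) = (\<Sum>e\<in>bas i. tscale c (tens B B e (gcomp G j (mB (dbas i e) a))))"
    using lmap_sum[OF lmap_scl[OF is_vs_tensor[of B B]], of "bas i" "\<lambda>e. tens B B e (gcomp G j (mB (dbas i e) a))" c]
    by (simp add: coprod_def tens_in_tensor)
  then show "coprod (vscl B c a) i j = vscl (tensor B B) c (coprod a i j)"
    by (simp add: coprod_def mB_simps gcomp_scale[OF graded_B, simplified] tens_linear(2)[of B B, simplified])
qed (use ctensor_in[OF graded_B graded_B coprod_in] in \<open>auto simp: coprod_def mB_simps gcomp_add[OF graded_B]
      tens_linear(1) sum.distrib\<close>)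

end

section \<open>Cobrackets agreeing on the carrier\<close>

lemma tmap_cong:
  assumes "\<And>v. v \<in> vcar V \<Longrightarrow> f v = f' v" "\<And>w. w \<in> vcar W \<Longrightarrow> g w = g' w"
  shows "tmap V W V' W' f g = tmap V W V' W' f' g'"
  unfolding tmap_def tlift_def using assms by (intro arg_cong[where f = Eps]) auto

text \<open>Lifted maps depend only on the values on the carriers.\<close>

lemma completed_lie_bialgebra_cong:
  assumes eq: "\<And>x. x \<in> vcar L \<Longrightarrow> \<delta> x = \<delta>' x" and c: "completed_lie_bialgebra L G br \<delta>"
  shows "completed_lie_bialgebra L G br \<delta>'"
proof -
  let ?c = "\<lambda>\<delta>. \<lambda>(p, q) z. \<delta> z p q"
  have t: "tmap L L L (tensor L L) (gcomp G p) (?c \<delta> q) = tmap L L L (tensor L L) (gcomp G p) (?c \<delta>' q)"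
    "tmap L L (tensor L L) L (?c \<delta> q) (gcomp G p) = tmap L L (tensor L L) L (?c \<delta>' q) (gcomp G p)" for p q
    by (rule tmap_cong; auto simp: eq split_def)+
  have m: "cmap L L L (tensor L L) (gcomp G) (?c \<delta>) = cmap L L L (tensor L L) (gcomp G) (?c \<delta>')"
    "cmap L L (tensor L L) L (?c \<delta>) (gcomp G) = cmap L L (tensor L L) L (?c \<delta>') (gcomp G)"
    "cmap_wd L L L (tensor L L) (gcomp G) (?c \<delta>) = cmap_wd L L L (tensor L L) (gcomp G) (?c \<delta>')"
    "cmap_wd L L (tensor L L) L (?c \<delta>) (gcomp G) = cmap_wd L L (tensor L L) L (?c \<delta>') (gcomp G)"
    by (intro ext; simp only: cmap_def cmap_wd_def t)+
  note C = c[unfolded completed_lie_bialgebra_def Let_def m]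
  have lie: "lie_algebra L br" and lin: "linear_on L ctscale \<delta>" using C by blast+
  have br: "br x y \<in> vcar L" if "x \<in> vcar L" "y \<in> vcar L" for x y
    using lie that by (simp add: lie_algebra_def)
  have v: "is_vs L" using lie by (simp add: lie_algebra_def)
  have "linear_on L ctscale \<delta>'"
    using lin v by (simp add: linear_on_def eq[symmetric])
  then show ?thesis
    unfolding completed_lie_bialgebra_def Let_def using C by (simp add: eq br)
qed

section \<open>The induced graded space and its bracket\<close>

locale novikov_pair = novikov sA mA + quadratic_novikov sB G mB form
  for sA :: "'k::field \<Rightarrow> 'a::ab_group_add \<Rightarrow> 'a" and mA
    and sB :: "'k \<Rightarrow> 'b::ab_group_add \<Rightarrow> 'b" and G mB form
begin

abbreviation "L \<equiv> tensor A B"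
abbreviation "LG \<equiv> induced_grading sA sB G"
abbreviation "br \<equiv> induced_bracket sA mA sB mB"

lemma LG_eq: "LG i = vcar (tensor A (Bh i))"
  by (simp add: induced_grading_def)

lemma L_part: "L\<lparr>vcar := LG i\<rparr> = tensor A (Bh i)"
  by (simp add: LG_eq tensor_def)

lemma subsp_LG: "subsp (tensor A (Bh i)) L"
  by (intro subsp_tensor graded_subsp[OF graded_B] subsp_refl is_vs_A)

lemma tens_Bh: "tens A (Bh i) = tens A B"
  by (intro tens_subsp graded_subsp[OF graded_B] subsp_refl is_vs_A)

lemma tens_in_LG: "b \<in> G i \<Longrightarrow> tens A B a b \<in> LG i"
  using tens_in_tensor[of a A b "Bh i"] by (simp add: LG_eq tens_Bh)

lemma tens_in_L: "tens A B a b \<in> vcar L"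
  by (simp add: tens_in_tensor)

lemma LG_induct [consumes 1, case_names tens add]:
  assumes "t \<in> LG i" "\<And>a b. b \<in> G i \<Longrightarrow> P (tens A B a b)"
    "\<And>s t. s \<in> LG i \<Longrightarrow> t \<in> LG i \<Longrightarrow> P s \<Longrightarrow> P t \<Longrightarrow> P (s + t)"
  shows "P t"
proof -
  have "t \<in> vcar (tensor A (Bh i))" using assms(1) by (simp add: LG_eq)
  with is_vs_A show ?thesis
    by (induction rule: tensor_induct)
      (use assms graded_part_is_vs[OF graded_B] in \<open>auto simp: tens_Bh LG_eq\<close>)
qed

lemma L_induct [consumes 1, case_names tens add]:
  assumes "t \<in> vcar L" "\<And>a b n. b \<in> G n \<Longrightarrow> P (tens A B a b)"
    "\<And>s t. s \<in> vcar L \<Longrightarrow> t \<in> vcar L \<Longrightarrow> P s \<Longrightarrow> P t \<Longrightarrow> P (s + t)"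
  shows "P t"
  using is_vs_A assms(1)
proof (induction rule: tensor_induct)
  case (tens a b)
  have "b \<in> vcar B" by simp
  with graded_B show ?case
    by (induction rule: graded_induct) (use assms(2,3) in \<open>auto simp: tens_linear tens_in_L\<close>)
qed (use assms in auto)

lemma LG_L: "t \<in> LG i \<Longrightarrow> t \<in> vcar L"
  using subspD[OF subsp_LG] by (simp add: LG_eq)

text \<open>\<open>id \<otimes> gcomp\<close>; applied to a decomposition it returns the components, which are therefore unique.\<close>

definition proj :: "int \<Rightarrow> ('k, 'a, 'b) tens \<Rightarrow> ('k, 'a, 'b) tens" where
  "proj i = tmap A B A B id (gcomp G i)"

lemma lmap_proj: "lmap L L (proj i)"
  unfolding proj_def by (intro lmap_tmap lmap_id' is_vs_A lmap_gcomp[OF graded_B])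

lemma proj_tens: "proj i (tens A B a b) = tens A B a (gcomp G i b)"
  unfolding proj_def by (subst tmap_tens[OF lmap_id'[OF is_vs_A] lmap_gcomp[OF graded_B]]) simp_all

lemma tens_zero: "tens A B a 0 = 0"
  using tens_linear(1)[of A B a 0 0] by simp

lemma proj_in: "t \<in> vcar L \<Longrightarrow> proj i t \<in> LG i"
  unfolding proj_def LG_eq
  by (rule tmap_in[OF lmap_id' lmap_gcomp[OF graded_B] _ _ _ graded_subsp[OF graded_B], of A A B])
    (use gcomp_in[OF graded_B] in auto)

lemma proj_homog: "t \<in> LG i \<Longrightarrow> proj j t = (if j = i then t else 0)"
proof (induction rule: LG_induct)
  case (tens a b) then show ?case by (simp add: proj_tens gcomp_homog[OF graded_B] tens_zero)
next
  case (add s t) then show ?case by (simp add: lmap_add[OF lmap_proj] LG_L)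
qed

lemma is_vs_LG: "is_vs (L\<lparr>vcar := LG i\<rparr>)"
  by (simp add: L_part)

lemma graded_L: "graded_space L LG"
  unfolding graded_space_def
proof (intro conjI allI ballI)
  show "is_vs L" by simp
next
  fix i show "module.subspace (vscl L) (LG i)" using is_vs_LG[of i] by (simp add: is_vs_def)
next
  fix i show "LG i \<subseteq> vcar L" using LG_L by blast
next
  fix t assume t: "t \<in> vcar L"
  have z: "0 \<in> LG i" for i using is_vs_zero[OF is_vs_LG[of i]] by simp
  have fin: "\<exists>S. finite S \<and> t = (\<Sum>i\<in>S. proj i t) \<and> (\<forall>i. i \<notin> S \<longrightarrow> proj i t = 0)"
    using t
  proof (induction rule: L_induct)
    case (tens a b n)
    then have "tens A B a b \<in> LG n" by (rule tens_in_LG)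
    then show ?case by (intro exI[of _ "{n}"]) (simp add: proj_homog)
  next
    case (add s t)
    then obtain S T where S: "finite S" "s = (\<Sum>i\<in>S. proj i s)" "\<forall>i. i \<notin> S \<longrightarrow> proj i s = 0"
      and T: "finite T" "t = (\<Sum>i\<in>T. proj i t)" "\<forall>i. i \<notin> T \<longrightarrow> proj i t = 0" by blast
    have "s = (\<Sum>i\<in>S \<union> T. proj i s)"
      by (subst S(2)) (rule sum.mono_neutral_left, use S T in auto)
    moreover have "t = (\<Sum>i\<in>S \<union> T. proj i t)"
      by (subst T(2)) (rule sum.mono_neutral_left, use S T in auto)
    ultimately have "s + t = (\<Sum>i\<in>S \<union> T. proj i (s + t))"
      using add by (simp add: lmap_add[OF lmap_proj] sum.distrib)
    moreover have "\<forall>i. i \<notin> S \<union> T \<longrightarrow> proj i (s + t) = 0"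
      using S(3) T(3) add by (simp add: lmap_add[OF lmap_proj])
    ultimately show ?case using S(1) T(1) by (intro exI[of _ "S \<union> T"]) blast
  qed
  then obtain S where S: "finite S" "t = (\<Sum>i\<in>S. proj i t)" "\<And>i. i \<notin> S \<Longrightarrow> proj i t = 0" by blast
  have f: "{i. proj i t \<noteq> 0} \<subseteq> S" using S(3) by blast
  show "\<exists>!h. is_decomp LG t h"
  proof (rule ex1I[of _ "\<lambda>i. proj i t"])
    have "t = Sum_any (\<lambda>i. proj i t)"
      by (subst Sum_any.expand_superset[OF S(1) f]) (rule S(2))
    then show "is_decomp LG t (\<lambda>i. proj i t)"
      unfolding is_decomp_def using proj_in[OF t] finite_subset[OF f S(1)] by blast
  next
    fix h assume h: "is_decomp LG t h"
    then have hi: "h i \<in> LG i" and fh: "finite {i. h i \<noteq> 0}" and ts: "t = (\<Sum>i | h i \<noteq> 0. h i)" for i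
      by (auto simp: is_decomp_def Sum_any.expand_set)
    show "h = (\<lambda>i. proj i t)"
    proof
      fix j
      have "proj j t = (\<Sum>i | h i \<noteq> 0. proj j (h i))"
        by (subst ts) (rule lmap_sum[OF lmap_proj LG_L[OF hi]])
      also have "\<dots> = (\<Sum>i | h i \<noteq> 0. if j = i then h i else 0)"
        by (simp add: proj_homog[OF hi])
      also have "\<dots> = h j" using fh by simp
      finally show "h j = proj j t" by simp
    qed
  qed
qed

lemma bilin_tens_plain: "bilin A B L (\<lambda>a b. tens A B (f a) (g b))" if "lmap A A f" "lmap B B g" for f g
  by (rule bilin_tens[OF that]) simp_all

lemma bilin_minus: "bilin V W Z F \<Longrightarrow> bilin V W Z F' \<Longrightarrow> bilin V W Z (\<lambda>v w. F v w - F' v w)"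
  by (simp add: bilin_def lmap_minus_fun)

lemma
  shows bilin_br: "bilin L L L br"
    and br_tens: "br (tens A B a1 b1) (tens A B a2 b2) = tens A B (mA a1 a2) (mB b1 b2) - tens A B (mA a2 a1) (mB b2 b1)"
proof -
  let ?K = "\<lambda>a1 b1 a2 b2. tens A B (mA a1 a2) (mB b1 b2) - tens A B (mA a2 a1) (mB b2 b1)"
  have K: "bilin A B L (?K a b)" "bilin A B L (\<lambda>a1 b1. ?K a1 b1 a b)" for a b
    by (intro bilin_minus bilin_tens_plain lmap_mA lmap_mA_right lmap_mB lmap_mB_right)+
  have e: "br = (\<lambda>s t. tlift A B (vscl L) (\<lambda>v w. tlift A B (vscl L) (?K v w) t) s)"
    by (intro ext) (simp add: induced_bracket_def Let_def)
  show "bilin L L L br"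
    unfolding e by (rule bilin_tlift2[OF _ _ _ _ _ K]) simp_all
  show "br (tens A B a1 b1) (tens A B a2 b2) = ?K a1 b1 a2 b2"
    unfolding e by (rule tlift2_tens[OF _ _ _ _ _ K]) simp_all
qed

lemmas br_lmap = bilinD(1)[OF bilin_br] bilinD(2)[OF bilin_br]
lemmas br_add = lmap_add[OF br_lmap(1)] lmap_add[OF br_lmap(2)]

lemma br_in: "u \<in> vcar L \<Longrightarrow> v \<in> vcar L \<Longrightarrow> br u v \<in> vcar L"
  using lmapD(3)[OF br_lmap(2)] .

lemma br_anticommute:
  assumes u: "u \<in> vcar L" and v: "v \<in> vcar L" shows "br u v = - br v u"
  using u
proof (induction rule: L_induct)
  case (tens a b)
  from v show ?case
    by (induction rule: L_induct) (simp_all add: br_tens br_add tens_in_L)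
next
  case (add s t) then show ?case using v by (simp add: br_add)
qed

lemma br_self: "u \<in> vcar L \<Longrightarrow> br u u = 0"
proof (induction rule: L_induct)
  case (tens a b) then show ?case by (simp add: br_tens)
next
  case (add s t) then show ?case using br_anticommute[of s t] by (simp add: br_add)
qed

lemma br_jacobi:
  assumes "u \<in> vcar L" "v \<in> vcar L" "w \<in> vcar L"
  shows "br u (br v w) + br v (br w u) + br w (br u v) = 0"
proof -
  define J where "J u v w = br u (br v w) + br v (br w u) + br w (br u v)" for u v w
  have J: "J (u + u') v w = J u v w + J u' v w" "J v (u + u') w = J v u w + J v u' w" "J v w (u + u') = J v w u + J v w u'"
    if "u \<in> vcar L" "u' \<in> vcar L" "v \<in> vcar L" "w \<in> vcar L" for u u' v w
    using that by (simp_all add: J_def br_add br_in)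
  have p: "J (tens A B a1 b1) (tens A B a2 b2) (tens A B a3 b3) = 0" for a1 b1 a2 b2 a3 b3
    using novikov_tensor_jacobi[of UNIV "tens A B" mA mB a1 a2 a3 b1 b2 b3]
      mA_left_symmetric mA_right_commutative mB_right_symmetric mB_left_commutative
    by (simp add: J_def br_tens lmap_diff[OF br_lmap(2)] tens_in_L tens_linear algebra_simps)
  have "J u v w = 0"
    using assms(1)
  proof (induction rule: L_induct)
    case (tens a b)
    from assms(2) show ?case
    proof (induction rule: L_induct)
      case (tens a' b')
      from assms(3) show ?case
        by (induction rule: L_induct) (simp_all add: p J tens_in_L)
    qed (use assms in \<open>simp add: J tens_in_L\<close>)
  qed (use assms in \<open>simp add: J\<close>)
  then show ?thesis by (simp add: J_def)
qed

lemma lie_L: "lie_algebra L br"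
  unfolding lie_algebra_def
  using bilin_br br_in br_self br_jacobi by (auto simp: bilin_def bilinear_on_def lmap_def)

lemma br_LG: "u \<in> LG i \<Longrightarrow> v \<in> LG j \<Longrightarrow> br u v \<in> LG (i + j)"
proof (induction rule: LG_induct)
  case (tens a b)
  note b = this(1)
  from \<open>v \<in> LG j\<close> show ?case
  proof (induction rule: LG_induct)
    case (tens a' b')
    have "mB b b' \<in> G (i + j)" "mB b' b \<in> G (i + j)" using mB_deg[OF b tens] mB_deg[OF tens b] by (simp_all add: add.commute)
    then show ?case
      using is_vs_diff[OF is_vs_LG[of "i + j"]] tens_in_LG by (simp add: br_tens)
  next
    case (add s t)
    then show ?case using is_vs_add[OF is_vs_LG[of "i + j"]] by (simp add: br_add tens_in_L LG_L)
  qed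
next
  case (add s t)
  then show ?case using is_vs_add[OF is_vs_LG[of "i + j"]] by (simp add: br_add LG_L)
qed

sublocale graded_lie L LG br
  by unfold_locales (fact graded_L lie_L br_LG)+

text \<open>The functional \<open>\<phi> \<otimes> (\<cdot>, b)\<close>. It lives in a single degree if \<open>b\<close> is homogeneous, and homogeneous \<open>b\<close>
  already give enough functionals to separate the homogeneous parts of \<open>L\<close>.\<close>

definition F :: "('a \<Rightarrow> 'k) \<Rightarrow> 'b \<Rightarrow> ('k, 'a, 'b) tens \<Rightarrow> 'k" where
  "F \<phi> b = tpair A B \<phi> (\<lambda>x. form x b)"

lemma functional_F: "functional A \<phi> \<Longrightarrow> functional L (F \<phi> b)"
  unfolding F_def by (rule functional_tpair[OF _ functional_form_right])

lemma F_tens: "functional A \<phi> \<Longrightarrow> F \<phi> b (tens A B a b') = \<phi> a * form b' b"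
  unfolding F_def by (simp add: tpair_tens functional_form_right)

lemma F_add: "functional A \<phi> \<Longrightarrow> functional A \<psi> \<Longrightarrow> t \<in> vcar L \<Longrightarrow> F (\<phi> + \<psi>) b t = F \<phi> b t + F \<psi> b t"
  "functional A \<phi> \<Longrightarrow> t \<in> vcar L \<Longrightarrow> F \<phi> (b + c) t = F \<phi> b t + F \<phi> c t"
  unfolding F_def by (simp_all add: tpair_add_left functional_form_right plus_fun_def form_simps tpair_add_right)

lemma supp_F: "functional A \<phi> \<Longrightarrow> b \<in> G k \<Longrightarrow> supp LG (F \<phi> b) \<subseteq> {- d - k}"
proof (rule supp_subsetI)
  fix i t assume \<phi>: "functional A \<phi>" and b: "b \<in> G k" and i: "i \<notin> {- d - k}" and t: "t \<in> LG i"
  from t show "F \<phi> b t = 0"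
    by (induction rule: LG_induct)
      (use i form_deg[OF _ b] in \<open>auto simp: F_tens[OF \<phi>] lmap_add[OF functional_F[OF \<phi>]] LG_L\<close>)
qed

lemma gdual_F: "functional A \<phi> \<Longrightarrow> b \<in> G k \<Longrightarrow> gdual L LG (F \<phi> b)"
  by (rule gdualI[OF functional_F supp_F]) auto

definition F_degree :: "int \<Rightarrow> (('k, 'a, 'b) tens \<Rightarrow> 'k) set" where
  "F_degree i = {F \<phi> b | \<phi> b. functional A \<phi> \<and> b \<in> G (- d - i)}"

lemma separates_F: "separates (L\<lparr>vcar := LG i\<rparr>) (F_degree i)"
  unfolding separates_def
proof (intro conjI ballI impI)
  show "is_vs (L\<lparr>vcar := LG i\<rparr>)" by (rule is_vs_LG)
next
  fix \<Phi> assume "\<Phi> \<in> F_degree i"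
  then show "functional (L\<lparr>vcar := LG i\<rparr>) \<Phi>"
    using lmap_subsp[OF graded_subsp[OF graded_L] functional_F] by (auto simp: F_degree_def)
next
  fix t assume t: "t \<in> vcar (L\<lparr>vcar := LG i\<rparr>)" and z: "\<forall>\<Phi>\<in>F_degree i. \<Phi> t = 0"
  then have ti: "t \<in> vcar (tensor A (Bh i))" by (simp add: LG_eq)
  show "t = 0"
  proof (rule tensor_zeroI[OF separates_functionals[OF is_vs_A] separates_B ti])
    fix \<phi> \<Psi> assume "\<phi> \<in> Collect (functional A)" "\<Psi> \<in> {\<lambda>x. form x b |b. b \<in> G (- d - i)}"
    then obtain b where \<phi>: "functional A \<phi>" and b: "b \<in> G (- d - i)" and \<Psi>: "\<Psi> = (\<lambda>x. form x b)" by auto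
    have "tpair A (Bh i) \<phi> \<Psi> t = F \<phi> b t"
      unfolding F_def \<Psi>
      by (rule tpair_cong[OF ti])
        (auto simp: graded_subsp[OF graded_B] graded_part_is_vs[OF graded_B] \<phi> functional_form_right
          intro: lmap_subsp[OF graded_subsp[OF graded_B]])
    then show "tpair A (Bh i) \<phi> \<Psi> t = 0" using z \<phi> b by (auto simp: F_degree_def)
  qed
qed

lemma ctensor_L_eqI:
  assumes "s \<in> ctensor L LG L LG" "t \<in> ctensor L LG L LG"
    "\<And>\<phi> \<psi> k l b c. functional A \<phi> \<Longrightarrow> functional A \<psi> \<Longrightarrow> b \<in> G k \<Longrightarrow> c \<in> G l \<Longrightarrow>
      tpair L L (F \<phi> b) (F \<psi> c) (s (- d - k) (- d - l)) = tpair L L (F \<phi> b) (F \<psi> c) (t (- d - k) (- d - l))"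
  shows "s = t"
proof (rule ctensor_eqI[OF graded_L graded_L assms(1,2) separates_F _ separates_F])
  fix i j \<Phi> \<Psi> assume "\<Phi> \<in> F_degree i" "\<Psi> \<in> F_degree j"
  then show "tpair L L \<Phi> \<Psi> (s i j) = tpair L L \<Phi> \<Psi> (t i j)"
    using assms(3)[of _ _ _ "- d - i" _ "- d - j"] by (auto simp: F_degree_def)
qed (auto simp: functional_F F_degree_def)

lemma cpair_F:
  assumes "t \<in> ctensor L LG L LG" "functional A \<phi>" "functional A \<psi>" "b \<in> G k" "c \<in> G l"
  shows "cpair L L (F \<phi> b) (F \<psi> c) t = tpair L L (F \<phi> b) (F \<psi> c) (t (- d - k) (- d - l))"
  by (rule cpair_homog[OF graded_L graded_L]) (use assms supp_F functional_F in auto)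

text \<open>The coadjoint action stays within the functionals \<open>F\<close>, because left multiplication of \<open>B\<close> is
  self-adjoint and right multiplication has the adjoint given by invariance.\<close>

lemma F_ad:
  assumes \<phi>: "functional A \<phi>" and z: "z \<in> vcar L"
  shows "F \<phi> b (br (tens A B a e) z) = F (\<lambda>c. \<phi> (Lstar mA a c)) (mB e b) z + F (\<lambda>c. \<phi> (mA c a)) (mB b e) z"
  using z
proof (induction rule: L_induct)
  case (tens a' b')
  have "form (mB e b') b = form b' (mB e b)" by (rule form_mB_self_adjoint)
  moreover have "\<phi> (Lstar mA a a') = \<phi> (mA a a') + \<phi> (mA a' a)"
    by (simp add: Lstar_def functional_A_simps[OF \<phi>])
  ultimately show ?case
    by (simp add: br_tens lmap_diff[OF functional_F[OF \<phi>]] tens_in_L F_tens \<phi> functional_mA[OF \<phi>] form_mB[of b' e b]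
        algebra_simps)
next
  case (add s t)
  then show ?case
    by (simp add: br_add tens_in_L lmap_add[OF functional_F[OF \<phi>]] br_in
      lmap_add[OF functional_F[OF functional_mA(2)[OF \<phi>]]] lmap_add[OF functional_F[OF functional_mA(3)[OF \<phi>]]])
qed

end

section \<open>The induced cobracket\<close>

locale novikov_ybe_pair = novikov_pair sA mA sB G mB form + novikov_ybe sA mA I x y r
  for sA :: "'k::field \<Rightarrow> 'a::ab_group_add \<Rightarrow> 'a" and mA
    and sB :: "'k \<Rightarrow> 'b::ab_group_add \<Rightarrow> 'b" and G mB form
    and I :: "'i set" and x y r
begin

abbreviation "\<delta> \<equiv> induced_cobracket sA \<Delta> sB coprod"

lemma bilin_tens_L: "bilin A A (tensor L L) (\<lambda>a a'. tens L L (tens A B a b) (tens A B a' b'))"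
  "bilin B B (tensor L L) (\<lambda>b b'. tens L L (tens A B a b) (tens A B a' b'))"
proof -
  have "lmap A L (\<lambda>a. tens A B a b)" "lmap B L (tens A B a)" for a b
    using tens_linear[of A B] by (auto intro!: lmapI simp: tens_in_L)
  then show "bilin A A (tensor L L) (\<lambda>a a'. tens L L (tens A B a b) (tens A B a' b'))"
    "bilin B B (tensor L L) (\<lambda>b b'. tens L L (tens A B a b) (tens A B a' b'))"
    by (auto intro!: bilin_tens)
qed

text \<open>\<open>u \<bullet> w\<close> in a single bidegree.\<close>

definition shuffle :: "('k, 'a, 'a) tens \<Rightarrow> ('k, 'b, 'b) tens \<Rightarrow> ('k, ('k, 'a, 'b) tens, ('k, 'a, 'b) tens) tens" where
  "shuffle u w = tlift A A tscale (\<lambda>a' a''. tlift B B tscale (\<lambda>b1 b2.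
     tens L L (tens A B a' b1) (tens A B a'' b2)) w) u"

lemma
  shows bilin_shuffle: "bilin (tensor A A) (tensor B B) (tensor L L) shuffle"
    and shuffle_tens: "shuffle (tens A A a a') (tens B B b b') = tens L L (tens A B a b) (tens A B a' b')"
  using bilin_tlift2[of A A B B "tensor L L" "\<lambda>a' a'' b1 b2. tens L L (tens A B a' b1) (tens A B a'' b2)"]
    tlift2_tens[of A A B B "tensor L L" "\<lambda>a' a'' b1 b2. tens L L (tens A B a' b1) (tens A B a'' b2)"]
  by (simp_all add: bilin_tens_L shuffle_def[abs_def])

lemma bullet_eq: "bullet sA sB u v i j = shuffle u (v i j)"
  by (simp add: bullet_def shuffle_def Let_def induced_space_def)

lemma shuffle_in:
  assumes u: "u \<in> vcar (tensor A A)" and w: "w \<in> vcar (tensor (Bh i) (Bh j))"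
  shows "shuffle u w \<in> vcar (tensor (tensor A (Bh i)) (tensor A (Bh j)))"
  using is_vs_A u
proof (induction rule: tensor_induct)
  case (tens a a')
  note sB = graded_subsp[OF graded_B]
  note sh = bilinD(2)[OF bilin_shuffle tens_in_tensor[OF tens]]
  show ?case using graded_part_is_vs[OF graded_B, of i] w
  proof (induction rule: tensor_induct)
    case (tens b b')
    have "shuffle (tens A A a a') (tens (Bh i) (Bh j) b b') =
        tens (tensor A (Bh i)) (tensor A (Bh j)) (tens A (Bh i) a b) (tens A (Bh j) a' b')"
      by (simp add: tens_subsp[OF sB sB] tens_Bh tens_subsp[OF subsp_LG subsp_LG] shuffle_tens)
    then show ?case using tens by (simp add: tens_in_tensor)
  next
    case (add s t)
    then show ?case
      using lmap_add[OF sh] subspD[OF subsp_tensor[OF sB sB]] by simp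
  qed (rule graded_part_is_vs[OF graded_B])
next
  case (add s t)
  then show ?case
    using lmap_add[OF bilinD(1)[OF bilin_shuffle subspD[OF subsp_tensor[OF graded_subsp[OF graded_B] graded_subsp[OF graded_B]] w]]]
    by simp
qed simp

lemma tpair_shuffle:
  assumes f: "functional A \<phi>" "functional A \<psi>" and u: "u \<in> vcar (tensor A A)" and w: "w \<in> vcar (tensor B B)"
  shows "tpair L L (F \<phi> b) (F \<psi> c) (shuffle u w) =
    tpair A A \<phi> \<psi> u * tpair B B (\<lambda>x. form x b) (\<lambda>x. form x c) w"
proof -
  note ff = functional_form_right
  note p = functional_tpair[OF functional_F[OF f(1)] functional_F[OF f(2)]]
    functional_tpair[OF f] functional_tpair[OF ff ff]
  show ?thesis
  proof (rule lmap_tensor_eqI[OF lmap_comp[OF bilinD(1)[OF bilin_shuffle w] p(1)] functional_mult_right[OF p(2)]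
        is_vs_A is_vs_A _ u])
    fix a a'
    assume "a \<in> vcar A" "a' \<in> vcar A"
    have aa: "tens A A a a' \<in> vcar (tensor A A)" by (simp add: tens_in_tensor)
    show "tpair L L (F \<phi> b) (F \<psi> c) (shuffle (tens A A a a') w) =
        tpair A A \<phi> \<psi> (tens A A a a') * tpair B B (\<lambda>x. form x b) (\<lambda>x. form x c) w"
      by (rule lmap_tensor_eqI[OF lmap_comp[OF bilinD(2)[OF bilin_shuffle aa] p(1)] functional_mult[OF p(3)]
            is_vs_B is_vs_B _ w])
        (simp add: shuffle_tens tpair_tens functional_F f F_tens tens_in_L ff)
  qed
qed

lemma coprod_in_BB: "coprod b i j \<in> vcar (tensor B B)"
  by (rule ctensor_in[OF graded_B graded_B coprod_in])

lemma shuffle_coprod_in: "shuffle (\<Delta> a) (coprod b i j) \<in> vcar (tensor (tensor A (Bh i)) (tensor A (Bh j)))"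
  by (rule shuffle_in[OF Delta_in ctensorD[OF coprod_in]])

lemma subsp_LL: "subsp (tensor (tensor A (Bh i)) (tensor A (Bh j))) (tensor L L)"
  by (intro subsp_tensor subsp_LG)

definition cobracket_on :: "int \<Rightarrow> int \<Rightarrow> 'a \<Rightarrow> 'b \<Rightarrow> ('k, ('k, 'a, 'b) tens, ('k, 'a, 'b) tens) tens" where
  "cobracket_on i j a b = shuffle (\<Delta> a) (coprod b i j) - tflip L L (shuffle (\<Delta> a) (coprod b j i))"

lemma bilin_cobracket_on: "bilin A B (tensor L L) (cobracket_on i j)"
proof -
  have s: "bilin A B (tensor L L) (\<lambda>a b. shuffle (\<Delta> a) (coprod b i j))" for i j
    using lmap_comp[OF lmap_Delta bilinD(1)[OF bilin_shuffle coprod_in_BB]]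
      lmap_comp[OF lmap_coprod bilinD(2)[OF bilin_shuffle Delta_in]]
    by (simp add: bilin_def)
  have "bilin A B (tensor L L) (\<lambda>a b. tflip L L (shuffle (\<Delta> a) (coprod b j i)))"
    using s[of j i] by (auto simp: bilin_def intro: lmap_comp[OF _ lmap_tflip[OF is_vs_tensor is_vs_tensor]])
  then show ?thesis unfolding cobracket_on_def[abs_def] by (intro bilin_minus s)
qed

lemma delta_eq: "\<delta> z i j = tlift A B (vscl (tensor L L)) (cobracket_on i j) z"
proof -
  have "cobracket_on i j = (\<lambda>a b. (bullet sA sB (\<Delta> a) (coprod b) - cflip L L (bullet sA sB (\<Delta> a) (coprod b))) i j)"
    by (intro ext[of "cobracket_on i j"] ext[of "cobracket_on i j _"]) (simp add: cobracket_on_def minus_apply[of "bullet sA sB _ _"]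
      minus_apply[of "bullet sA sB _ _ _"] bullet_eq cflip_def)
  then show ?thesis by (simp add: induced_cobracket_def Let_def induced_space_def)
qed

lemma lmap_delta: "lmap L (tensor L L) (\<lambda>z. \<delta> z i j)"
  and delta_tens: "\<delta> (tens A B a b) i j = cobracket_on i j a b"
  using lmap_tlift[OF is_vs_A is_vs_B is_vs_tensor bilin_cobracket_on] tlift_tens[OF is_vs_A is_vs_B is_vs_tensor bilin_cobracket_on]
  by (simp_all add: delta_eq)

lemma delta_in: "z \<in> vcar L \<Longrightarrow> \<delta> z \<in> ctensor L LG L LG"
  unfolding ctensor_def mem_Collect_eq L_part
proof (intro allI)
  fix i j assume z: "z \<in> vcar L"
  from z show "\<delta> z i j \<in> vcar (tensor (tensor A (Bh i)) (tensor A (Bh j)))"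
  proof (induction rule: L_induct)
    case (tens a b n)
    show ?case unfolding delta_tens cobracket_on_def
      by (intro is_vs_diff is_vs_tensor shuffle_coprod_in tflip_in[OF subsp_LG subsp_LG])
  next
    case (add s t) then show ?case by (simp add: lmap_add[OF lmap_delta])
  qed
qed

text \<open>The bracket of \<open>\<phi> \<otimes> b\<close> and \<open>\<psi> \<otimes> c\<close> in the Lie algebra that \<open>star\<close> and \<open>mB\<close> induce on \<open>A* \<otimes> B\<close>, as a
  functional on \<open>L\<close>.\<close>

definition dual_bracket :: "('a \<Rightarrow> 'k) \<Rightarrow> 'b \<Rightarrow> ('a \<Rightarrow> 'k) \<Rightarrow> 'b \<Rightarrow> ('k, 'a, 'b) tens \<Rightarrow> 'k" where
  "dual_bracket \<phi> b \<psi> c = (\<lambda>z. F (star \<phi> \<psi>) (mB b c) z - F (star \<psi> \<phi>) (mB c b) z)"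

lemma functional_dual_bracket: "functional A \<phi> \<Longrightarrow> functional A \<psi> \<Longrightarrow> functional L (dual_bracket \<phi> b \<psi> c)"
  unfolding dual_bracket_def by (intro lmap_minus_fun functional_F functional_star)

text \<open>On \<open>a \<otimes> e\<close>, the first part of the cobracket gives \<open>star \<phi> \<psi> a\<close> times \<open>(e, b \<diamond> c)\<close>, and its flip gives
  \<open>star \<psi> \<phi> a\<close> times \<open>(e, c \<diamond> b)\<close>.\<close>

lemma tpair_delta:
  assumes f: "functional A \<phi>" "functional A \<psi>" and b: "b \<in> G k" "c \<in> G l" and z: "z \<in> vcar L"
  shows "tpair L L (F \<phi> b) (F \<psi> c) (\<delta> z (- d - k) (- d - l)) = dual_bracket \<phi> b \<psi> c z"
proof -
  note FF = functional_F[OF f(1)] functional_F[OF f(2)]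
  note p = functional_tpair[OF FF]
  note s = functional_star[OF f] functional_star[OF f(2,1)]
  have S: "shuffle (\<Delta> a) (coprod e i j) \<in> vcar (tensor L L)" for a e i j
    using subspD[OF subsp_LL shuffle_coprod_in] .
  have T: "tflip L L (shuffle (\<Delta> a) (coprod e i j)) \<in> vcar (tensor L L)" for a e i j
    by (rule lmapD(3)[OF lmap_tflip S]) simp_all
  show ?thesis
    by (rule lmap_tensor_eqI[OF lmap_comp[OF lmap_delta p] functional_dual_bracket[OF f] is_vs_A is_vs_B _ z])
      (simp add: delta_tens cobracket_on_def lmap_diff[OF p] S T tpair_tflip[OF FF(2,1) S] tpair_shuffle f Delta_in coprod_in_BB
        tpair_coprod[OF b] tpair_coprod[OF b(2,1)] F_tens s dual_bracket_def, simp add: star_def)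
qed

lemma cpair_delta:
  assumes "functional A \<phi>" "functional A \<psi>" "b \<in> G k" "c \<in> G l" "z \<in> vcar L"
  shows "cpair L L (F \<phi> b) (F \<psi> c) (\<delta> z) = dual_bracket \<phi> b \<psi> c z"
  by (simp add: cpair_F[OF delta_in[OF assms(5)] assms(1-4)] tpair_delta[OF assms])

lemma delta_skew: "z \<in> vcar L \<Longrightarrow> \<delta> z = - cflip L L (\<delta> z)"
proof -
  assume z: "z \<in> vcar L"
  note D = delta_in[OF z] and DL = ctensor_in[OF graded_L graded_L delta_in[OF z]]
  have c: "cflip L L (\<delta> z) \<in> ctensor L LG L LG"
    using D by (auto simp: ctensor_def cflip_def L_part intro: tflip_in[OF subsp_LG subsp_LG])
  show "\<delta> z = - cflip L L (\<delta> z)"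
  proof (rule ctensor_L_eqI[OF D ctensor_minus[OF c]])
    fix \<phi> \<psi> k l b c
    assume f: "functional A \<phi>" "functional A \<psi>" and b: "b \<in> G k" "c \<in> G l"
    note FF = functional_F[OF f(1)] functional_F[OF f(2)]
    have "(- cflip L L (\<delta> z)) (- d - k) (- d - l) = - tflip L L (\<delta> z (- d - l) (- d - k))"
      by (simp only: uminus_apply cflip_def)
    then show "tpair L L (F \<phi> b) (F \<psi> c) (\<delta> z (- d - k) (- d - l)) =
        tpair L L (F \<phi> b) (F \<psi> c) ((- cflip L L (\<delta> z)) (- d - k) (- d - l))"
      using lmapD(3)[OF lmap_tflip DL]
      by (simp add: tpair_minus[OF FF] tpair_tflip[OF FF(2,1) DL] tpair_delta f b z dual_bracket_def)
  qed
qed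

lemma delta_linear: "linear_on L ctscale \<delta>"
  unfolding linear_on_def
  using lmap_add[OF lmap_delta] lmap_scale[OF lmap_delta]
  by (auto simp: fun_eq_iff[of "\<delta> _"] fun_eq_iff[of "\<delta> _ _"] ctscale_def plus_fun_apply[of "\<delta> _" "\<delta> _"]
    plus_fun_apply[of "\<delta> _ _" "\<delta> _ _"] fun_eq_iff[of "\<delta> _ _ _"] fun_eq_iff[of "\<delta> _ _ _ _"])

text \<open>The dual bracket of functionals of degrees \<open>p\<close> and \<open>q\<close> has degree \<open>d + p + q\<close>. So a component of
  the cobracket sees one degree only, and the iterated cobrackets are well defined.\<close>

lemma supp_delta: "supp LG (\<lambda>z. \<delta> z p q) \<subseteq> {d + p + q}"
proof (rule supp_subsetI)
  fix i z assume i: "i \<notin> {d + p + q}" and z: "z \<in> LG i"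
  note zL = LG_L[OF z]
  have F0: "F \<phi> e z = 0" if "functional A \<phi>" "e \<in> G (- d - p + (- d - q))" for \<phi> e
  proof -
    have "- d - (- d - p + (- d - q)) = d + p + q" by simp
    then have "i \<notin> supp LG (F \<phi> e)" using supp_F[OF that] i by auto
    then show ?thesis using z by (rule supp_zero)
  qed
  have in0: "\<delta> z p q \<in> vcar (tensor (L\<lparr>vcar := LG p\<rparr>) (L\<lparr>vcar := LG q\<rparr>))"
    by (rule ctensorD[OF delta_in[OF zL]])
  show "\<delta> z p q = 0"
  proof (rule tensor_zeroI[OF separates_F separates_F in0])
    fix \<Phi> \<Psi> assume "\<Phi> \<in> F_degree p" "\<Psi> \<in> F_degree q"
    then obtain \<phi> b \<psi> c where *: "\<Phi> = F \<phi> b" "\<Psi> = F \<psi> c" "functional A \<phi>" "functional A \<psi>"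
      "b \<in> G (- d - p)" "c \<in> G (- d - q)" by (auto simp: F_degree_def)
    have "tpair (L\<lparr>vcar := LG p\<rparr>) (L\<lparr>vcar := LG q\<rparr>) \<Phi> \<Psi> (\<delta> z p q) = tpair L L \<Phi> \<Psi> (\<delta> z p q)"
      by (rule tpair_cong[OF in0])
        (use * in \<open>auto simp: graded_subsp[OF graded_L] is_vs_LG functional_F intro: lmap_subsp[OF graded_subsp[OF graded_L]]\<close>)
    also have "\<dots> = F (star \<phi> \<psi>) (mB b c) z - F (star \<psi> \<phi>) (mB c b) z"
      using tpair_delta[OF *(3-6) zL] * by (simp add: dual_bracket_def)
    also have "\<dots> = 0"
      using F0[OF functional_star mB_deg[OF *(5,6)]] F0[OF functional_star, of \<psi> \<phi> "mB c b"] mB_deg[OF *(6,5)] *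
      by (simp add: add.commute)
    finally show "tpair (L\<lparr>vcar := LG p\<rparr>) (L\<lparr>vcar := LG q\<rparr>) \<Phi> \<Psi> (\<delta> z p q) = 0" .
  qed
qed

abbreviation "\<delta>c \<equiv> \<lambda>(p, q) z. \<delta> z p q"

lemma lmap_dc: "lmap L (tensor L L) (\<delta>c pq)" and supp_dc: "finite (supp LG (\<delta>c pq))"
  using lmap_delta[of "fst pq" "snd pq"] finite_subset[OF supp_delta[of "fst pq" "snd pq"]] by (simp_all add: split_def)

lemmas gcomp_facts = lmap_gcomp[OF graded_L] supp_id

lemma cmap_dc_wd:
  assumes "z \<in> vcar L"
  shows "cmap_wd L L L (tensor L L) (gcomp LG) \<delta>c (\<delta> z)" "cmap_wd L L (tensor L L) L \<delta>c (gcomp LG) (\<delta> z)"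
  by (rule cmap_wdI[OF graded_L graded_L delta_in[OF assms]]; rule lmap_dc supp_dc gcomp_facts)+

lemma F_gcomp:
  assumes "functional A \<phi>" "b \<in> G (- d - i)" "z \<in> vcar L"
  shows "F \<phi> b (gcomp LG i z) = F \<phi> b z"
  using functional_expand[OF graded_L functional_F[OF assms(1)], of "{i}" b z] supp_F[OF assms(1,2)] assms by simp

context
  fixes z \<phi> \<psi> \<chi> b c e i j k
  assumes z: "z \<in> vcar L" and f: "functional A \<phi>" "functional A \<psi>" "functional A \<chi>"
    and bc: "b \<in> G (- d - i)" "c \<in> G (- d - j)" "e \<in> G (- d - k)"
begin

lemma cpair_dual_bracket_right: "cpair L L (F \<phi> b) (dual_bracket \<psi> c \<chi> e) (\<delta> z) =
    dual_bracket \<phi> b (star \<psi> \<chi>) (mB c e) z - dual_bracket \<phi> b (star \<chi> \<psi>) (mB e c) z"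
proof -
  note s = functional_star[OF f(2,3)] functional_star[OF f(3,2)] and m = mB_deg[OF bc(2,3)] mB_deg[OF bc(3,2)]
  show ?thesis
    unfolding dual_bracket_def[of \<psi>]
      cpair_diff_right[OF graded_L graded_L delta_in[OF z] gdual_F[OF f(1) bc(1)] gdual_F[OF s(1) m(1)] gdual_F[OF s(2) m(2)]]
      cpair_delta[OF f(1) s(1) bc(1) m(1) z] cpair_delta[OF f(1) s(2) bc(1) m(2) z] ..
qed

lemma cpair_dual_bracket_left: "cpair L L (dual_bracket \<phi> b \<psi> c) (F \<chi> e) (\<delta> z) =
    dual_bracket (star \<phi> \<psi>) (mB b c) \<chi> e z - dual_bracket (star \<psi> \<phi>) (mB c b) \<chi> e z"
proof -
  note s = functional_star[OF f(1,2)] functional_star[OF f(2,1)] and m = mB_deg[OF bc(1,2)] mB_deg[OF bc(2,1)]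
  show ?thesis
    unfolding dual_bracket_def[of \<phi>]
      cpair_diff_left[OF graded_L graded_L delta_in[OF z] gdual_F[OF s(1) m(1)] gdual_F[OF s(2) m(2)] gdual_F[OF f(3) bc(3)]]
      cpair_delta[OF s(1) f(3) m(1) bc(3) z] cpair_delta[OF s(2) f(3) m(2) bc(3) z] ..
qed

lemma tpair_id_delta:
  assumes "cmap L L L (tensor L L) (gcomp LG) \<delta>c (\<delta> z) i (j, k) \<in> vcar (tensor L (tensor L L))" (is "?t \<in> _")
  shows "tpair (tensor L L) L (tpair L L (F \<phi> b) (F \<psi> c)) (F \<chi> e) (tassoc L L L ?t) =
    cpair L L (F \<phi> b) (dual_bracket \<psi> c \<chi> e) (\<delta> z)"
proof -
  note FF = functional_F[OF f(1)] functional_F[OF f(2)] functional_F[OF f(3)]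
  have "tpair (tensor L L) L (tpair L L (F \<phi> b) (F \<psi> c)) (F \<chi> e) (tassoc L L L ?t) =
      cpair L L (\<lambda>z. F \<phi> b (gcomp LG i z)) (\<lambda>z. tpair L L (F \<psi> c) (F \<chi> e) (\<delta>c (j, k) z)) (\<delta> z)"
    unfolding tpair_tassoc[OF FF assms]
    by (rule tpair_cmap[OF graded_L graded_L delta_in[OF z] _ _ _ _ FF(1) functional_tpair[OF FF(2,3)]];
      rule lmap_dc supp_dc gcomp_facts)
  also have "\<dots> = cpair L L (F \<phi> b) (dual_bracket \<psi> c \<chi> e) (\<delta> z)"
    by (rule cpair_cong[OF graded_L graded_L delta_in[OF z]])
      (auto intro!: lmap_comp[OF lmap_gcomp[OF graded_L] FF(1)] lmap_comp[OF lmap_delta functional_tpair[OF FF(2,3)]]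
        functional_dual_bracket FF f simp: F_gcomp[OF f(1) bc(1)] tpair_delta[OF f(2,3) bc(2,3), simplified])
  finally show ?thesis .
qed

lemma tpair_delta_id: "tpair (tensor L L) L (tpair L L (F \<phi> b) (F \<psi> c)) (F \<chi> e)
    (cmap L L (tensor L L) L \<delta>c (gcomp LG) (\<delta> z) (i, j) k) = cpair L L (dual_bracket \<phi> b \<psi> c) (F \<chi> e) (\<delta> z)"
proof -
  note FF = functional_F[OF f(1)] functional_F[OF f(2)] functional_F[OF f(3)]
  have "tpair (tensor L L) L (tpair L L (F \<phi> b) (F \<psi> c)) (F \<chi> e)
      (cmap L L (tensor L L) L \<delta>c (gcomp LG) (\<delta> z) (i, j) k) =
      cpair L L (\<lambda>z. tpair L L (F \<phi> b) (F \<psi> c) (\<delta>c (i, j) z)) (\<lambda>z. F \<chi> e (gcomp LG k z)) (\<delta> z)"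
    by (rule tpair_cmap[OF graded_L graded_L delta_in[OF z] _ _ _ _ functional_tpair[OF FF(1,2)] FF(3)];
      rule lmap_dc supp_dc gcomp_facts)
  also have "\<dots> = cpair L L (dual_bracket \<phi> b \<psi> c) (F \<chi> e) (\<delta> z)"
    by (rule cpair_cong[OF graded_L graded_L delta_in[OF z]])
      (auto intro!: lmap_comp[OF lmap_gcomp[OF graded_L] FF(3)] lmap_comp[OF lmap_delta functional_tpair[OF FF(1,2)]]
        functional_dual_bracket FF f simp: F_gcomp[OF f(3) bc(3)] tpair_delta[OF f(1,2) bc(1,2), simplified])
  finally show ?thesis .
qed

lemma dual_bracket_jacobi:
  "dual_bracket \<phi> b (star \<psi> \<chi>) (mB c e) z - dual_bracket \<phi> b (star \<chi> \<psi>) (mB e c) z -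
   (dual_bracket \<psi> c (star \<phi> \<chi>) (mB b e) z - dual_bracket \<psi> c (star \<chi> \<phi>) (mB e b) z) =
   dual_bracket (star \<phi> \<psi>) (mB b c) \<chi> e z - dual_bracket (star \<psi> \<phi>) (mB c b) \<chi> e z"
proof -
  let ?J = "\<lambda>u a v b w c. F (star u (star v w)) (mB a (mB b c)) z - F (star (star v w) u) (mB (mB b c) a) z
    - F (star u (star w v)) (mB a (mB c b)) z + F (star (star w v) u) (mB (mB c b) a) z"
  have "?J \<phi> b \<psi> c \<chi> e + ?J \<psi> c \<chi> e \<phi> b + ?J \<chi> e \<phi> b \<psi> c = 0"
  proof (rule novikov_tensor_jacobi[where C = "Collect (functional A)" and T = "\<lambda>\<phi> b. F \<phi> b z"])
    fix u v w assume uvw: "u \<in> Collect (functional A)" "v \<in> Collect (functional A)" "w \<in> Collect (functional A)"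
    show "star (star u v) w + star v (star u w) = star (star v u) w + star u (star v w)"
      using star_left_symmetric uvw by (auto simp: fun_eq_iff plus_fun_apply)
    show "star (star u v) w = star (star u w) v"
      using star_right_commutative uvw by auto
  qed (use f z in \<open>auto simp: F_add functional_star mB_right_symmetric intro: mB_left_commutative\<close>)
  then show ?thesis by (simp add: dual_bracket_def algebra_simps)
qed

end

text \<open>Paired with three functionals of the right degrees, the iterated cobrackets are the iterated
  dual brackets, and the identity becomes Jacobi for the dual bracket.\<close>

lemma co_jacobi:
  assumes z: "z \<in> vcar L"
  defines "id\<delta> \<equiv> \<lambda>t (i, j) k. tassoc L L L (cmap L L L (tensor L L) (gcomp LG) \<delta>c t i (j, k))"
    and "\<delta>id \<equiv> cmap L L (tensor L L) L \<delta>c (gcomp LG)"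
    and "\<tau>id \<equiv> \<lambda>t (i, j) k. tmap (tensor L L) L (tensor L L) L (tflip L L) id (t (j, i) k)"
  shows "id\<delta> (\<delta> z) - \<tau>id (id\<delta> (\<delta> z)) = \<delta>id (\<delta> z)"
proof -
  let ?LL = "tensor L L"
  let ?Lh = "\<lambda>i. tensor A (Bh i)"
  let ?U = "\<lambda>i j k. tensor (tensor (?Lh i) (?Lh j)) (?Lh k)"
  have gin: "gcomp LG i z \<in> vcar (?Lh i)" if "z \<in> vcar L" for i z
    using gcomp_in[OF graded_L that] by (simp add: LG_eq)
  have din: "\<delta>c (i, j) z \<in> vcar (tensor (?Lh i) (?Lh j))" if "z \<in> vcar L" for i j z
    using ctensorD[OF delta_in[OF that]] by (simp add: L_part)
  have lf: "lmap ?LL ?LL (tflip L L)" and li: "lmap L L id" by (simp_all add: lmap_tflip)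
  have m: "cmap L L L ?LL (gcomp LG) \<delta>c (\<delta> z) i (j, k) \<in> vcar (tensor (?Lh i) (tensor (?Lh j) (?Lh k)))" for i j k
    by (rule cmap_in[OF graded_L graded_L delta_in[OF z]]; (rule lmap_dc supp_dc gcomp_facts subsp_LG subsp_LL)?; (rule gin din)?)
  note mL = subspD[OF subsp_tensor[OF subsp_LG subsp_LL] m]
  have u1: "id\<delta> (\<delta> z) (i, j) k \<in> vcar (?U i j k)" for i j k
    unfolding id\<delta>_def by (simp add: tassoc_in[OF subsp_LG subsp_LG subsp_LG m])
  have u2: "\<tau>id (id\<delta> (\<delta> z)) (i, j) k \<in> vcar (?U i j k)" for i j k
    unfolding \<tau>id_def
    by (simp, rule tmap_in[OF lf li subsp_LL subsp_LG subsp_LL subsp_LG _ _ u1])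
      (auto intro: tflip_in[OF subsp_LG subsp_LG])
  have u3: "\<delta>id (\<delta> z) (i, j) k \<in> vcar (?U i j k)" for i j k
    unfolding \<delta>id_def
    by (rule cmap_in[OF graded_L graded_L delta_in[OF z]]; (rule lmap_dc supp_dc gcomp_facts subsp_LG subsp_LL)?; (rule gin din)?)
  have sU: "subsp (?U i j k) (tensor ?LL L)" for i j k by (intro subsp_tensor subsp_LG)
  note uL = subspD[OF sU u1] subspD[OF sU u2] subspD[OF sU u3]
  have main: "id\<delta> (\<delta> z) (i, j) k - \<tau>id (id\<delta> (\<delta> z)) (i, j) k = \<delta>id (\<delta> z) (i, j) k" (is "?l = ?r") for i j k
  proof -
    let ?S = "{tpair (tensor (?Lh i) (?Lh j)) (?Lh k) T \<Xi> | T \<Xi>.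
        T \<in> {tpair (?Lh i) (?Lh j) \<Phi> \<Psi> | \<Phi> \<Psi>. \<Phi> \<in> F_degree i \<and> \<Psi> \<in> F_degree j} \<and> \<Xi> \<in> F_degree k}"
    have sep: "separates (?U i j k) ?S" by (intro separates_tensor separates_F[unfolded L_part])
    have lr: "?l \<in> vcar (?U i j k)" "?r \<in> vcar (?U i j k)"
      by (intro is_vs_diff is_vs_tensor u1 u2 u3)+
    show ?thesis
    proof (rule separates_eqI[OF sep lr])
      fix X assume "X \<in> ?S"
      then obtain \<phi> b \<psi> c \<chi> e where
        X: "X = tpair (tensor (?Lh i) (?Lh j)) (?Lh k) (tpair (?Lh i) (?Lh j) (F \<phi> b) (F \<psi> c)) (F \<chi> e)"
        and f: "functional A \<phi>" "functional A \<psi>" "functional A \<chi>"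
        and bc: "b \<in> G (- d - i)" "c \<in> G (- d - j)" "e \<in> G (- d - k)"
        unfolding F_degree_def by blast
      note FF = functional_F[OF f(1)] functional_F[OF f(2)] functional_F[OF f(3)]
      let ?P = "tpair ?LL L (tpair L L (F \<phi> b) (F \<psi> c)) (F \<chi> e)"
      note p = functional_tpair[OF functional_tpair[OF FF(1,2)] FF(3)]
      have X': "X t = ?P t" if t: "t \<in> vcar (?U i j k)" for t
        unfolding X
        by (rule tpair_cong[OF t])
          (use f FF lmap_subsp[OF subsp_LG functional_F] in \<open>auto simp: subsp_LG subsp_LL functional_tpair
            intro!: tpair_cong[of _ "?Lh i" "?Lh j"]\<close>)
      have i1: "?P (id\<delta> (\<delta> z) (i, j) k) = cpair L L (F \<phi> b) (dual_bracket \<psi> c \<chi> e) (\<delta> z)"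
        using tpair_id_delta[OF z f bc mL] by (simp add: id\<delta>_def)
      have i2: "?P (\<tau>id (id\<delta> (\<delta> z)) (i, j) k) = cpair L L (F \<psi> c) (dual_bracket \<phi> b \<chi> e) (\<delta> z)"
      proof -
        have "?P (\<tau>id (id\<delta> (\<delta> z)) (i, j) k) =
            tpair ?LL L (\<lambda>s. tpair L L (F \<phi> b) (F \<psi> c) (tflip L L s)) (F \<chi> e) (id\<delta> (\<delta> z) (j, i) k)"
          unfolding \<tau>id_def
          using tpair_tmap[OF lf li functional_tpair[OF FF(1,2)] FF(3) uL(1)] by simp
        also have "\<dots> = tpair ?LL L (tpair L L (F \<psi> c) (F \<phi> b)) (F \<chi> e) (id\<delta> (\<delta> z) (j, i) k)"
          by (rule tpair_cong_whole[OF uL(1)])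
            (use FF in \<open>auto intro!: lmap_comp[OF lf] functional_tpair simp: tpair_tflip\<close>)
        finally show ?thesis
          using tpair_id_delta[OF z f(2,1,3) bc(2,1,3) mL] by (simp add: id\<delta>_def)
      qed
      have i3: "?P (\<delta>id (\<delta> z) (i, j) k) = cpair L L (dual_bracket \<phi> b \<psi> c) (F \<chi> e) (\<delta> z)"
        unfolding \<delta>id_def by (rule tpair_delta_id[OF z f bc])
      have "?P (id\<delta> (\<delta> z) (i, j) k) - ?P (\<tau>id (id\<delta> (\<delta> z)) (i, j) k) = ?P (\<delta>id (\<delta> z) (i, j) k)"
        unfolding i1 i2 i3 cpair_dual_bracket_right[OF z f bc] cpair_dual_bracket_right[OF z f(2,1,3) bc(2,1,3)]
          cpair_dual_bracket_left[OF z f bc] by (rule dual_bracket_jacobi[OF z f bc])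
      then show "X ?l = X ?r"
        by (simp add: X' lr lmap_diff[OF p uL(1) uL(2)])
    qed
  qed
  show ?thesis
  proof (rule ext, rule ext)
    fix ij k
    have "(id\<delta> (\<delta> z) - \<tau>id (id\<delta> (\<delta> z))) ij k = id\<delta> (\<delta> z) (fst ij, snd ij) k - \<tau>id (id\<delta> (\<delta> z)) (fst ij, snd ij) k"
      by (simp add: minus_apply[of "id\<delta> (\<delta> z)"] minus_apply[of "id\<delta> (\<delta> z) _"])
    also have "\<dots> = \<delta>id (\<delta> z) ij k" using main[of "fst ij" "snd ij" k] by simp
    finally show "(id\<delta> (\<delta> z) - \<tau>id (id\<delta> (\<delta> z))) ij k = \<delta>id (\<delta> z) ij k" .
  qed
qed

section \<open>The cobracket as a coboundary\<close>

text \<open>\<open>t\<close> represents the bilinear form \<open>r(\<phi>, \<psi>) (b, c)\<close> on \<open>A* \<otimes> B\<close>. The elements \<open>r\<^sub>L\<close> of all pairs of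
  homogeneous dual bases do so.\<close>

definition lifts_r :: "(int \<Rightarrow> int \<Rightarrow> ('k, ('k, 'a, 'b) tens, ('k, 'a, 'b) tens) tens) \<Rightarrow> bool" where
  "lifts_r t \<longleftrightarrow> t \<in> ctensor L LG L LG \<and> (\<forall>\<phi> \<psi> k l. \<forall>b\<in>G k. \<forall>c\<in>G l. functional A \<phi> \<longrightarrow> functional A \<psi> \<longrightarrow>
     tpair L L (F \<phi> b) (F \<psi> c) (t (- d - k) (- d - l)) = r_pair \<phi> \<psi> * form b c)"

lemma cpair_lifts_r:
  assumes "lifts_r t" "functional A \<phi>" "functional A \<psi>" "b \<in> G k" "c \<in> G l"
  shows "cpair L L (F \<phi> b) (F \<psi> c) t = r_pair \<phi> \<psi> * form b c"
  using assms cpair_F[of t \<phi> \<psi> b k c l] by (simp add: lifts_r_def)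

text \<open>Both sides are evaluated at \<open>F \<phi> b\<close> and \<open>F \<psi> c\<close> on \<open>a \<otimes> e\<close>. Invariance rewrites every value of the form
  in terms of \<open>(e, b \<diamond> c)\<close> and \<open>(e, c \<diamond> b)\<close>; the coefficient of the former is \<open>star \<phi> \<psi> a\<close> by definition and
  that of the latter is \<open>- star \<psi> \<phi> a\<close> by skewsymmetry of \<open>r\<close>.\<close>

lemma delta_eq_ad_act:
  assumes t: "lifts_r t" and z: "z \<in> vcar L"
  shows "\<delta> z = ad_act L LG br z t"
proof -
  have tin: "t \<in> ctensor L LG L LG" using t by (simp add: lifts_r_def)
  note ad = ad_act_in[OF z tin]
  show ?thesis
  proof (rule ctensor_L_eqI[OF delta_in[OF z] ad])
    fix \<phi> \<psi> k l b c
    assume f: "functional A \<phi>" "functional A \<psi>" and b: "b \<in> G k" "c \<in> G l"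
    note FF = functional_F[OF f(1)] functional_F[OF f(2)]
    note gd = gdual_F[OF f(1) b(1)] gdual_F[OF f(2) b(2)]
    note fm = functional_mA[OF f(1)] functional_mA[OF f(2)]
    \<comment> \<open>A predicate rather than a bare equation, so that the induction replaces every occurrence of \<open>z\<close>.\<close>
    define ev where "ev w \<longleftrightarrow> F (star \<phi> \<psi>) (mB b c) w - F (star \<psi> \<phi>) (mB c b) w =
        cpair L L (\<lambda>u. F \<phi> b (br w u)) (F \<psi> c) t + cpair L L (F \<phi> b) (\<lambda>u. F \<psi> c (br w u)) t" for w
    have "ev z"
      using z
    proof (induction rule: L_induct)
      case (tens a e n)
      note eb = mB_deg[OF tens b(1)] mB_deg[OF b(1) tens] mB_deg[OF tens b(2)] mB_deg[OF b(2) tens]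
      have 1: "cpair L L (\<lambda>u. F \<phi> b (br (tens A B a e) u)) (F \<psi> c) t =
          r_pair (\<lambda>c. \<phi> (Lstar mA a c)) \<psi> * form (mB e b) c + r_pair (\<lambda>c. \<phi> (mA c a)) \<psi> * form (mB b e) c"
      proof -
        have "cpair L L (\<lambda>u. F \<phi> b (br (tens A B a e) u)) (F \<psi> c) t =
            cpair L L (\<lambda>u. F (\<lambda>c. \<phi> (Lstar mA a c)) (mB e b) u + F (\<lambda>c. \<phi> (mA c a)) (mB b e) u) (F \<psi> c) t"
          by (rule cpair_cong[OF graded_L graded_L tin])
            (auto intro!: lmap_comp[OF lmap_ad[OF tens_in_L] FF(1)] lmap_plus functional_F FF fm simp: F_ad f)
        also have "\<dots> = cpair L L (F (\<lambda>c. \<phi> (Lstar mA a c)) (mB e b)) (F \<psi> c) t + cpair L L (F (\<lambda>c. \<phi> (mA c a)) (mB b e)) (F \<psi> c) t"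
          by (rule cpair_add_left[OF graded_L graded_L tin gdual_F[OF fm(3) eb(1)] gdual_F[OF fm(2) eb(2)] gd(2)])
        finally show ?thesis
          by (simp add: cpair_lifts_r[OF t fm(3) f(2) eb(1) b(2)] cpair_lifts_r[OF t fm(2) f(2) eb(2) b(2)])
      qed
      have 2: "cpair L L (F \<phi> b) (\<lambda>u. F \<psi> c (br (tens A B a e) u)) t =
          r_pair \<phi> (\<lambda>c. \<psi> (Lstar mA a c)) * form b (mB e c) + r_pair \<phi> (\<lambda>c. \<psi> (mA c a)) * form b (mB c e)"
      proof -
        have "cpair L L (F \<phi> b) (\<lambda>u. F \<psi> c (br (tens A B a e) u)) t =
            cpair L L (F \<phi> b) (\<lambda>u. F (\<lambda>c. \<psi> (Lstar mA a c)) (mB e c) u + F (\<lambda>c. \<psi> (mA c a)) (mB c e) u) t"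
          by (rule cpair_cong[OF graded_L graded_L tin])
            (auto intro!: lmap_comp[OF lmap_ad[OF tens_in_L] FF(2)] lmap_plus functional_F FF fm simp: F_ad f)
        also have "\<dots> = cpair L L (F \<phi> b) (F (\<lambda>c. \<psi> (Lstar mA a c)) (mB e c)) t + cpair L L (F \<phi> b) (F (\<lambda>c. \<psi> (mA c a)) (mB c e)) t"
          by (rule cpair_add_right[OF graded_L graded_L tin gd(1) gdual_F[OF fm(6) eb(3)] gdual_F[OF fm(5) eb(4)]])
        finally show ?thesis
          by (simp add: cpair_lifts_r[OF t f(1) fm(6) b(1) eb(3)] cpair_lifts_r[OF t f(1) fm(5) b(1) eb(4)])
      qed
      have L1: "r_pair (\<lambda>c. \<phi> (Lstar mA a c)) \<psi> = r_pair (\<lambda>c. \<phi> (mA a c)) \<psi> + r_pair (\<lambda>c. \<phi> (mA c a)) \<psi>"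
        using r_pair_add(1)[OF fm(1,2) f(2)] by (simp add: Lstar_def functional_A_simps[OF f(1)])
      have L2: "r_pair \<phi> (\<lambda>c. \<psi> (Lstar mA a c)) = r_pair \<phi> (\<lambda>c. \<psi> (mA a c)) + r_pair \<phi> (\<lambda>c. \<psi> (mA c a))"
        using r_pair_add(2)[OF fm(4,5) f(1)] by (simp add: Lstar_def functional_A_simps[OF f(2)])
      have s1: "star \<phi> \<psi> a = - r_pair (\<lambda>c. \<phi> (mA a c)) \<psi> - r_pair \<phi> (\<lambda>c. \<psi> (Lstar mA a c))"
        by (rule star_r_pair[OF f])
      \<comment> \<open>Skewsymmetry brings \<open>\<phi>\<close> to the first slot.\<close>
      have s2: "star \<psi> \<phi> a = r_pair \<phi> (\<lambda>c. \<psi> (mA a c)) + r_pair (\<lambda>c. \<phi> (Lstar mA a c)) \<psi>"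
        using star_r_pair[OF f(2,1), of a] r_pair_skew[OF f(1) fm(4)[of a]] r_pair_skew[OF fm(3)[of a] f(2)] by simp
      have b1: "form (mB e b) c = - form e (mB b c) - form e (mB c b)" by (rule form_mB)
      have b2: "form (mB b e) c = form e (mB b c)" by (rule form_mB_self_adjoint)
      have b3: "form b (mB e c) = - form e (mB b c) - form e (mB c b)"
        using form_mB[of e c b] form_sym[of b] by simp
      have b4: "form b (mB c e) = form e (mB c b)"
        using form_mB_self_adjoint[of c b e] form_sym[of e] form_mB_swap[of c b e] form_sym[of b "mB c e"] by simp
      show ?case
        unfolding ev_def 1 2 F_tens[OF functional_star[OF f]] F_tens[OF functional_star[OF f(2,1)]] s1 s2 b1 b2 b3 b4 L1 L2
        by (simp add: algebra_simps)
    next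
      case (add u v)
      note s = functional_star[OF f] functional_star[OF f(2,1)]
      have uv: "u + v \<in> vcar L" using add by simp
      note ga = gdual_ad[OF gd(1)] gdual_ad[OF gd(2)]
      have "cpair L L (\<lambda>w. F \<phi> b (br (u + v) w)) (F \<psi> c) t =
          cpair L L (\<lambda>w. F \<phi> b (br u w) + F \<phi> b (br v w)) (F \<psi> c) t"
        by (rule cpair_cong[OF graded_L graded_L tin])
          (use add(1,2) uv in \<open>auto intro!: lmap_plus lmap_comp[OF lmap_ad FF(1)] FF simp: br_add lmap_add[OF FF(1)] br_in\<close>)
      moreover have "cpair L L (F \<phi> b) (\<lambda>w. F \<psi> c (br (u + v) w)) t =
          cpair L L (F \<phi> b) (\<lambda>w. F \<psi> c (br u w) + F \<psi> c (br v w)) t"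
        by (rule cpair_cong[OF graded_L graded_L tin])
          (use add(1,2) uv in \<open>auto intro!: lmap_plus lmap_comp[OF lmap_ad FF(2)] FF simp: br_add lmap_add[OF FF(2)] br_in\<close>)
      ultimately show ?case
        using add unfolding ev_def by (simp add: cpair_add_left[OF graded_L graded_L tin ga(1) ga(1) gd(2)]
          cpair_add_right[OF graded_L graded_L tin gd(1) ga(2) ga(2)]
          lmap_add[OF functional_F[OF s(1)]] lmap_add[OF functional_F[OF s(2)]]) (simp add: algebra_simps)
    qed
    then show "tpair L L (F \<phi> b) (F \<psi> c) (\<delta> z (- d - k) (- d - l)) =
        tpair L L (F \<phi> b) (F \<psi> c) (ad_act L LG br z t (- d - k) (- d - l))"
      using cpair_F[OF ad f b] cpair_ad_act[OF z tin gd] tpair_delta[OF f b z] by (simp add: ev_def dual_bracket_def)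
  qed
qed

text \<open>Any bidegree-wise finite system that resolves the form gives an element representing \<open>r\<close>.\<close>

lemma lifts_r_sum:
  assumes fin: "\<And>i j. finite (P i j)"
    and P: "\<And>i j p. p \<in> P i j \<Longrightarrow> e p \<in> G i \<and> f p \<in> G j"
    and dual: "\<And>k l b c. b \<in> G k \<Longrightarrow> c \<in> G l \<Longrightarrow>
      (\<Sum>p\<in>P (- d - k) (- d - l). form (e p) b * form (f p) c) = form b c"
  shows "lifts_r (\<lambda>i j. \<Sum>p\<in>P i j. \<Sum>\<alpha>\<in>I. tens L L (tens A B (x \<alpha>) (e p)) (tens A B (y \<alpha>) (f p)))"
    (is "lifts_r ?t")
proof -
  have "tens L L (tens A B (x \<alpha>) (e p)) (tens A B (y \<alpha>) (f p)) \<in> vcar (tensor (tensor A (Bh i)) (tensor A (Bh j)))"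
    if "p \<in> P i j" for p i j \<alpha>
    using tens_in_tensor[of _ "tensor A (Bh i)" _ "tensor A (Bh j)"] tens_in_LG[of "e p" i] tens_in_LG[of "f p" j] P[OF that]
    by (simp add: tens_subsp[OF subsp_LG subsp_LG] LG_eq)
  then have "?t \<in> ctensor L LG L LG"
    by (auto simp: ctensor_def L_part intro!: is_vs_sum)
  moreover have "tpair L L (F \<phi> b) (F \<psi> c) (?t (- d - k) (- d - l)) = r_pair \<phi> \<psi> * form b c"
    if b: "b \<in> G k" "c \<in> G l" and f: "functional A \<phi>" "functional A \<psi>" for \<phi> \<psi> k l b c
  proof -
    note FF = functional_F[OF f(1)] functional_F[OF f(2)]
    have "tpair L L (F \<phi> b) (F \<psi> c) (?t (- d - k) (- d - l)) =
        (\<Sum>p\<in>P (- d - k) (- d - l). \<Sum>\<alpha>\<in>I. \<phi> (x \<alpha>) * \<psi> (y \<alpha>) * (form (e p) b * form (f p) c))"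
      by (simp add: tpair_sum[OF FF] is_vs_sum tens_in_tensor tpair_tens[OF FF] F_tens f mult_ac)
    also have "\<dots> = r_pair \<phi> \<psi> * (\<Sum>p\<in>P (- d - k) (- d - l). form (e p) b * form (f p) c)"
      by (simp add: r_pair_sum[OF f] sum_product sum.swap[of _ I])
    finally show ?thesis by (simp add: dual[OF b])
  qed
  ultimately show ?thesis by (simp add: lifts_r_def)
qed

lemma lifts_r_exists: "\<exists>t. lifts_r t"
proof -
  \<comment> \<open>The index remembers the degree, because the dual vectors depend on it.\<close>
  let ?P = "\<lambda>i j. if j = - d - i then bas i \<times> {i} else {}"
  have "lifts_r (\<lambda>i j. \<Sum>p\<in>?P i j. \<Sum>\<alpha>\<in>I. tens L L (tens A B (x \<alpha>) (fst p)) (tens A B (y \<alpha>) (dbas (snd p) (fst p))))"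
  proof (rule lifts_r_sum)
    fix k l b c assume b: "b \<in> G k" "c \<in> G l"
    show "(\<Sum>p\<in>?P (- d - k) (- d - l). form (fst p) b * form (dbas (snd p) (fst p)) c) = form b c"
    proof (cases "l = - d - k")
      case True
      have product: "bas i \<times> {i} = (\<lambda>e. (e, i)) ` bas i" for i by auto
      from True have "(\<Sum>p\<in>?P (- d - k) (- d - l). form (fst p) b * form (dbas (snd p) (fst p)) c) =
          (\<Sum>e\<in>bas (- d - k). form e b * form (dbas (- d - k) e) c)"
        using sum.reindex[of "\<lambda>e. (e, - d - k)" "bas (- d - k)" "\<lambda>p. form (fst p) b * form (dbas (snd p) (fst p)) c"]
        by (simp add: inj_on_def product comp_def)
      also have "\<dots> = form b c"
        by (rule casimir[OF _ functional_form_right]) (use b in simp)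
      finally show ?thesis .
    next
      case False
      then have "k \<noteq> - d - l" by auto
      then show ?thesis using False form_deg[OF b] by simp
    qed
  qed (use bas in \<open>auto split: if_splits\<close>)
  then show ?thesis by blast
qed

lemma completed_lie_bialgebra_delta: "completed_lie_bialgebra L LG br \<delta>"
proof -
  obtain t where t: "lifts_r t" using lifts_r_exists by blast
  then have tin: "t \<in> ctensor L LG L LG" by (simp add: lifts_r_def)
  have co: "\<delta> (br u v) = ad_act L LG br u (\<delta> v) - ad_act L LG br v (\<delta> u)"
    if "u \<in> vcar L" "v \<in> vcar L" for u v
    using that by (simp add: delta_eq_ad_act[OF t] br_in ad_act_bracket[OF _ _ tin])
  show ?thesis
    unfolding completed_lie_bialgebra_def Let_def
    by (intro conjI ballI graded_L lie_L delta_in delta_linear cmap_dc_wd ad_act_wdI delta_skew co_jacobi co)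
qed

text \<open>A homogeneous \<open>b\<close> is the finite sum of the \<open>(e p, b) f p\<close>, and the grading of the form leaves only \<open>p\<close>
  of the bidegree at hand. Each such set of \<open>p\<close> is finite because the \<open>e p\<close> are independent in a
  finite-dimensional \<open>G i\<close>.\<close>

lemma lifts_r_r_L:
  assumes e: "homogeneous_basis sB G \<Pi> e" and f: "homogeneous_basis sB G \<Pi> f"
    and dual: "\<forall>p\<in>\<Pi>. \<forall>q\<in>\<Pi>. form (e p) (f q) = (if p = q then 1 else 0)"
  shows "lifts_r (r_L sA I x y sB G \<Pi> e f)"
proof -
  interpret V: vector_space sB using is_vs_vector_space[OF is_vs_B] by simp
  let ?P = "\<lambda>i j. {p\<in>\<Pi>. e p \<in> G i \<and> f p \<in> G j}"
  have fin: "finite (?P i j)" for i j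
  proof -
    obtain S where S: "finite S" "G i = V.span S" using quadratic_axioms(3) by blast
    have "V.independent (e ` ?P i j)"
      by (rule V.independent_mono[of "e ` \<Pi>"]) (use e in \<open>auto simp: homogeneous_basis_def\<close>)
    then have "finite (e ` ?P i j)"
      using V.independent_span_bound[OF S(1), of "e ` ?P i j"] S(2) by auto
    moreover have "inj_on e (?P i j)"
      by (rule inj_on_subset[of e \<Pi>]) (use e in \<open>auto simp: homogeneous_basis_def\<close>)
    ultimately show ?thesis by (rule finite_imageD)
  qed
  have eq: "r_L sA I x y sB G \<Pi> e f = (\<lambda>i j. \<Sum>p\<in>?P i j. \<Sum>\<alpha>\<in>I. tens L L (tens A B (x \<alpha>) (e p)) (tens A B (y \<alpha>) (f p)))"
    by (simp add: r_L_def Let_def induced_space_def)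
  show ?thesis
    unfolding eq
  proof (rule lifts_r_sum[OF fin])
    fix k l b c assume b: "b \<in> G k" "c \<in> G l"
    have "b \<in> V.span (f ` \<Pi>)" using f by (simp add: homogeneous_basis_def)
    then obtain T u where T: "finite T" "T \<subseteq> f ` \<Pi>" "b = (\<Sum>v\<in>T. sB (u v) v)"
      unfolding V.span_explicit by auto
    obtain S where S: "S \<subseteq> \<Pi>" "finite S" "T = f ` S"
      using finite_subset_image[OF T(1,2)] by blast
    have inj: "inj_on f S" using f S(1) by (auto simp: homogeneous_basis_def intro: inj_on_subset)
    have bS: "b = (\<Sum>p\<in>S. sB (u (f p)) (f p))"
      using T(3) by (simp add: S(3) sum.reindex[OF inj])
    have co: "form (e q) b = (if q \<in> S then u (f q) else 0)" if "q \<in> \<Pi>" for q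
    proof -
      have "form (e q) b = (\<Sum>p\<in>S. if p = q then u (f p) else 0)"
        unfolding bS lmap_sum[OF functional_form, simplified]
        by (rule sum.cong) (use dual that S(1) in \<open>auto simp: form_simps\<close>)
      then show ?thesis using S(2) by simp
    qed
    have z: "form (e p) b * form (f p) c = 0" if p: "p \<in> \<Pi>" "p \<notin> ?P (- d - k) (- d - l)" for p
    proof -
      obtain i j where ij: "e p \<in> G i" "f p \<in> G j"
        using e f p(1) unfolding homogeneous_basis_def by blast
      have "i \<noteq> - d - k \<or> j \<noteq> - d - l" using p ij by auto
      then show ?thesis using form_deg[OF ij(1) b(1)] form_deg[OF ij(2) b(2)] by auto
    qed
    have "(\<Sum>p\<in>?P (- d - k) (- d - l). form (e p) b * form (f p) c) =
        (\<Sum>p\<in>?P (- d - k) (- d - l) \<union> S. form (e p) b * form (f p) c)"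
      by (rule sum.mono_neutral_left) (use fin S(1,2) z in auto)
    also have "\<dots> = (\<Sum>p\<in>S. form (e p) b * form (f p) c)"
      by (rule sum.mono_neutral_right) (use fin S(2) co in auto)
    also have "\<dots> = (\<Sum>p\<in>S. u (f p) * form (f p) c)"
      by (rule sum.cong) (use co S(1) in auto)
    also have "\<dots> = form b c"
      by (simp add: bS lmap_sum[OF functional_form_right, simplified] form_simps)
    finally show "(\<Sum>p\<in>?P (- d - k) (- d - l). form (e p) b * form (f p) c) = form b c" .
  qed auto
qed

end

section \<open>The completed Lie bialgebra of a skewsymmetric solution\<close>

theorem corollary4p5:
  fixes sA :: "'k::field_char_0 \<Rightarrow> 'a::ab_group_add \<Rightarrow> 'a"
    and mA :: "'a \<Rightarrow> 'a \<Rightarrow> 'a"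
    and sB :: "'k \<Rightarrow> 'b::ab_group_add \<Rightarrow> 'b"
    and G :: "int \<Rightarrow> 'b set"
    and mB :: "'b \<Rightarrow> 'b \<Rightarrow> 'b"
    and form :: "'b \<Rightarrow> 'b \<Rightarrow> 'k"
    and I :: "'i set"
    and x y :: "'i \<Rightarrow> 'a"
    and r :: "('k, 'a, 'a) tens"
  assumes A: "novikov_algebra sA mA"
    and A_fin_dim: "\<exists>Bs. finite_dimensional_vector_space sA Bs"
    and B: "quadratic_graded_right_novikov sB G mB form"
    and I: "finite I"
    and r: "r = (\<Sum>\<alpha>\<in>I. tens (whole sA) (whole sA) (x \<alpha>) (y \<alpha>))"
    and skew: "tflip (whole sA) (whole sA) r = - r"
    and nybe: "nybe sA mA I x y"
  shows
    "let \<Delta>A = (\<lambda>a. - Delta_r sA mA r a);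
         \<Delta>B = Delta_B sB G mB form;
         L = induced_space sA sB;
         LG = induced_grading sA sB G;
         br = induced_bracket sA mA sB mB;
         \<delta> = induced_cobracket sA \<Delta>A sB \<Delta>B
     in novikov_bialgebra sA mA \<Delta>A \<and>
        (\<forall>a. \<Delta>B a \<in> ctensor (whole sB) G (whole sB) G \<and>
             (\<forall>b c. cpairing sB form (\<Delta>B a) b c = form a (mB b c))) \<and>
        completed_lie_bialgebra L LG br \<delta> \<and>
        (\<forall>(\<Pi> :: 'p set) e f.
           homogeneous_basis sB G \<Pi> e \<and> homogeneous_basis sB G \<Pi> f \<and>
           (\<forall>p\<in>\<Pi>. \<forall>q\<in>\<Pi>. form (e p) (f q) = (if p = q then 1 else 0)) \<longrightarrow>
           (let rL = r_L sA I x y sB G \<Pi> e f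
            in rL \<in> ctensor L LG L LG \<and>
               (\<forall>z\<in>vcar L. ad_act_wd L LG br z rL) \<and>
               completed_lie_bialgebra L LG br (\<lambda>z. ad_act L LG br z rL) \<and>
               (\<forall>z\<in>vcar L. \<delta> z = ad_act L LG br z rL)))"
proof -
  have V: "novikov_ybe sA mA I x y r"
    by unfold_locales (fact A I r skew nybe)+
  have Q: "quadratic_novikov sB G mB form"
    by unfold_locales (fact B)
  interpret novikov_ybe sA mA I x y r by (rule V)
  interpret quadratic_novikov sB G mB form by (rule Q)
  interpret novikov_ybe_pair sA mA sB G mB form I x y r by unfold_locales
  have D: "(\<lambda>a. - Delta_r sA mA r a) = \<Delta>" by (simp add: \<Delta>_def[abs_def])
  have DB: "Delta_B sB G mB form = coprod" by (rule ext) (rule Delta_B_eq)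
  have rL: "r_L sA I x y sB G \<Pi> e f \<in> ctensor L LG L LG \<and>
      (\<forall>z\<in>vcar L. ad_act_wd L LG br z (r_L sA I x y sB G \<Pi> e f)) \<and>
      completed_lie_bialgebra L LG br (\<lambda>z. ad_act L LG br z (r_L sA I x y sB G \<Pi> e f)) \<and>
      (\<forall>z\<in>vcar L. \<delta> z = ad_act L LG br z (r_L sA I x y sB G \<Pi> e f))"
    if "homogeneous_basis sB G \<Pi> e \<and> homogeneous_basis sB G \<Pi> f \<and>
      (\<forall>p\<in>\<Pi>. \<forall>q\<in>\<Pi>. form (e p) (f q) = (if p = q then 1 else 0))"
    for \<Pi> :: "'p set" and e f
  proof -
    have t: "lifts_r (r_L sA I x y sB G \<Pi> e f)" using that by (intro lifts_r_r_L) auto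
    then have tin: "r_L sA I x y sB G \<Pi> e f \<in> ctensor L LG L LG" by (simp add: lifts_r_def)
    show ?thesis
      using tin ad_act_wdI[OF _ tin] delta_eq_ad_act[OF t]
        completed_lie_bialgebra_cong[OF delta_eq_ad_act[OF t] completed_lie_bialgebra_delta] by blast
  qed
  show ?thesis
    unfolding Let_def D DB induced_space_def[of sA sB] cpairing_eq
    by (intro conjI allI impI novikov_bialgebra_Delta coprod_in cpair_coprod completed_lie_bialgebra_delta)
      (use rL in blast)+
qed

end
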